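(* Let $d\ge 2$ and let the collision kernel $B$ be of hard-potential type with angular cutoff, as specified in the context. Let $f(v,t)$, $v\in\mathbb{R}^d$, $t\ge 0$, be the solution, preserving the initial mass and energy, of the spatially homogeneous Boltzmann equation $\partial_t f=Q(f)$, $f|_{t=0}=f_0$, with initial datum $f_0\ge 0$ such that $$\frac{f_0}{M_0}\in L^1(\mathbb{R}^d)$$ for a certain Maxwellian $M_0(v)=e^{-a_0|v|^2}$, where $a_0$ is a positive constant. Then there exist constants $C$ and $a>0$ such that $$\int_{\mathbb{R}^d}\frac{f(v,t)}{M(v)}\,dv\le C,\qquad t\ge 0,$$ where $M(v)=e^{-a|v|^2}$.
   Context: The collision operator is $$Q(f)(v,t)=\int_{\mathbb{R}^d}\int_{S^{d-1}}\big(f(v'_*,t)f(v',t)-f(v_*,t)f(v,t)\big)\,B(v-v_*,\sigma)\,d\sigma\,dv_*,$$ where $v'=\frac{v+v_*}{2}+\frac{|v-v_*|}{2}\sigma$, $v'_*=\frac{v+v_*}{2}-\frac{|v-v_*|}{2}\sigma$. Assumptions on $B$: $B(v-v_*,\sigma)=|v-v_*|^\beta h(\cos\vartheta)$, $\cos\vartheta=\frac{(v-v_* )\cdot\sigma}{|v-v_*|}$, where $0<\beta\le 1$ is a constant and $h$ is a nonnegative (measurable) function on $(-1,1)$ such that $h(z)+h(-z)$ is nondecreasing on $(0,1)$; $0\le h(\cos\vartheta)\sin^\alpha\vartheta\le C'$ for $\vartheta\in(0,\pi)$, where $\alpha<d-1$ and $C'$ are constants; and the normalization $\int_{S^{d-1}}h(\cos\vartheta)\,d\sigma=1$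 holds. Solution concept: a nonnegative function $f\in C([0,\infty);L^1(\mathbb{R}^d))$ with $(1+|v|^2)f\in L^\infty((0,\infty);L^1(\mathbb{R}^d))$ is a (mild) solution if for almost all $v\in\mathbb{R}^d$: $f(v,0)=f_0(v)$ and $f(v,t)-f(v,s)=\int_s^t Q(f)(v,\tau)\,d\tau$ for all $0\le s<t$. It preserves mass and energy if $\int f(v,t)\,dv=\int f_0(v)\,dv$ and $\int f(v,t)|v|^2\,dv=\int f_0(v)|v|^2\,dv$ for all $t\ge0$; for $f_0\ge0$ with finite mass and energy such a solution is known to exist and be unique. *)

theory Defs
  imports "HOL-Analysis.Analysis"
begin

text \<open>The unnormalised surface measure \<open>d\<sigma>\<close> on the unit sphere, obtained from Lebesgue measure by
  polar coordinates: \<open>\<sigma>(A) = d \<cdot> vol {x. 0 < |x| < 1, x/|x| \<in> A}\<close>.\<close>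

definition sphere_measure :: "'a::euclidean_space measure" where
  "sphere_measure = scale_measure (of_nat DIM('a))
     (distr (restrict_space lborel (ball 0 1 - {0})) (restrict_space borel (sphere 0 1)) sgn)"

lemma space_sphere_measure: "space sphere_measure = sphere (0::'a::euclidean_space) 1"
  by (simp add: sphere_measure_def space_scale_measure space_restrict_space)

lemma emeasure_sphere_measure:
  fixes A :: "'a::euclidean_space set"
  assumes "A \<in> sets borel" "A \<subseteq> sphere 0 1"
  shows "emeasure sphere_measure A =
    of_nat DIM('a) * emeasure lborel {x. 0 < norm x \<and> norm x < 1 \<and> x /\<^sub>R norm x \<in> A}"
proof -
  have "(sgn :: 'a \<Rightarrow> 'a) \<in> borel_measurable borel"
    unfolding sgn_div_norm[abs_def] by measurable
  then have "sgn \<in> borel_measurable (restrict_space lborel (ball (0::'a) 1 - {0}))"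
    by (intro measurable_restrict_space1) simp
  then have m: "sgn \<in> restrict_space lborel (ball 0 1 - {0}) \<rightarrow>\<^sub>M restrict_space borel (sphere (0::'a) 1)"
    by (intro measurable_restrict_space2) (auto simp: space_restrict_space norm_sgn)
  have A: "A \<in> sets (restrict_space borel (sphere (0::'a) 1))"
    using assms by (auto simp: sets_restrict_space)
  have "sgn -` A \<inter> space (restrict_space lborel (ball (0::'a) 1 - {0}))
      = {x. 0 < norm x \<and> norm x < 1 \<and> x /\<^sub>R norm x \<in> A}"
    by (auto simp: space_restrict_space sgn_div_norm)
  moreover have "{x. 0 < norm x \<and> norm x < 1 \<and> x /\<^sub>R norm x \<in> A} \<subseteq> ball (0::'a) 1 - {0}"
    by auto
  ultimately show ?thesis
    unfolding sphere_measure_def emeasure_scale_measure emeasure_distr[OF m A]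
    by (simp add: emeasure_restrict_space)
qed

definition post_velocity :: "'a::euclidean_space \<Rightarrow> 'a \<Rightarrow> 'a \<Rightarrow> 'a" where
  "post_velocity v w \<sigma> = (v + w) /\<^sub>R 2 + (norm (v - w) / 2) *\<^sub>R \<sigma>"

definition post_velocity_star :: "'a::euclidean_space \<Rightarrow> 'a \<Rightarrow> 'a \<Rightarrow> 'a" where
  "post_velocity_star v w \<sigma> = (v + w) /\<^sub>R 2 - (norm (v - w) / 2) *\<^sub>R \<sigma>"

definition collision_operator ::
  "('a::euclidean_space \<Rightarrow> 'a \<Rightarrow> real) \<Rightarrow> ('a \<Rightarrow> real) \<Rightarrow> 'a \<Rightarrow> real" where
  "collision_operator B g v =
     (\<integral>w. (\<integral>\<sigma>. (g (post_velocity_star v w \<sigma>) * g (post_velocity v w \<sigma>) - g w * g v) * B (v - w) \<sigma>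
        \<partial>sphere_measure) \<partial>lborel)"

definition cos_angle :: "'a::euclidean_space \<Rightarrow> 'a \<Rightarrow> real" where
  "cos_angle u \<sigma> = (u \<bullet> \<sigma>) / norm u"

text \<open>For \<open>u = 0\<close> the angle is undefined, but the kernel vanishes there since \<open>0 powr \<beta> = 0\<close>.
  The values of \<open>h\<close> outside \<open>(-1,1)\<close> only enter on null sets.\<close>

definition hard_potential_kernel ::
  "real \<Rightarrow> (real \<Rightarrow> real) \<Rightarrow> 'a::euclidean_space \<Rightarrow> 'a \<Rightarrow> real" where
  "hard_potential_kernel \<beta> h u \<sigma> = norm u powr \<beta> * h (cos_angle u \<sigma>)"

definition hard_potential_with_cutoff :: "('a::euclidean_space \<Rightarrow> 'a \<Rightarrow> real) \<Rightarrow> bool" where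
  "hard_potential_with_cutoff B \<longleftrightarrow>
     (\<exists>\<beta> h \<alpha> C'.
        B = hard_potential_kernel \<beta> h \<and>
        0 < \<beta> \<and> \<beta> \<le> 1 \<and>
        h \<in> borel_measurable (restrict_space borel {-1<..<1}) \<and>
        (\<forall>z\<in>{-1<..<1}. 0 \<le> h z) \<and>
        mono_on {0<..<1} (\<lambda>z. h z + h (- z)) \<and>
        \<alpha> < real DIM('a) - 1 \<and>
        (\<forall>\<theta>\<in>{0<..<pi}. 0 \<le> h (cos \<theta>) * sin \<theta> powr \<alpha> \<and> h (cos \<theta>) * sin \<theta> powr \<alpha> \<le> C') \<and>
        (\<forall>u::'a. u \<noteq> 0 \<longrightarrow> (\<integral>\<sigma>. h (cos_angle u \<sigma>) \<partial>sphere_measure) = 1))"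

text \<open>In \<open>f t v\<close> time comes first; only \<open>t \<ge> 0\<close> is relevant. Elements of \<open>L\<^sup>1\<close> are represented by
  Borel functions, with nonnegativity understood almost everywhere. The integrability of
  \<open>\<tau> \<mapsto> Q(f)(v,\<tau>)\<close> is stated explicitly because the integral of a non-integrable function is
  \<open>0\<close> by convention.\<close>

definition boltzmann_mild_solution ::
  "('a::euclidean_space \<Rightarrow> 'a \<Rightarrow> real) \<Rightarrow> ('a \<Rightarrow> real) \<Rightarrow> (real \<Rightarrow> 'a \<Rightarrow> real) \<Rightarrow> bool" where
  "boltzmann_mild_solution B f0 f \<longleftrightarrow>
     (\<forall>t\<ge>0. AE v in lborel. 0 \<le> f t v) \<and>
     (\<forall>t\<ge>0. integrable lborel (f t)) \<and>
     (\<forall>t\<ge>0. ((\<lambda>s. \<integral>v. \<bar>f s v - f t v\<bar> \<partial>lborel) \<longlongrightarrow> 0) (at t within {0..})) \<and>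
     (\<exists>K. AE t in lborel. 0 < t \<longrightarrow>
        integrable lborel (\<lambda>v. (1 + (norm v)\<^sup>2) * f t v) \<and>
        (\<integral>v. (1 + (norm v)\<^sup>2) * f t v \<partial>lborel) \<le> K) \<and>
     (AE v in lborel. f 0 v = f0 v \<and>
        (\<forall>s t. 0 \<le> s \<and> s < t \<longrightarrow>
           set_integrable lborel {s..t} (\<lambda>\<tau>. collision_operator B (f \<tau>) v) \<and>
           f t v - f s v = (LINT \<tau>:{s..t}|lborel. collision_operator B (f \<tau>) v)))"

definition preserves_mass_and_energy ::
  "('a::euclidean_space \<Rightarrow> real) \<Rightarrow> (real \<Rightarrow> 'a \<Rightarrow> real) \<Rightarrow> bool" where
  "preserves_mass_and_energy f0 f \<longleftrightarrow>
     (\<forall>t\<ge>0. has_bochner_integral lborel (f t) (\<integral>v. f0 v \<partial>lborel) \<and>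
        has_bochner_integral lborel (\<lambda>v. f t v * (norm v)\<^sup>2) (\<integral>v. f0 v * (norm v)\<^sup>2 \<partial>lborel))"

definition maxwellian :: "real \<Rightarrow> 'a::euclidean_space \<Rightarrow> real" where
  "maxwellian a v = exp (- a * (norm v)\<^sup>2)"

end

theory Submission
  imports Defs
begin

text \<open>The excess moment \<open>z(t) = \<integral> f(v,t) \<psi>(a |v|\<^sup>2) dv\<close> with \<open>\<psi>(x) = e\<^sup>x - 1 - x\<close> is followed directly, without
  expanding it into polynomial moments; the subtracted linear part is conserved. The identity
  \<open>\<psi>(x + y) = \<psi>(x) + \<psi>(y) + (e\<^sup>x - 1)(e\<^sup>y - 1)\<close> and the strict convexity of \<open>\<psi>\<close> bound \<open>z'\<close> by a product
  of two exponential moments minus a multiple of \<open>\<integral> f |v|\<^sup>\<beta> \<psi>(a |v|\<^sup>2) dv\<close>. For small \<open>a\<close> and as long as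
  \<open>z\<close> is small, the product is absorbed up to a small constant, so \<open>z\<close> stays small.

  Since only mass and energy of \<open>f(\<cdot>,t)\<close> are known to be finite, \<open>\<psi>\<close> is first replaced beyond \<open>N\<close> by its
  tangent. This keeps the gain estimate but leaves damping only by the moment of \<open>\<psi>(min(a |v|\<^sup>2, N))\<close>,
  which suffices for a time step that does not depend on \<open>N\<close>; letting \<open>N \<rightarrow> \<infinity>\<close> there recovers the full
  damping and the argument is iterated. By rotation invariance and compactness,
  \<open>\<integral> h(cos \<theta>) (1 - (e \<bullet> \<sigma>)\<^sup>2) d\<sigma>\<close> is bounded below uniformly in the relative velocity and in the unit
  vector \<open>e\<close>, which makes the convexity gain quantitative.\<close>

section \<open>Lebesgue measure and the sphere\<close>

text \<open>The gain carries a moment weighted by \<open>norm v powr \<beta>\<close>, of the same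
  order as the damping, so it is absorbed through a small factor rather than through a difference of
  orders. That factor is the unweighted exponential moment, at most the excess moment plus
  \<open>a * energy\<close>; each of these is kept below \<open>\<delta> = c / 8\<close>, with
  \<open>c\<close> the damping coefficient, and half of the damping survives.

  The weak form is available for bounded test functions only: finite mass and energy make the
  collision rate integrable but give no higher moments. The truncated excess function differs from
  its asymptotic slope times |v|^2 by a bounded function, and |v|^2 is a collision invariant whose
  moment is constant in time, so the bounded remainder carries the whole evolution.

  The measure theory rests on one invariance: the collision, with the old direction of the relative
  velocity kept as the new angle, preserves \<open>collision_measure\<close>. It yields the weak
  form, and it shows that outgoing velocities almost never fall into a given null set, so the
  solution may be changed on a null set of velocities for all times at once.\<close>

lemma distr_lborel_uminus: "distr lborel borel uminus = (lborel :: 'a::euclidean_space measure)"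
  using lborel_affine[of "-1" "0::'a"] by (simp add: density_1)

lemma nn_integral_lborel_translate:
  fixes F :: "'a::euclidean_space \<Rightarrow> ennreal"
  assumes [measurable]: "F \<in> borel_measurable borel"
  shows "(\<integral>\<^sup>+x. F (c + x) \<partial>lborel) = (\<integral>\<^sup>+x. F x \<partial>lborel)"
  by (subst (2) lborel_distr_plus[of c, symmetric]) (simp add: nn_integral_distr)

lemma nn_integral_lborel_reflect:
  fixes F :: "'a::euclidean_space \<Rightarrow> ennreal"
  assumes [measurable]: "F \<in> borel_measurable borel"
  shows "(\<integral>\<^sup>+x. F (c - x) \<partial>lborel) = (\<integral>\<^sup>+x. F x \<partial>lborel)"
proof -
  have "(\<integral>\<^sup>+x. F (c - x) \<partial>lborel) = (\<integral>\<^sup>+x. F (c + x) \<partial>distr lborel borel uminus)"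
    by (subst nn_integral_distr) simp_all
  then show ?thesis
    by (simp add: distr_lborel_uminus nn_integral_lborel_translate)
qed

lemma borel_measurable_orthogonal_transformation:
  fixes T :: "'a::euclidean_space \<Rightarrow> 'a"
  assumes "orthogonal_transformation T"
  shows "T \<in> borel_measurable borel"
  using orthogonal_transformation_linear[OF assms]
  by (simp add: linear_continuous_on borel_measurable_continuous_onI linear_conv_bounded_linear)

text \<open>The two orders of integration of \<open>1\<^sub>A(x) 1\<^sub>B(y - x)\<close> give \<open>\<mu>(A) \<lambda>(B) = \<lambda>(A) \<mu>(-B)\<close> for every
  translation invariant \<open>\<mu>\<close>; a ball \<open>B\<close> then fixes the constant.\<close>

lemma distr_lborel_isometry:
  fixes T :: "'a::euclidean_space \<Rightarrow> 'a"
  assumes T: "orthogonal_transformation T"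
  shows "distr lborel borel T = lborel"
proof (rule measure_eqI)
  fix A assume "A \<in> sets (distr lborel borel T)"
  then have A[measurable]: "A \<in> sets borel" by simp
  have lin: "linear T" using T by (simp add: orthogonal_transformation_linear)
  have [measurable]: "T \<in> borel_measurable borel" by (rule borel_measurable_orthogonal_transformation[OF T])
  define M where "M = distr lborel borel T"
  have setsM[simp, measurable_cong]: "sets M = sets borel" and spM[simp]: "space M = UNIV" by (simp_all add: M_def)
  have ball: "emeasure M (ball 0 r) = emeasure lborel (ball (0::'a) r)" for r
    unfolding M_def using T
    by (subst emeasure_distr) (auto intro!: arg_cong[where f="emeasure lborel"] simp: orthogonal_transformation_norm)
  have Mtr: "(\<integral>\<^sup>+x. F (x + c) \<partial>M) = (\<integral>\<^sup>+x. F x \<partial>M)"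
    if [measurable]: "F \<in> borel_measurable borel" for c and F :: "'a \<Rightarrow> ennreal"
  proof -
    obtain c' where c': "T c' = c" using T orthogonal_transformation_surj by (metis surjD)
    have "(\<integral>\<^sup>+x. F (x + c) \<partial>M) = (\<integral>\<^sup>+x. F (T (c' + x)) \<partial>lborel)"
      unfolding M_def using lin c' by (subst nn_integral_distr) (simp_all add: linear_add add.commute)
    also have "\<dots> = (\<integral>\<^sup>+x. F (T x) \<partial>lborel)"
      by (rule nn_integral_lborel_translate) measurable
    also have "\<dots> = (\<integral>\<^sup>+x. F x \<partial>M)"
      unfolding M_def by (subst nn_integral_distr) simp_all
    finally show ?thesis .
  qed
  have fin: "emeasure lborel (ball (0::'a) r) \<noteq> \<infinity>" for r
    by (metis emeasure_lborel_ball_finite less_irrefl)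
  interpret M: sigma_finite_measure M
  proof
    show "\<exists>A. countable A \<and> A \<subseteq> sets M \<and> \<Union>A = space M \<and> (\<forall>a\<in>A. emeasure M a \<noteq> \<infinity>)"
      by (rule exI[of _ "range (\<lambda>n::nat. ball 0 (real n))"])
         (use fin in \<open>auto simp: ball intro: reals_Archimedean2\<close>)
  qed
  interpret P: pair_sigma_finite lborel M ..
  let ?B = "ball (0::'a) 1"
  define a b :: "'a \<Rightarrow> ennreal" where "a = indicator A" and "b = indicator ?B"
  have [measurable]: "a \<in> borel_measurable borel" "b \<in> borel_measurable borel"
    unfolding a_def b_def by (simp_all add: borel_measurable_indicator)
  have b: "b (- x) = b x" "(\<integral>\<^sup>+x. b x \<partial>lborel) = emeasure lborel ?B"
    "(\<integral>\<^sup>+x. b x \<partial>M) = emeasure lborel ?B" for x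
    by (simp_all add: b_def ball) (simp add: indicator_def)
  have a: "(\<integral>\<^sup>+x. a x \<partial>lborel) = emeasure lborel A" "(\<integral>\<^sup>+x. a x \<partial>M) = emeasure M A"
    by (simp_all add: a_def)
  have tr: "(\<integral>\<^sup>+y. F (y + c) \<partial>lborel) = (\<integral>\<^sup>+y. F y \<partial>lborel)"
    if "F \<in> borel_measurable borel" for c and F :: "'a \<Rightarrow> ennreal"
    using nn_integral_lborel_translate[OF that, of c] by (simp add: add.commute)
  have "emeasure M A * emeasure lborel ?B = (\<integral>\<^sup>+x. a x * emeasure lborel ?B \<partial>M)"
    by (simp add: nn_integral_multc a)
  also have "\<dots> = (\<integral>\<^sup>+x. (\<integral>\<^sup>+y. a x * b (y - x) \<partial>lborel) \<partial>M)"
    using tr[of b "- x" for x] by (rule_tac nn_integral_cong) (simp add: nn_integral_cmult b)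
  also have "\<dots> = (\<integral>\<^sup>+y. (\<integral>\<^sup>+x. a x * b (y - x) \<partial>M) \<partial>lborel)"
    by (rule P.Fubini') measurable
  also have "\<dots> = (\<integral>\<^sup>+y. (\<integral>\<^sup>+x. a (x + y) * b x \<partial>M) \<partial>lborel)"
  proof (rule nn_integral_cong)
    fix y
    have "(\<integral>\<^sup>+x. a x * b (y - x) \<partial>M) = (\<integral>\<^sup>+x. a (x + y) * b (y - (x + y)) \<partial>M)"
      by (rule Mtr[symmetric]) measurable
    then show "(\<integral>\<^sup>+x. a x * b (y - x) \<partial>M) = (\<integral>\<^sup>+x. a (x + y) * b x \<partial>M)"
      by (simp add: b)
  qed
  also have "\<dots> = (\<integral>\<^sup>+x. (\<integral>\<^sup>+y. a (y + x) * b x \<partial>lborel) \<partial>M)"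
    by (subst add.commute, rule P.Fubini'[symmetric]) measurable
  also have "\<dots> = (\<integral>\<^sup>+x. emeasure lborel A * b x \<partial>M)"
    by (rule nn_integral_cong) (simp add: nn_integral_multc tr a)
  also have "\<dots> = emeasure lborel A * emeasure lborel ?B"
    by (simp add: nn_integral_cmult b)
  finally have "emeasure M A * emeasure lborel ?B = emeasure lborel A * emeasure lborel ?B" .
  moreover have "emeasure lborel ?B \<noteq> 0" "emeasure lborel ?B \<noteq> \<infinity>"
    using emeasure_lborel_ball_finite[of "0::'a" 1] content_ball_pos[of 1 "0::'a"]
    by (auto simp: measure_def)
  ultimately show "emeasure (distr lborel borel T) A = emeasure lborel A"
    unfolding M_def[symmetric] by (simp add: mult.commute[of _ "emeasure lborel ?B"] ennreal_mult_cancel_left)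
qed simp

text \<open>The surface measure pushed to the Borel sets of the whole space, so that measurability
  of angular functions is plain Borel measurability. The price is that unit length of \<sigma> holds
  only almost everywhere (\<open>AE_angular_norm\<close>).\<close>

definition angular_measure :: "'a::euclidean_space measure" where
  "angular_measure = distr sphere_measure borel (\<lambda>x. x)"

lemma sets_angular_measure [simp, measurable_cong]: "sets angular_measure = sets borel"
  and space_angular_measure [simp]: "space angular_measure = UNIV"
  by (simp_all add: angular_measure_def)

lemma measurable_angular_measure [simp]: "measurable angular_measure N = measurable borel N"
  by (rule measurable_cong_sets) simp_all

lemma sets_sphere_measure: "sets sphere_measure = sets (restrict_space borel (sphere (0::'a::euclidean_space) 1))"
  by (simp add: sphere_measure_def)

lemma measurable_sphere_measure_ident: "(\<lambda>x. x) \<in> sphere_measure \<rightarrow>\<^sub>M (borel :: 'a::euclidean_space measure)"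
  unfolding measurable_cong_sets[OF sets_sphere_measure refl]
  by (rule measurable_restrict_space1) simp

lemma borel_measurable_sgn_euclidean [measurable]: "(sgn :: 'a::euclidean_space \<Rightarrow> 'a) \<in> borel_measurable borel"
  unfolding sgn_div_norm[abs_def] by measurable

lemma emeasure_angular_measure:
  fixes A :: "'a::euclidean_space set"
  assumes [measurable]: "A \<in> sets borel"
  shows "emeasure angular_measure A = of_nat DIM('a) * emeasure lborel {x\<in>ball 0 1. sgn x \<in> A \<and> x \<noteq> 0}"
proof -
  have "emeasure angular_measure A = emeasure sphere_measure (A \<inter> sphere 0 1)"
    unfolding angular_measure_def
    by (subst emeasure_distr[OF measurable_sphere_measure_ident]) (auto simp: space_sphere_measure)
  also have "\<dots> = of_nat DIM('a) * emeasure lborel {x. 0 < norm x \<and> norm x < 1 \<and> x /\<^sub>R norm x \<in> A \<inter> sphere 0 1}"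
    by (rule emeasure_sphere_measure) auto
  also have "{x. 0 < norm x \<and> norm x < 1 \<and> x /\<^sub>R norm x \<in> A \<inter> sphere 0 1} = {x\<in>ball 0 1. sgn x \<in> A \<and> x \<noteq> 0}"
    by (auto simp: sgn_div_norm)
  finally show ?thesis .
qed

lemma finite_measure_angular_measure: "finite_measure (angular_measure :: 'a::euclidean_space measure)"
proof
  have "emeasure lborel {x\<in>ball (0::'a) 1. sgn x \<in> UNIV \<and> x \<noteq> 0} \<le> emeasure lborel (ball (0::'a) 1)"
    by (intro emeasure_mono) auto
  also have "\<dots> < \<infinity>" by (rule emeasure_lborel_ball_finite)
  finally show "emeasure angular_measure (space (angular_measure :: 'a measure)) \<noteq> \<infinity>"
    by (simp add: emeasure_angular_measure ennreal_mult_eq_top_iff less_top)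
qed

interpretation angular: finite_measure angular_measure
  by (rule finite_measure_angular_measure)

lemma AE_angular_norm: "AE \<sigma> in angular_measure. norm \<sigma> = 1"
proof -
  have "emeasure angular_measure {\<sigma>::'a. norm \<sigma> \<noteq> 1} = 0"
    by (subst emeasure_angular_measure) (auto simp: norm_sgn)
  then show ?thesis
    by (intro AE_I[of _ _ "{\<sigma>. norm \<sigma> \<noteq> 1}"]) auto
qed

lemma integral_sphere_measure:
  fixes F :: "'a::euclidean_space \<Rightarrow> real"
  assumes "F \<in> borel_measurable borel"
  shows "(\<integral>\<sigma>. F \<sigma> \<partial>sphere_measure) = (\<integral>\<sigma>. F \<sigma> \<partial>angular_measure)"
  unfolding angular_measure_def by (rule integral_distr[OF measurable_sphere_measure_ident assms, symmetric])

text \<open>An orthogonal map commutes with \<open>sgn\<close> and preserves the unit ball, so the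
  cone formula \<open>emeasure_angular_measure\<close> reduces the claim to
  \<open>distr_lborel_isometry\<close>.\<close>

lemma distr_angular_isometry:
  fixes T :: "'a::euclidean_space \<Rightarrow> 'a"
  assumes T: "orthogonal_transformation T"
  shows "distr angular_measure borel T = angular_measure"
proof (rule measure_eqI)
  fix A assume "A \<in> sets (distr angular_measure borel T)"
  then have [measurable]: "A \<in> sets borel" by simp
  have lin: "linear T" using T by (simp add: orthogonal_transformation_linear)
  have [measurable]: "T \<in> borel_measurable borel" by (rule borel_measurable_orthogonal_transformation[OF T])
  have sg: "sgn (T x) = T (sgn x)" for x
    using T lin by (simp add: sgn_div_norm orthogonal_transformation_norm linear_scale)
  have T0: "T x = 0 \<longleftrightarrow> x = 0" for x
    by (metis T norm_eq_zero orthogonal_transformation_norm)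
  have "emeasure (distr angular_measure borel T) A = emeasure angular_measure {x. T x \<in> A}"
    by (subst emeasure_distr) (auto simp: vimage_def)
  also have "\<dots> = of_nat DIM('a) * emeasure lborel {x\<in>ball 0 1. T (sgn x) \<in> A \<and> x \<noteq> 0}"
    by (subst emeasure_angular_measure) auto
  also have "emeasure lborel {x\<in>ball 0 1. T (sgn x) \<in> A \<and> x \<noteq> 0} = emeasure (distr lborel borel T) {x\<in>ball 0 1. sgn x \<in> A \<and> x \<noteq> 0}"
    using T by (subst emeasure_distr) (auto intro!: arg_cong[where f="emeasure lborel"] simp: sg T0 orthogonal_transformation_norm)
  also have "distr lborel borel T = lborel" by (rule distr_lborel_isometry[OF T])
  finally show "emeasure (distr angular_measure borel T) A = emeasure angular_measure A"
    by (simp add: emeasure_angular_measure)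
qed simp

text \<open>The reflection in the hyperplane orthogonal to \<open>n = u - e\<close>; equal lengths
  give \<open>2 * (u \<bullet> n) = n \<bullet> n\<close>, which is why it carries \<open>u\<close>
  to \<open>e\<close>.\<close>

lemma orthogonal_transformation_maps_unit:
  fixes u e :: "'a::euclidean_space"
  assumes "norm u = 1" "norm e = 1"
  obtains T where "orthogonal_transformation T" "T u = e"
proof (cases "u = e")
  case True
  then show ?thesis using that[of "\<lambda>x. x"] by simp
next
  case False
  define n where "n = u - e"
  have nn: "n \<bullet> n \<noteq> 0" using False by (simp add: n_def)
  define T where "T x = x - (2 * (x \<bullet> n) / (n \<bullet> n)) *\<^sub>R n" for x
  have "linear T"
    unfolding T_def by (rule linearI) (auto simp: algebra_simps add_divide_distrib)
  moreover have "T x \<bullet> T y = x \<bullet> y" for x y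
  proof -
    have "T x \<bullet> T y = x \<bullet> y - 2 * (x \<bullet> n) / (n \<bullet> n) * (n \<bullet> y) - 2 * (y \<bullet> n) / (n \<bullet> n) * (x \<bullet> n)
        + 2 * (x \<bullet> n) / (n \<bullet> n) * (2 * (y \<bullet> n) / (n \<bullet> n)) * (n \<bullet> n)"
      unfolding T_def by (simp add: inner_diff_left inner_diff_right)
    also have "\<dots> = x \<bullet> y"
      using nn by (simp add: inner_commute[of n y] divide_simps)
    finally show ?thesis .
  qed
  moreover have "T u = e"
  proof -
    have uu: "u \<bullet> u = 1" "e \<bullet> e = 1" using assms by (simp_all add: norm_eq_1)
    have "2 * (u \<bullet> n) = n \<bullet> n"
      by (simp add: n_def inner_diff_left inner_diff_right uu inner_commute[of e u])
    then show ?thesis using nn by (simp add: T_def n_def)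
  qed
  ultimately show ?thesis using that by (auto simp: orthogonal_transformation_def)
qed

text \<open>Equality in Cauchy-Schwarz puts the cone over the exceptional directions into the line
  spanned by \<open>e\<close>, which is negligible in dimension at least two. This is how the
  dimension enters the proof: to discard the directions where the argument of \<open>h\<close> is 1
  or -1, and to make the angular dissipation positive.\<close>

lemma AE_angular_inner_less:
  fixes e :: "'a::euclidean_space"
  assumes "2 \<le> DIM('a)" "norm e \<le> 1"
  shows "AE \<sigma> in angular_measure. \<bar>e \<bullet> \<sigma>\<bar> < 1"
proof -
  have sub: "{x\<in>ball 0 1. \<bar>e \<bullet> sgn x\<bar> \<ge> 1 \<and> x \<noteq> 0} \<subseteq> span {e}"
  proof safe
    fix x :: 'a assume x: "\<bar>e \<bullet> sgn x\<bar> \<ge> 1" "x \<noteq> 0"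
    have s: "norm (sgn x) = 1" using x by (simp add: norm_sgn)
    have "\<bar>e \<bullet> sgn x\<bar> \<le> norm e * norm (sgn x)" by (rule Cauchy_Schwarz_ineq2)
    with x s assms have eq: "\<bar>e \<bullet> sgn x\<bar> = norm e * norm (sgn x)" and e: "norm e = 1" by auto
    from eq have "norm e *\<^sub>R sgn x = norm (sgn x) *\<^sub>R e \<or> norm e *\<^sub>R sgn x = - norm (sgn x) *\<^sub>R e"
      by (simp add: norm_cauchy_schwarz_abs_eq)
    then have "sgn x = e \<or> sgn x = - e" using s e by auto
    moreover have "x = norm x *\<^sub>R sgn x" using x by (simp add: sgn_div_norm)
    ultimately have "x = norm x *\<^sub>R e \<or> x = (- norm x) *\<^sub>R e" by auto
    then show "x \<in> span {e}" by (metis span_base singletonI span_scale)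
  qed
  have "dim (span {e}) < DIM('a)"
    using assms dim_le_card'[of "{e}"] by (simp add: dim_span)
  then have "negligible (span {e})"
    by (rule negligible_lowdim)
  then have "negligible {x\<in>ball 0 1. \<bar>e \<bullet> sgn x\<bar> \<ge> 1 \<and> x \<noteq> 0}"
    by (rule negligible_subset) (rule sub)
  moreover have m: "{x\<in>ball 0 1. \<bar>e \<bullet> sgn x\<bar> \<ge> 1 \<and> x \<noteq> 0} \<in> sets borel" by measurable
  ultimately have "emeasure lborel {x\<in>ball 0 1. \<bar>e \<bullet> sgn x\<bar> \<ge> 1 \<and> x \<noteq> 0} = 0"
    using emeasure_completion[of _ lborel] by (simp add: negligible_iff_null_sets null_sets_def)
  then have "emeasure angular_measure {\<sigma>. \<bar>e \<bullet> \<sigma>\<bar> \<ge> 1} = 0"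
    by (subst emeasure_angular_measure) auto
  then show ?thesis
    by (intro AE_I[of _ _ "{\<sigma>. \<bar>e \<bullet> \<sigma>\<bar> \<ge> 1}"]) auto
qed

section \<open>Polar coordinates and the exchange of directions\<close>

lemma emeasure_lborel_scale:
  fixes A :: "'a::euclidean_space set"
  assumes [measurable]: "A \<in> sets borel" and "0 < r"
  shows "emeasure lborel {x. x /\<^sub>R r \<in> A} = ennreal (r ^ DIM('a)) * emeasure lborel A"
proof -
  have "emeasure lborel {x. x /\<^sub>R r \<in> A}
      = emeasure (density (distr lborel borel (\<lambda>x. 0 + r *\<^sub>R x)) (\<lambda>_. \<bar>r\<bar>^DIM('a))) {x::'a. x /\<^sub>R r \<in> A}"
    using \<open>0 < r\<close> by (subst lborel_affine[of r "0::'a"]) simp_all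
  also have "\<dots> = ennreal (r ^ DIM('a)) * emeasure (distr lborel borel (\<lambda>x. r *\<^sub>R x)) {x::'a. x /\<^sub>R r \<in> A}"
    using \<open>0 < r\<close> by (subst emeasure_density_const) auto
  also have "emeasure (distr lborel borel (\<lambda>x. r *\<^sub>R x)) {x::'a. x /\<^sub>R r \<in> A} = emeasure lborel A"
    using \<open>0 < r\<close> by (subst emeasure_distr) (auto simp: vimage_def)
  finally show ?thesis .
qed

text \<open>The radial factor is left as an image measure, since only the product structure matters.\<close>

lemma distr_lborel_polar:
  "distr lborel (borel \<Otimes>\<^sub>M borel) (\<lambda>x::'a::euclidean_space. (norm x, sgn x))
   = scale_measure (inverse (of_nat DIM('a) * emeasure lborel (ball (0::'a) 1)))
       (distr lborel borel (norm :: 'a \<Rightarrow> real)) \<Otimes>\<^sub>M (angular_measure :: 'a measure)"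
proof -
  let ?d = "of_nat DIM('a) :: ennreal"
  define \<omega> where "\<omega> = emeasure lborel (ball (0::'a) 1)"
  have \<omega>: "\<omega> \<noteq> 0" "\<omega> \<noteq> \<infinity>"
    using emeasure_lborel_ball_finite[of "0::'a" 1] content_ball_pos[of 1 "0::'a"]
    by (auto simp: measure_def \<omega>_def)
  define R where "R = scale_measure (inverse (?d * \<omega>)) (distr lborel borel (norm :: 'a \<Rightarrow> real))"
  have [simp, measurable_cong]: "sets R = sets borel" and [simp]: "space R = UNIV"
    by (simp_all add: R_def space_scale_measure)
  have emR: "emeasure R A = inverse (?d * \<omega>) * emeasure lborel {x::'a. norm x \<in> A}" if "A \<in> sets borel" for A
    unfolding R_def using that by (simp add: emeasure_distr vimage_def)
  have dw: "?d * \<omega> \<noteq> 0" "?d * \<omega> \<noteq> top" using \<omega> by (auto simp: ennreal_mult_eq_top_iff)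
  then have dwi: "?d * \<omega> * inverse (?d * \<omega>) = 1"
    using ennreal_divide_self[of "?d * \<omega>"] by (simp add: divide_ennreal_def less_top)
  have fin: "emeasure lborel {x::'a. norm x \<in> {..r} \<and> sgn x \<in> B} \<noteq> \<infinity>" if [measurable]: "B \<in> sets borel" for r B
  proof -
    have "emeasure lborel {x::'a. norm x \<in> {..r} \<and> sgn x \<in> B} \<le> emeasure lborel (cball (0::'a) r)"
      by (intro emeasure_mono) auto
    also have "\<dots> < \<infinity>" by (rule emeasure_lborel_cball_finite)
    finally show ?thesis by simp
  qed
  interpret R: sigma_finite_measure R
  proof
    have "emeasure R {..real n} \<noteq> \<infinity>" for n
      using fin[of UNIV "real n"] dw by (simp add: emR ennreal_mult_eq_top_iff ennreal_inverse_eq_top_iff)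
    then show "\<exists>A. countable A \<and> A \<subseteq> sets R \<and> \<Union>A = space R \<and> (\<forall>a\<in>A. emeasure R a \<noteq> \<infinity>)"
      by (intro exI[of _ "range (\<lambda>n::nat. {..real n})"]) (auto intro: real_arch_simple)
  qed
  have norm0: "emeasure lborel (A - {0::'a}) = emeasure lborel A" if "A \<in> sets borel" for A
    using that by (intro emeasure_Diff_null_set) auto
  have ball_part: "emeasure lborel {x::'a. norm x \<in> {..r} \<and> sgn x \<in> B} * (?d * \<omega>)
      = emeasure lborel {x::'a. norm x \<in> {..r}} * emeasure angular_measure B" if [measurable]: "B \<in> sets borel" for r B
  proof (cases "r > 0")
    case False
    then have "{x::'a. norm x \<in> {..r} \<and> sgn x \<in> B} \<subseteq> {0}" "{x::'a. norm x \<in> {..r}} \<subseteq> {0}"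
      by (auto simp: not_less dest: order_trans)
    then have "emeasure lborel {x::'a. norm x \<in> {..r} \<and> sgn x \<in> B} = 0" "emeasure lborel {x::'a. norm x \<in> {..r}} = 0"
      by (metis emeasure_lborel_countable countable_subset countable_insert countable_empty)+
    then show ?thesis by simp
  next
    case True
    have *: "emeasure lborel {x::'a. norm x \<in> {..r} \<and> sgn x \<in> B}
       = ennreal (r ^ DIM('a)) * emeasure lborel {x\<in>ball (0::'a) 1. sgn x \<in> B \<and> x \<noteq> 0}"
      if [measurable]: "B \<in> sets borel" for B
    proof -
      \<comment> \<open>\<open>emeasure_angular_measure\<close> speaks of the open punctured ball,
        whereas the generators in the radial variable are closed half-lines; the sphere and the
        origin make up the difference.\<close>
      have "sphere (0::'a) r \<in> null_sets lborel"
        using negligible_sphere[of "0::'a" r] by (auto simp: negligible_iff_null_sets null_sets_def)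
      then have N: "insert 0 (sphere (0::'a) r) \<in> null_sets lborel"
        using null_sets.Un[of "{0}" lborel "sphere (0::'a) r"] by (simp add: finite_imp_null_set_lborel)
      have "emeasure lborel {x::'a. norm x \<in> {..r} \<and> sgn x \<in> B}
         = emeasure lborel ({x::'a. norm x \<in> {..r} \<and> sgn x \<in> B} - insert 0 (sphere (0::'a) r))"
        by (rule emeasure_Diff_null_set[symmetric, OF N]) measurable
      also have "{x::'a. norm x \<in> {..r} \<and> sgn x \<in> B} - insert 0 (sphere (0::'a) r)
         = {x. x /\<^sub>R r \<in> {x\<in>ball (0::'a) 1. sgn x \<in> B \<and> x \<noteq> 0}}"
        using True by (auto simp: sgn_div_norm divide_simps)
      also have "emeasure lborel \<dots> = ennreal (r ^ DIM('a)) * emeasure lborel {x\<in>ball (0::'a) 1. sgn x \<in> B \<and> x \<noteq> 0}"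
        using True by (intro emeasure_lborel_scale) auto
      finally show ?thesis .
    qed
    have "emeasure lborel {x\<in>ball (0::'a) 1. sgn x \<in> UNIV \<and> x \<noteq> 0} = emeasure lborel (ball (0::'a) 1 - {0})"
      by (rule arg_cong[where f="emeasure lborel"]) auto
    then have "emeasure lborel {x\<in>ball (0::'a) 1. sgn x \<in> UNIV \<and> x \<noteq> 0} = \<omega>"
      by (simp add: norm0 \<omega>_def)
    then show ?thesis
      using *[of UNIV] *[OF that] by (simp add: emeasure_angular_measure mult_ac)
  qed
  have main: "emeasure lborel {x::'a. norm x \<in> A \<and> sgn x \<in> B} = emeasure R A * emeasure angular_measure B"
    if [measurable]: "A \<in> sets borel" "B \<in> sets borel" for A B
  proof -
    define M1 where "M1 = distr (restrict_space lborel {x::'a. sgn x \<in> B}) borel norm"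
    define M2 where "M2 = scale_measure (emeasure angular_measure B) R"
    have nm: "norm \<in> borel_measurable (restrict_space lborel {x::'a. sgn x \<in> B})"
      by (rule measurable_restrict_space1) simp
    have M1: "emeasure M1 C = emeasure lborel {x::'a. norm x \<in> C \<and> sgn x \<in> B}" if [measurable]: "C \<in> sets borel" for C
    proof -
      have "emeasure M1 C = emeasure (restrict_space lborel {x::'a. sgn x \<in> B}) {x. norm x \<in> C \<and> sgn x \<in> B}"
        unfolding M1_def by (subst emeasure_distr[OF nm]) (auto simp: space_restrict_space intro!: arg_cong[where f="emeasure _"])
      also have "\<dots> = emeasure lborel {x::'a. norm x \<in> C \<and> sgn x \<in> B}"
        by (rule emeasure_restrict_space) auto
      finally show ?thesis .
    qed
    have M2: "emeasure M2 C = emeasure angular_measure B * emeasure R C" if "C \<in> sets borel" for C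
      using that by (simp add: M2_def)
    \<comment> \<open>For fixed \<open>B\<close> both sides are measures in the radial variable,
      hence determined by their values on half-lines, where scaling gives the claim
      (\<open>ball_part\<close>).\<close>
    have "M1 = M2"
    proof (rule measure_eqI_generator_eq[where E="range (\<lambda>r::real. {..r})" and \<Omega>=UNIV and A="\<lambda>n. {..real n}"])
      show "Int_stable (range (\<lambda>r::real. {..r}))"
        by (auto simp: Int_stable_def intro!: exI[of _ "min _ _"])
      show "sets M1 = sigma_sets UNIV (range (\<lambda>r::real. {..r}))" "sets M2 = sigma_sets UNIV (range (\<lambda>r::real. {..r}))"
        by (simp_all add: M1_def M2_def borel_eq_atMost)
      show "(\<Union>n. {..real n}) = UNIV" by (auto intro: real_arch_simple)
      show "emeasure M1 {..real n} \<noteq> \<infinity>" for n using fin[of B "real n"] by (simp add: M1)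
      fix C assume "C \<in> range (\<lambda>r::real. {..r})"
      then obtain r where C: "C = {..r}" by auto
      have "emeasure M1 C = emeasure lborel {x::'a. norm x \<in> {..r} \<and> sgn x \<in> B} * (?d * \<omega>) * inverse (?d * \<omega>)"
        unfolding mult.assoc[of "emeasure _ _"] dwi by (simp add: M1 C)
      also have "\<dots> = emeasure M2 C"
        by (simp only: ball_part[OF that(2)]) (simp add: M2 C emR mult_ac)
      finally show "emeasure M1 C = emeasure M2 C" .
    qed auto
    then show ?thesis using M1[OF that(1)] M2[OF that(1)] by (simp add: mult.commute)
  qed
  show ?thesis
    unfolding R_def[symmetric] \<omega>_def[symmetric]
  proof (rule pair_measure_eqI[symmetric])
    show "sigma_finite_measure R" ..
    show "sigma_finite_measure (angular_measure :: 'a measure)" ..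
    show "sets (R \<Otimes>\<^sub>M (angular_measure :: 'a measure)) = sets (distr lborel (borel \<Otimes>\<^sub>M borel) (\<lambda>x::'a. (norm x, sgn x)))"
      by (simp cong: sets_pair_measure_cong)
    fix A B assume "A \<in> sets R" "B \<in> sets (angular_measure :: 'a measure)"
    then have [measurable]: "A \<in> sets borel" "B \<in> sets borel" by simp_all
    show "emeasure R A * emeasure angular_measure B
        = emeasure (distr lborel (borel \<Otimes>\<^sub>M borel) (\<lambda>x::'a. (norm x, sgn x))) (A \<times> B)"
      by (subst emeasure_distr) (auto simp: main[symmetric] intro!: arg_cong[where f="emeasure lborel"])
  qed
qed

text \<open>Both sides become an integral over a radius and two independent copies of
  \<open>angular_measure\<close>; Tonelli exchanges the copies.\<close>

lemma nn_integral_polar_swap: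
  fixes F :: "real \<times> 'a::euclidean_space \<times> 'a \<Rightarrow> ennreal"
  assumes [measurable]: "F \<in> borel_measurable (borel \<Otimes>\<^sub>M borel \<Otimes>\<^sub>M borel)"
  shows "(\<integral>\<^sup>+u. (\<integral>\<^sup>+\<sigma>. F (norm u, sgn u, \<sigma>) \<partial>angular_measure) \<partial>lborel)
       = (\<integral>\<^sup>+u. (\<integral>\<^sup>+\<sigma>. F (norm u, \<sigma>, sgn u) \<partial>angular_measure) \<partial>lborel)"
proof -
  define R where "R = scale_measure (inverse (of_nat DIM('a) * emeasure lborel (ball (0::'a) 1)))
       (distr lborel borel (norm :: 'a \<Rightarrow> real))"
  have [simp, measurable_cong]: "sets R = sets borel" by (simp add: R_def)
  have *: "(\<integral>\<^sup>+u. G (norm u, sgn u) \<partial>lborel) = (\<integral>\<^sup>+r. (\<integral>\<^sup>+\<omega>. G (r, \<omega>) \<partial>angular_measure) \<partial>R)"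
    if [measurable]: "G \<in> borel_measurable (borel \<Otimes>\<^sub>M borel)" for G :: "real \<times> 'a \<Rightarrow> ennreal"
  proof -
    have "(\<integral>\<^sup>+u. G (norm u, sgn u) \<partial>lborel) = (\<integral>\<^sup>+p. G p \<partial>distr lborel (borel \<Otimes>\<^sub>M borel) (\<lambda>x. (norm x, sgn x)))"
      by (subst nn_integral_distr) auto
    also have "\<dots> = (\<integral>\<^sup>+p. G p \<partial>(R \<Otimes>\<^sub>M angular_measure))"
      by (simp only: R_def distr_lborel_polar[where 'a='a])
    also have "\<dots> = (\<integral>\<^sup>+r. (\<integral>\<^sup>+\<omega>. G (r, \<omega>) \<partial>angular_measure) \<partial>R)"
      by (rule angular.nn_integral_fst[symmetric]) measurable
    finally show ?thesis .
  qed
  interpret P: pair_sigma_finite "angular_measure :: 'a measure" "angular_measure :: 'a measure" ..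
  have "(\<integral>\<^sup>+u. (\<integral>\<^sup>+\<sigma>. F (norm u, sgn u, \<sigma>) \<partial>angular_measure) \<partial>lborel)
      = (\<integral>\<^sup>+r. (\<integral>\<^sup>+\<omega>. (\<integral>\<^sup>+\<sigma>. F (r, \<omega>, \<sigma>) \<partial>angular_measure) \<partial>angular_measure) \<partial>R)"
    using *[of "\<lambda>(r, \<omega>). \<integral>\<^sup>+\<sigma>. F (r, \<omega>, \<sigma>) \<partial>angular_measure"] by simp
  also have "\<dots> = (\<integral>\<^sup>+r. (\<integral>\<^sup>+\<omega>. (\<integral>\<^sup>+\<sigma>. F (r, \<sigma>, \<omega>) \<partial>angular_measure) \<partial>angular_measure) \<partial>R)"
    by (rule nn_integral_cong, rule P.Fubini') measurable
  also have "\<dots> = (\<integral>\<^sup>+u. (\<integral>\<^sup>+\<sigma>. F (norm u, \<sigma>, sgn u) \<partial>angular_measure) \<partial>lborel)"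
    using *[of "\<lambda>(r, \<omega>). \<integral>\<^sup>+\<sigma>. F (r, \<sigma>, \<omega>) \<partial>angular_measure"] by simp
  finally show ?thesis .
qed

section \<open>The collision transformation\<close>

abbreviation borel3 :: "('a::topological_space \<times> 'a \<times> 'a) measure" where
  "borel3 \<equiv> borel \<Otimes>\<^sub>M borel \<Otimes>\<^sub>M borel"

abbreviation partner_measure :: "('a::euclidean_space \<times> 'a) measure" where
  "partner_measure \<equiv> lborel \<Otimes>\<^sub>M angular_measure"

abbreviation collision_measure :: "('a::euclidean_space \<times> 'a \<times> 'a) measure" where
  "collision_measure \<equiv> lborel \<Otimes>\<^sub>M partner_measure"

text \<open>The classical change between pre- and post-collisional velocities. Keeping the old
  direction \<open>sgn (v - w)\<close> as the new angle makes the map an involution almost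
  everywhere; \<open>post_velocity_collision\<close> is the first component of this fact.\<close>

definition collision_map :: "'a::euclidean_space \<times> 'a \<times> 'a \<Rightarrow> 'a \<times> 'a \<times> 'a" where
  "collision_map = (\<lambda>(v, w, \<sigma>). (post_velocity v w \<sigma>, post_velocity_star v w \<sigma>, sgn (v - w)))"

lemma sets_collision_measure [measurable_cong]:
  "sets (collision_measure :: ('a::euclidean_space \<times> 'a \<times> 'a) measure) = sets borel3"
  by (intro sets_pair_measure_cong) simp_all

interpretation velocity_angle: pair_sigma_finite lborel angular_measure ..
interpretation collision: pair_sigma_finite lborel partner_measure
  by (simp add: pair_sigma_finite_def lborel.sigma_finite_measure_axioms velocity_angle.sigma_finite_measure_axioms)

lemma measurable_post_velocity [measurable]:
  "(\<lambda>x. post_velocity (f x) (g x) (k x)) \<in> borel_measurable M"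
  "(\<lambda>x. post_velocity_star (f x) (g x) (k x)) \<in> borel_measurable M"
  if [measurable]: "f \<in> borel_measurable M" "g \<in> borel_measurable M" "k \<in> borel_measurable M"
  unfolding post_velocity_def post_velocity_star_def by measurable

lemma measurable_collision_map [measurable]:
  "collision_map \<in> borel3 \<rightarrow>\<^sub>M borel3"
  unfolding collision_map_def by measurable

lemma nn_integral_collision_measure:
  fixes H :: "'a::euclidean_space \<times> 'a \<times> 'a \<Rightarrow> ennreal"
  assumes [measurable]: "H \<in> borel_measurable borel3"
  shows "(\<integral>\<^sup>+p. H p \<partial>collision_measure) = (\<integral>\<^sup>+v. (\<integral>\<^sup>+w. (\<integral>\<^sup>+\<sigma>. H (v, w, \<sigma>) \<partial>angular_measure) \<partial>lborel) \<partial>lborel)"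
proof -
  have "(\<integral>\<^sup>+v. (\<integral>\<^sup>+w. (\<integral>\<^sup>+\<sigma>. H (v, w, \<sigma>) \<partial>angular_measure) \<partial>lborel) \<partial>lborel)
    = (\<integral>\<^sup>+v. (\<integral>\<^sup>+q. H (v, q) \<partial>partner_measure) \<partial>lborel)"
    by (rule nn_integral_cong, rule angular.nn_integral_fst) measurable
  also have "\<dots> = (\<integral>\<^sup>+p. H p \<partial>collision_measure)"
    by (rule velocity_angle.nn_integral_fst) measurable
  finally show ?thesis ..
qed

lemma distr_collision_measureI:
  fixes T :: "'a::euclidean_space \<times> 'a \<times> 'a \<Rightarrow> 'a \<times> 'a \<times> 'a"
  assumes T: "T \<in> borel3 \<rightarrow>\<^sub>M borel3"
    and int: "\<And>H. H \<in> borel_measurable borel3 \<Longrightarrow>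
      (\<integral>\<^sup>+p. H (T p) \<partial>collision_measure) = (\<integral>\<^sup>+p. H p \<partial>collision_measure)"
  shows "distr collision_measure collision_measure T = collision_measure"
proof (rule measure_eqI)
  note [measurable] = T
  fix A assume "A \<in> sets (distr collision_measure collision_measure T)"
  then have A: "A \<in> sets collision_measure" by simp
  then have [measurable]: "A \<in> sets borel3" by (simp only: sets_collision_measure)
  have "emeasure (distr collision_measure collision_measure T) A = (\<integral>\<^sup>+p. indicator A p \<partial>distr collision_measure collision_measure T)"
    using A by simp
  also have "\<dots> = (\<integral>\<^sup>+p. indicator A (T p) \<partial>collision_measure)"
    by (rule nn_integral_distr) measurable
  also have "\<dots> = emeasure collision_measure A" using A by (simp add: int)
  finally show "emeasure (distr collision_measure collision_measure T) A = emeasure collision_measure A" .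
qed simp

text \<open>Passing to centre and relative velocity has Jacobian one: for fixed \<open>v\<close> it
  is the reflection \<open>w = v - u\<close>, and for fixed \<open>u\<close> the translation
  \<open>v = c + u /\<^sub>R 2\<close>.\<close>

lemma nn_integral_center_of_mass:
  fixes H :: "'a::euclidean_space \<times> 'a \<Rightarrow> ennreal"
  assumes [measurable]: "H \<in> borel_measurable (borel \<Otimes>\<^sub>M borel)"
  shows "(\<integral>\<^sup>+v. (\<integral>\<^sup>+w. H (v, w) \<partial>lborel) \<partial>lborel)
       = (\<integral>\<^sup>+c. (\<integral>\<^sup>+u. H (c + u /\<^sub>R 2, c - u /\<^sub>R 2) \<partial>lborel) \<partial>lborel)"
proof -
  have "(\<integral>\<^sup>+v. (\<integral>\<^sup>+w. H (v, w) \<partial>lborel) \<partial>lborel) = (\<integral>\<^sup>+v. (\<integral>\<^sup>+u. H (v, v - u) \<partial>lborel) \<partial>lborel)"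
    by (rule nn_integral_cong, rule nn_integral_lborel_reflect[symmetric]) measurable
  also have "\<dots> = (\<integral>\<^sup>+u. (\<integral>\<^sup>+v. H (v, v - u) \<partial>lborel) \<partial>lborel)"
    by (rule lborel_pair.Fubini') measurable
  also have "\<dots> = (\<integral>\<^sup>+u. (\<integral>\<^sup>+c. H (u /\<^sub>R 2 + c, u /\<^sub>R 2 + c - u) \<partial>lborel) \<partial>lborel)"
    by (rule nn_integral_cong, rule nn_integral_lborel_translate[symmetric]) measurable
  also have "\<dots> = (\<integral>\<^sup>+c. (\<integral>\<^sup>+u. H (u /\<^sub>R 2 + c, u /\<^sub>R 2 + c - u) \<partial>lborel) \<partial>lborel)"
    by (rule lborel_pair.Fubini') measurable
  also have "\<dots> = (\<integral>\<^sup>+c. (\<integral>\<^sup>+u. H (c + u /\<^sub>R 2, c - u /\<^sub>R 2) \<partial>lborel) \<partial>lborel)"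
  proof -
    have "u /\<^sub>R 2 + c = c + u /\<^sub>R 2" "u /\<^sub>R 2 + c - u = c - u /\<^sub>R 2" for u c :: 'a
      using scaleR_half_double[of u] by (simp_all add: algebra_simps)
    then show ?thesis by (simp only:)
  qed
  finally show ?thesis .
qed

text \<open>In centre-of-mass coordinates the map exchanges \<open>\<sigma>\<close> with the direction of \<open>v - w\<close>; in polar
  coordinates this merely exchanges two angular integrals.\<close>

lemma distr_collision_map:
  "distr collision_measure collision_measure collision_map = (collision_measure :: ('a::euclidean_space \<times> 'a \<times> 'a) measure)"
proof (rule distr_collision_measureI)
  fix H :: "'a \<times> 'a \<times> 'a \<Rightarrow> ennreal"
  assume [measurable]: "H \<in> borel_measurable borel3"
  have "(\<integral>\<^sup>+p. H (collision_map p) \<partial>collision_measure) = (\<integral>\<^sup>+v. (\<integral>\<^sup>+w. (\<integral>\<^sup>+\<sigma>. H (post_velocity v w \<sigma>, post_velocity_star v w \<sigma>, sgn (v - w)) \<partial>angular_measure) \<partial>lborel) \<partial>lborel)"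
    by (subst nn_integral_collision_measure) (simp_all add: collision_map_def)
  also have "\<dots> = (\<integral>\<^sup>+c. (\<integral>\<^sup>+u. (\<integral>\<^sup>+\<sigma>. H (c + (norm u / 2) *\<^sub>R \<sigma>, c - (norm u / 2) *\<^sub>R \<sigma>, sgn u) \<partial>angular_measure) \<partial>lborel) \<partial>lborel)"
  proof -
    have "c + u /\<^sub>R 2 - (c - u /\<^sub>R 2) = u" "(c + u /\<^sub>R 2 + (c - u /\<^sub>R 2)) /\<^sub>R 2 = c" for c u :: 'a
      using scaleR_half_double[of u] scaleR_half_double[of c] by (simp_all add: algebra_simps)
    then have eq: "post_velocity (c + u /\<^sub>R 2) (c - u /\<^sub>R 2) \<sigma> = c + (norm u / 2) *\<^sub>R \<sigma>"
       "post_velocity_star (c + u /\<^sub>R 2) (c - u /\<^sub>R 2) \<sigma> = c - (norm u / 2) *\<^sub>R \<sigma>"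
       "sgn (c + u /\<^sub>R 2 - (c - u /\<^sub>R 2)) = sgn u" for c u \<sigma> :: 'a
      unfolding post_velocity_def post_velocity_star_def by simp_all
    have "(\<integral>\<^sup>+v. (\<integral>\<^sup>+w. (\<integral>\<^sup>+\<sigma>. H (post_velocity v w \<sigma>, post_velocity_star v w \<sigma>, sgn (v - w)) \<partial>angular_measure) \<partial>lborel) \<partial>lborel)
      = (\<integral>\<^sup>+v. (\<integral>\<^sup>+w. (\<lambda>(v, w). \<integral>\<^sup>+\<sigma>. H (post_velocity v w \<sigma>, post_velocity_star v w \<sigma>, sgn (v - w)) \<partial>angular_measure) (v, w) \<partial>lborel) \<partial>lborel)"
      by simp
    then show ?thesis
      by (subst (asm) nn_integral_center_of_mass) (measurable, simp only: prod.case eq)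
  qed
  also have "\<dots> = (\<integral>\<^sup>+c. (\<integral>\<^sup>+u. (\<integral>\<^sup>+\<sigma>. H (c + (norm u / 2) *\<^sub>R sgn u, c - (norm u / 2) *\<^sub>R sgn u, \<sigma>) \<partial>angular_measure) \<partial>lborel) \<partial>lborel)"
  proof (rule nn_integral_cong)
    fix c :: 'a
    show "(\<integral>\<^sup>+u. (\<integral>\<^sup>+\<sigma>. H (c + (norm u / 2) *\<^sub>R \<sigma>, c - (norm u / 2) *\<^sub>R \<sigma>, sgn u) \<partial>angular_measure) \<partial>lborel)
      = (\<integral>\<^sup>+u. (\<integral>\<^sup>+\<sigma>. H (c + (norm u / 2) *\<^sub>R sgn u, c - (norm u / 2) *\<^sub>R sgn u, \<sigma>) \<partial>angular_measure) \<partial>lborel)"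
      using nn_integral_polar_swap[of "\<lambda>(r, \<omega>, \<sigma>). H (c + (r / 2) *\<^sub>R \<omega>, c - (r / 2) *\<^sub>R \<omega>, \<sigma>)"] by simp
  qed
  also have "\<dots> = (\<integral>\<^sup>+c. (\<integral>\<^sup>+u. (\<integral>\<^sup>+\<sigma>. H (c + u /\<^sub>R 2, c - u /\<^sub>R 2, \<sigma>) \<partial>angular_measure) \<partial>lborel) \<partial>lborel)"
  proof -
    have "(norm u / 2) *\<^sub>R sgn u = u /\<^sub>R 2" for u :: 'a
      by (cases "u = 0") (simp_all add: sgn_div_norm)
    then show ?thesis by (simp only:)
  qed
  also have "\<dots> = (\<integral>\<^sup>+v. (\<integral>\<^sup>+w. (\<integral>\<^sup>+\<sigma>. H (v, w, \<sigma>) \<partial>angular_measure) \<partial>lborel) \<partial>lborel)"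
    using nn_integral_center_of_mass[of "\<lambda>(v, w). \<integral>\<^sup>+\<sigma>. H (v, w, \<sigma>) \<partial>angular_measure"] by simp
  also have "\<dots> = (\<integral>\<^sup>+p. H p \<partial>collision_measure)"
    by (rule nn_integral_collision_measure[symmetric]) measurable
  finally show "(\<integral>\<^sup>+p. H (collision_map p) \<partial>collision_measure) = (\<integral>\<^sup>+p. H p \<partial>collision_measure)" .
qed measurable

section \<open>Exchange of the collision partners\<close>

abbreviation collision_integrand ::
  "('a::euclidean_space \<Rightarrow> 'a \<Rightarrow> real) \<Rightarrow> ('a \<Rightarrow> real) \<Rightarrow> 'a \<Rightarrow> 'a \<Rightarrow> 'a \<Rightarrow> real" where
  "collision_integrand B g v w \<sigma> \<equiv>
    (g (post_velocity_star v w \<sigma>) * g (post_velocity v w \<sigma>) - g w * g v) * B (v - w) \<sigma>"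

text \<open>The test function of the weak form. The division by two averages over the two partners,
  which may be exchanged.\<close>

definition collision_average :: "('a::euclidean_space \<Rightarrow> real) \<Rightarrow> 'a \<times> 'a \<times> 'a \<Rightarrow> real" where
  "collision_average \<phi> = (\<lambda>(v, w, \<sigma>). (\<phi> (post_velocity v w \<sigma>) + \<phi> (post_velocity_star v w \<sigma>) - \<phi> v - \<phi> w) / 2)"

text \<open>\<sigma> changes sign together with \<open>v - w\<close>, so the deviation angle, and
  with it the kernel, is kept even if \<open>h\<close> is not an even function; the outgoing
  velocities are interchanged.\<close>

definition exchange_map :: "'a::euclidean_space \<times> 'a \<times> 'a \<Rightarrow> 'a \<times> 'a \<times> 'a" where
  "exchange_map = (\<lambda>(v, w, \<sigma>). (w, v, - \<sigma>))"

lemma measurable_exchange_map [measurable]: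
  "exchange_map \<in> borel3 \<rightarrow>\<^sub>M borel3"
  unfolding exchange_map_def by measurable

lemma nn_integral_angular_uminus:
  assumes [measurable]: "F \<in> borel_measurable borel"
  shows "(\<integral>\<^sup>+\<sigma>. F (- \<sigma>) \<partial>angular_measure) = (\<integral>\<^sup>+\<sigma>. F (\<sigma> :: 'a::euclidean_space) \<partial>angular_measure)"
proof -
  have "orthogonal_transformation (uminus :: 'a \<Rightarrow> 'a)"
    using orthogonal_transformation_neg[of "\<lambda>x::'a. x"] by simp
  then have "distr angular_measure borel uminus = (angular_measure :: 'a measure)"
    by (rule distr_angular_isometry)
  moreover have "(\<integral>\<^sup>+\<sigma>. F \<sigma> \<partial>distr angular_measure borel uminus) = (\<integral>\<^sup>+\<sigma>. F (- \<sigma>) \<partial>angular_measure)"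
    by (rule nn_integral_distr) simp_all
  ultimately show ?thesis by simp
qed

lemma distr_exchange_map:
  "distr collision_measure collision_measure exchange_map = (collision_measure :: ('a::euclidean_space \<times> 'a \<times> 'a) measure)"
proof (rule distr_collision_measureI)
  fix H :: "'a \<times> 'a \<times> 'a \<Rightarrow> ennreal"
  assume [measurable]: "H \<in> borel_measurable borel3"
  have "(\<integral>\<^sup>+p. H (exchange_map p) \<partial>collision_measure) = (\<integral>\<^sup>+v. (\<integral>\<^sup>+w. (\<integral>\<^sup>+\<sigma>. H (w, v, - \<sigma>) \<partial>angular_measure) \<partial>lborel) \<partial>lborel)"
    by (subst nn_integral_collision_measure) (simp_all add: exchange_map_def)
  also have "\<dots> = (\<integral>\<^sup>+v. (\<integral>\<^sup>+w. (\<integral>\<^sup>+\<sigma>. H (w, v, \<sigma>) \<partial>angular_measure) \<partial>lborel) \<partial>lborel)"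
    by (intro nn_integral_cong nn_integral_angular_uminus) measurable
  also have "\<dots> = (\<integral>\<^sup>+v. (\<integral>\<^sup>+w. (\<integral>\<^sup>+\<sigma>. H (v, w, \<sigma>) \<partial>angular_measure) \<partial>lborel) \<partial>lborel)"
    by (rule lborel_pair.Fubini') measurable
  also have "\<dots> = (\<integral>\<^sup>+p. H p \<partial>collision_measure)"
    by (rule nn_integral_collision_measure[symmetric]) measurable
  finally show "(\<integral>\<^sup>+p. H (exchange_map p) \<partial>collision_measure) = (\<integral>\<^sup>+p. H p \<partial>collision_measure)" .
qed measurable

lemma integral_invariant_map:
  fixes F :: "'b \<Rightarrow> real"
  assumes "distr M M T = M" "T \<in> M \<rightarrow>\<^sub>M M" "F \<in> borel_measurable M"
  shows "integrable M (\<lambda>x. F (T x)) \<longleftrightarrow> integrable M F" "(\<integral>x. F (T x) \<partial>M) = (\<integral>x. F x \<partial>M)"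
  using integrable_distr_eq[of T M M F] integral_distr[of T M M F] assms by simp_all

section \<open>Elementary inequalities and conservation laws of a single collision\<close>

lemma powr_add_le:
  fixes x y \<beta> :: real
  assumes "0 \<le> x" "0 \<le> y" "0 < \<beta>" "\<beta> \<le> 1"
  shows "(x + y) powr \<beta> \<le> x powr \<beta> + y powr \<beta>"
proof (cases "x + y = 0")
  case True
  then show ?thesis by simp
next
  case False
  then have s: "0 < x + y" using assms by simp
  have *: "z \<le> z powr \<beta>" if "0 \<le> z" "z \<le> 1" for z :: real
  proof (cases "z = 0")
    case False
    then show ?thesis using powr_mono'[of \<beta> 1 z] that assms by simp
  qed simp
  have "1 = x / (x + y) + y / (x + y)" using s by (simp add: add_divide_distrib[symmetric])
  also have "\<dots> \<le> (x / (x + y)) powr \<beta> + (y / (x + y)) powr \<beta>"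
    using assms s by (intro add_mono *) simp_all
  also have "\<dots> = (x powr \<beta> + y powr \<beta>) / (x + y) powr \<beta>"
    using assms s by (simp add: powr_divide add_divide_distrib)
  finally show ?thesis using s by (simp add: field_simps)
qed

lemma norm_diff_powr_le:
  fixes v w :: "'a::real_normed_vector"
  assumes "0 < \<beta>" "\<beta> \<le> 1"
  shows "norm (v - w) powr \<beta> \<le> norm v powr \<beta> + norm w powr \<beta>"
proof -
  have "norm (v - w) powr \<beta> \<le> (norm v + norm w) powr \<beta>"
    using assms by (intro powr_mono2 norm_triangle_ineq4) simp_all
  also have "\<dots> \<le> norm v powr \<beta> + norm w powr \<beta>"
    using assms by (intro powr_add_le) simp_all
  finally show ?thesis .
qed

lemma powr_le_one_plus_square:
  fixes x :: real
  assumes "0 \<le> x" "0 < \<beta>" "\<beta> \<le> 1"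
  shows "x powr \<beta> \<le> 1 + x\<^sup>2"
proof (cases "x \<le> 1")
  case True
  then have "x powr \<beta> \<le> 1" using assms by (intro powr_le1) simp_all
  then show ?thesis by (simp add: add_increasing2)
next
  case False
  then have "x powr \<beta> \<le> x powr 2" using assms by (intro powr_mono) simp_all
  also have "\<dots> = x\<^sup>2" using False by simp
  finally show ?thesis by simp
qed

lemma post_velocity_diff: "post_velocity v w \<sigma> - post_velocity_star v w \<sigma> = norm (v - w) *\<^sub>R \<sigma>"
  using scaleR_left.add[of "norm (v - w) / 2" "norm (v - w) / 2" \<sigma>]
  by (simp add: post_velocity_def post_velocity_star_def)

lemma post_velocity_collision:
  assumes "norm \<sigma> = 1"
  shows "post_velocity (post_velocity v w \<sigma>) (post_velocity_star v w \<sigma>) (sgn (v - w)) = v"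
proof -
  have "post_velocity v w \<sigma> + post_velocity_star v w \<sigma> = v + w"
    using scaleR_half_double[of "v + w"]
    by (simp add: post_velocity_def post_velocity_star_def scaleR_right.add[symmetric])
  then have "post_velocity (post_velocity v w \<sigma>) (post_velocity_star v w \<sigma>) (sgn (v - w))
     = (v + w) /\<^sub>R 2 + (norm (v - w) / 2) *\<^sub>R sgn (v - w)"
    using assms by (simp add: post_velocity_def[of "post_velocity v w \<sigma>"] post_velocity_diff)
  also have "\<dots> = (v + w) /\<^sub>R 2 + (v - w) /\<^sub>R 2"
    by (cases "v = w") (simp_all add: sgn_div_norm)
  also have "\<dots> = v" using scaleR_half_double[of v] by (simp add: algebra_simps)
  finally show ?thesis .
qed

text \<open>The parallelogram law about the centre of mass: the outgoing half difference has the
  length of the incoming one because \<sigma> is a unit vector.\<close>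

lemma energy_conservation:
  assumes "norm \<sigma> = 1"
  shows "(norm (post_velocity v w \<sigma>))\<^sup>2 + (norm (post_velocity_star v w \<sigma>))\<^sup>2 = (norm v)\<^sup>2 + (norm w)\<^sup>2"
proof -
  have ss: "\<sigma> \<bullet> \<sigma> = 1" using assms by (simp add: norm_eq_1)
  have nn: "norm (v - w) * norm (v - w) = (v - w) \<bullet> (v - w)" by (simp add: dot_square_norm power2_eq_square)
  have p: "(norm (a + b))\<^sup>2 + (norm (a - b))\<^sup>2 = 2 * (a \<bullet> a) + 2 * (b \<bullet> b)" for a b :: 'a
    by (simp add: power2_norm_eq_inner inner_add inner_diff inner_commute)
  show ?thesis
    unfolding post_velocity_def post_velocity_star_def p
    by (simp add: ss nn power2_norm_eq_inner) (simp add: inner_add inner_diff inner_commute field_simps)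
qed

text \<open>The kernel in a form where \<open>h\<close> is Borel and nonnegative on the whole line
  and angles are integrated over \<open>angular_measure\<close>. The normalisation makes the total
  cross section exactly \<open>norm u powr \<beta>\<close>.\<close>

locale cutoff_kernel =
  fixes B :: "'a::euclidean_space \<Rightarrow> 'a \<Rightarrow> real" and \<beta> :: real and h :: "real \<Rightarrow> real"
  assumes B_def: "B = hard_potential_kernel \<beta> h"
    and beta: "0 < \<beta>" "\<beta> \<le> 1"
    and h_measurable [measurable]: "h \<in> borel_measurable borel"
    and h_nonneg: "\<And>z. 0 \<le> h z"
    and h_normalised: "\<And>u::'a. u \<noteq> 0 \<Longrightarrow> (\<integral>\<sigma>. h (cos_angle u \<sigma>) \<partial>angular_measure) = 1"
begin

lemma cos_angle_measurable [measurable]: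
  "(\<lambda>x. cos_angle (f x) (k x :: 'b::euclidean_space)) \<in> borel_measurable M"
  if [measurable]: "f \<in> borel_measurable M" "k \<in> borel_measurable M"
  unfolding cos_angle_def by measurable

lemma B_measurable [measurable]:
  "(\<lambda>x. B (f x) (k x)) \<in> borel_measurable M"
  if [measurable]: "f \<in> borel_measurable M" "k \<in> borel_measurable M"
  unfolding B_def hard_potential_kernel_def by measurable

lemma B_nonneg [simp]: "0 \<le> B u \<sigma>"
  by (simp add: B_def hard_potential_kernel_def h_nonneg)

text \<open>Microreversibility: the relative speed is preserved, and \<sigma> and the old direction
  enter the inner product symmetrically.\<close>

lemma B_collision:
  assumes "norm \<sigma> = 1"
  shows "B (post_velocity v w \<sigma> - post_velocity_star v w \<sigma>) (sgn (v - w)) = B (v - w) \<sigma>"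
proof -
  have "B (norm u *\<^sub>R \<sigma>) (sgn u) = B u \<sigma>" for u
    using assms by (cases "u = 0")
      (simp_all add: B_def hard_potential_kernel_def cos_angle_def sgn_div_norm inner_commute field_simps)
  then show ?thesis by (simp only: post_velocity_diff)
qed

lemma B_exchange: "B (w - v) (- \<sigma>) = B (v - w) \<sigma>"
  unfolding B_def hard_potential_kernel_def cos_angle_def
  by (simp add: norm_minus_commute inner_diff_left)

lemma nn_integral_B: "(\<integral>\<^sup>+\<sigma>. ennreal (B u \<sigma>) \<partial>angular_measure) = ennreal (norm u powr \<beta>)"
proof (cases "u = 0")
  case True
  then show ?thesis by (simp add: B_def hard_potential_kernel_def)
next
  case False
  \<comment> \<open>A non-integrable function would have integral 0, so the normalisation itself
    supplies integrability.\<close>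
  have "integrable angular_measure (\<lambda>\<sigma>. h (cos_angle u \<sigma>))"
    using h_normalised[OF False] not_integrable_integral_eq by fastforce
  then have "(\<integral>\<^sup>+\<sigma>. ennreal (h (cos_angle u \<sigma>)) \<partial>angular_measure) = 1"
    by (subst nn_integral_eq_integral) (simp_all add: h_nonneg h_normalised[OF False])
  then show ?thesis
    unfolding B_def hard_potential_kernel_def
    by (simp add: ennreal_mult h_nonneg nn_integral_cmult)
qed

definition rate :: "('a \<Rightarrow> real) \<Rightarrow> 'a \<times> 'a \<times> 'a \<Rightarrow> real" where
  "rate g = (\<lambda>(v, w, \<sigma>). g w * g v * B (v - w) \<sigma>)"

text \<open>Gain minus loss under a single integral over partner and angle, the gain being the loss
  density at the collided state. In this form Fubini and the invariance under
  \<open>collision_map\<close> apply directly; the iterated integrals of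
  \<open>collision_operator\<close> agree with it for almost every \<open>v\<close>.\<close>

definition net_rate :: "('a \<Rightarrow> real) \<Rightarrow> 'a \<Rightarrow> real" where
  "net_rate g v = (\<integral>q. rate g (collision_map (v, q)) - rate g (v, q) \<partial>partner_measure)"

lemma rate_measurable [measurable]:
  assumes [measurable]: "g \<in> borel_measurable borel"
  shows "rate g \<in> borel_measurable borel3"
  unfolding rate_def by measurable

lemma rate_exchange: "rate g (exchange_map p) = rate g p"
  by (cases p) (simp add: rate_def exchange_map_def B_exchange mult.commute)

lemma AE_collision_norm: "AE p in collision_measure. norm (snd (snd (p :: 'a \<times> 'a \<times> 'a))) = 1"
proof (rule collision.AE_pair_measure)
  show "AE x in lborel. AE y in partner_measure. norm (snd (snd (x :: 'a, y :: 'a \<times> 'a))) = 1"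
  proof (rule AE_I2, rule velocity_angle.AE_pair_measure)
    show "AE w in lborel. AE \<sigma> in angular_measure. norm (snd (snd (x :: 'a, w :: 'a, \<sigma> :: 'a))) = 1" for x
      using AE_angular_norm by (rule_tac AE_I2) simp
    show "{q \<in> space partner_measure. norm (snd (snd (x :: 'a, q :: 'a \<times> 'a))) = 1}
        \<in> sets partner_measure" for x
      unfolding snd_conv by measurable
  qed
qed measurable

text \<open>A weight that does not see the angle leaves the angular integral, and the normalisation
  replaces the kernel by \<open>norm (v - w) powr \<beta>\<close>.\<close>

lemma nn_integral_rate:
  assumes [measurable]: "g \<in> borel_measurable borel" and g: "\<And>v. 0 \<le> g v"
    and [measurable]: "\<Psi> \<in> borel_measurable (borel \<Otimes>\<^sub>M borel)"
  shows "(\<integral>\<^sup>+p. ennreal (rate g p) * \<Psi> (fst p, fst (snd p)) \<partial>collision_measure)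
       = (\<integral>\<^sup>+v. (\<integral>\<^sup>+w. ennreal (g w * g v * norm (v - w) powr \<beta>) * \<Psi> (v, w) \<partial>lborel) \<partial>lborel)"
proof -
  have "(\<integral>\<^sup>+p. ennreal (rate g p) * \<Psi> (fst p, fst (snd p)) \<partial>collision_measure)
    = (\<integral>\<^sup>+v. (\<integral>\<^sup>+w. (\<integral>\<^sup>+\<sigma>. ennreal (rate g (v, w, \<sigma>)) * \<Psi> (v, w) \<partial>angular_measure) \<partial>lborel) \<partial>lborel)"
    by (subst nn_integral_collision_measure) simp_all
  also have "\<dots> = (\<integral>\<^sup>+v. (\<integral>\<^sup>+w. ennreal (g w * g v * norm (v - w) powr \<beta>) * \<Psi> (v, w) \<partial>lborel) \<partial>lborel)"
  proof (intro nn_integral_cong)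
    fix v w :: 'a
    have "(\<integral>\<^sup>+\<sigma>. ennreal (rate g (v, w, \<sigma>)) * \<Psi> (v, w) \<partial>angular_measure)
      = (\<integral>\<^sup>+\<sigma>. ennreal (g w * g v) * (ennreal (B (v - w) \<sigma>) * \<Psi> (v, w)) \<partial>angular_measure)"
      using g by (simp add: rate_def ennreal_mult mult_ac)
    also have "\<dots> = ennreal (g w * g v) * (ennreal (norm (v - w) powr \<beta>) * \<Psi> (v, w))"
      by (subst nn_integral_cmult, simp, subst nn_integral_multc) (simp_all add: nn_integral_B)
    also have "\<dots> = ennreal (g w * g v * norm (v - w) powr \<beta>) * \<Psi> (v, w)"
      using g by (simp add: ennreal_mult mult_ac)
    finally show "(\<integral>\<^sup>+\<sigma>. ennreal (rate g (v, w, \<sigma>)) * \<Psi> (v, w) \<partial>angular_measure)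
      = ennreal (g w * g v * norm (v - w) powr \<beta>) * \<Psi> (v, w)" .
  qed
  finally show ?thesis .
qed

end

section \<open>Collision rates of a state with finite mass and energy\<close>

locale kinetic_state = cutoff_kernel B \<beta> h
  for B :: "'a::euclidean_space \<Rightarrow> 'a \<Rightarrow> real" and \<beta> h +
  fixes g :: "'a \<Rightarrow> real" and mass energy :: real
  assumes g_nonneg: "\<And>v. 0 \<le> g v"
    and g_mass: "has_bochner_integral lborel g mass"
    and g_energy: "has_bochner_integral lborel (\<lambda>v. g v * (norm v)\<^sup>2) energy"
begin

lemma g_measurable [measurable]: "g \<in> borel_measurable borel"
  using has_bochner_integral_integrable[of lborel g] g_mass by (auto simp: has_bochner_integral_iff)

lemma mass_nonneg: "0 \<le> mass" and energy_nonneg: "0 \<le> energy"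
  using g_mass g_energy g_nonneg by (auto simp: has_bochner_integral_iff intro!: integral_nonneg)

text \<open>Since \<open>\<beta> \<le> 1\<close>, the power of the relative speed is at most 2 (1 +
  |v|^2) (1 + |w|^2), and the double integral factorises. Thus mass and energy alone make gain and
  loss integrable on the whole collision space.\<close>

lemma nn_integral_rate_le: "(\<integral>\<^sup>+p. ennreal (rate g p) \<partial>collision_measure) \<le> ennreal (2 * (mass + energy)\<^sup>2)"
proof -
  define G where "G v = g v * (1 + (norm v)\<^sup>2)" for v
  have [measurable]: "G \<in> borel_measurable borel" unfolding G_def by measurable
  have Gn: "0 \<le> G v" for v using g_nonneg by (simp add: G_def)
  have "has_bochner_integral lborel G (mass + energy)"
    unfolding G_def using has_bochner_integral_add[OF g_mass g_energy] by (simp add: algebra_simps)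
  then have G: "(\<integral>\<^sup>+v. ennreal (G v) \<partial>lborel) = ennreal (mass + energy)"
    using Gn by (subst nn_integral_eq_integral) (auto simp: has_bochner_integral_iff)
  have "(\<integral>\<^sup>+p. ennreal (rate g p) \<partial>collision_measure)
    = (\<integral>\<^sup>+v. (\<integral>\<^sup>+w. ennreal (g w * g v * norm (v - w) powr \<beta>) \<partial>lborel) \<partial>lborel)"
    using nn_integral_rate[OF g_measurable g_nonneg, of "\<lambda>_. 1"] by simp
  also have "\<dots> \<le> (\<integral>\<^sup>+v. (\<integral>\<^sup>+w. 2 * ennreal (G v) * ennreal (G w) \<partial>lborel) \<partial>lborel)"
  proof (intro nn_integral_mono)
    fix v w :: 'a
    have "norm (v - w) powr \<beta> \<le> (1 + (norm v)\<^sup>2) + (1 + (norm w)\<^sup>2)"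
      using norm_diff_powr_le[OF beta, of v w] powr_le_one_plus_square[OF norm_ge_zero beta, of v]
        powr_le_one_plus_square[OF norm_ge_zero beta, of w] by linarith
    also have "\<dots> \<le> 2 * ((1 + (norm v)\<^sup>2) * (1 + (norm w)\<^sup>2))"
      by (simp add: algebra_simps)
    finally have "g w * g v * norm (v - w) powr \<beta> \<le> g w * g v * (2 * ((1 + (norm v)\<^sup>2) * (1 + (norm w)\<^sup>2)))"
      using g_nonneg by (intro mult_left_mono) simp_all
    also have "\<dots> = 2 * G v * G w" by (simp add: G_def mult_ac)
    finally have "ennreal (g w * g v * norm (v - w) powr \<beta>) \<le> ennreal (2 * G v * G w)"
      by (rule ennreal_leI)
    then show "ennreal (g w * g v * norm (v - w) powr \<beta>) \<le> 2 * ennreal (G v) * ennreal (G w)"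
      using Gn by (simp add: ennreal_mult)
  qed
  also have "\<dots> = 2 * ennreal (mass + energy) * ennreal (mass + energy)"
    by (simp add: nn_integral_cmult nn_integral_multc G)
  also have "\<dots> = ennreal (2 * (mass + energy)\<^sup>2)"
    using mass_nonneg energy_nonneg by (simp add: power2_eq_square ennreal_mult mult.assoc del: ennreal_plus)
  finally show ?thesis .
qed

lemma rate_nonneg: "0 \<le> rate g p"
  by (cases p) (simp add: rate_def g_nonneg)

lemma integrable_rate: "integrable collision_measure (rate g)"
proof (rule integrableI_bounded)
  have "(\<integral>\<^sup>+p. ennreal (norm (rate g p)) \<partial>collision_measure) \<le> ennreal (2 * (mass + energy)\<^sup>2)"
    using nn_integral_rate_le by (simp add: rate_nonneg)
  then show "(\<integral>\<^sup>+p. ennreal (norm (rate g p)) \<partial>collision_measure) < \<infinity>"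
    by (simp add: le_less_trans)
qed measurable

lemma integral_rate_le: "(\<integral>p. rate g p \<partial>collision_measure) \<le> 2 * (mass + energy)\<^sup>2"
  using nn_integral_rate_le nn_integral_eq_integral[OF integrable_rate] rate_nonneg
  by (simp add: ennreal_le_iff)

lemma integrable_rate_mult:
  assumes [measurable]: "K \<in> borel_measurable borel3" and K: "\<And>p. \<bar>K p\<bar> \<le> C"
  shows "integrable collision_measure (\<lambda>p. rate g p * K p)"
proof (rule Bochner_Integration.integrable_bound)
  show "integrable collision_measure (\<lambda>p. C * rate g p)"
    by (intro integrable_mult_right integrable_rate)
  show "AE p in collision_measure. norm (rate g p * K p) \<le> norm (C * rate g p)"
    using K rate_nonneg by (intro AE_I2) (simp add: abs_mult, metis abs_ge_self mult.commute mult_right_mono order_trans)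
qed measurable

lemma integrable_rate_collision: "integrable collision_measure (\<lambda>p. rate g (collision_map p))"
  using integrable_rate by (subst integral_invariant_map(1)[OF distr_collision_map]) measurable

text \<open>Integrability over the collision space gives integrable sections for almost every
  \<open>v\<close>; for those the integral over partner and angle may be iterated, and
  microreversibility identifies the gain.\<close>

lemma collision_operator_eq_net_rate: "AE v in lborel. collision_operator B g v = net_rate g v"
proof -
  define F where "F p = rate g (collision_map p) - rate g p" for p
  have [measurable]: "F \<in> borel_measurable borel3" unfolding F_def by measurable
  have "integrable collision_measure F"
    unfolding F_def by (intro Bochner_Integration.integrable_diff integrable_rate_collision integrable_rate)
  then have "AE v in lborel. integrable partner_measure (\<lambda>q. F (v, q))"
    by (rule collision.AE_integrable_fst')
  then show ?thesis
  proof eventually_elim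
    case (elim v)
    have "net_rate g v = (\<integral>q. F (v, q) \<partial>partner_measure)"
      by (simp add: net_rate_def F_def)
    also have "\<dots> = (\<integral>w. (\<integral>\<sigma>. F (v, w, \<sigma>) \<partial>angular_measure) \<partial>lborel)"
      using velocity_angle.integral_fst'[OF elim] by simp
    also have "\<dots> = (\<integral>w. (\<integral>\<sigma>. collision_integrand B g v w \<sigma>
        \<partial>angular_measure) \<partial>lborel)"
    proof (rule Bochner_Integration.integral_cong[OF refl], rule integral_cong_AE)
      fix w :: 'a
      show "AE \<sigma> in angular_measure. F (v, w, \<sigma>) = collision_integrand B g v w \<sigma>"
        using AE_angular_norm
        by eventually_elim (simp add: F_def rate_def collision_map_def B_collision algebra_simps)
    qed measurable
    also have "\<dots> = collision_operator B g v"
      unfolding collision_operator_def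
      by (intro Bochner_Integration.integral_cong refl integral_sphere_measure[symmetric]) measurable
    finally show ?case ..
  qed
qed

lemma integrable_net_rate: "integrable lborel (net_rate g)"
  and integral_abs_net_rate_le: "(\<integral>v. \<bar>net_rate g v\<bar> \<partial>lborel) \<le> 4 * (mass + energy)\<^sup>2"
proof -
  define F where "F p = rate g (collision_map p) - rate g p" for p
  have F: "integrable collision_measure F"
    unfolding F_def by (intro Bochner_Integration.integrable_diff integrable_rate_collision integrable_rate)
  have eq: "net_rate g v = (\<integral>q. F (v, q) \<partial>partner_measure)" for v
    by (simp add: net_rate_def F_def)
  show 1: "integrable lborel (net_rate g)"
    unfolding eq by (rule collision.integrable_fst'[OF F])
  have F': "integrable collision_measure (\<lambda>p. norm (F p))" using F by (rule integrable_norm)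
  have "(\<integral>v. \<bar>net_rate g v\<bar> \<partial>lborel) \<le> (\<integral>v. (\<integral>q. norm (F (v, q)) \<partial>partner_measure) \<partial>lborel)"
  proof (rule integral_mono)
    show "integrable lborel (\<lambda>v. \<integral>q. norm (F (v, q)) \<partial>partner_measure)"
      using collision.integrable_fst'[OF F'] .
    show "\<bar>net_rate g v\<bar> \<le> (\<integral>q. norm (F (v, q)) \<partial>partner_measure)" for v
      unfolding eq using integral_norm_bound[of _ "\<lambda>q. F (v, q)"] by simp
  qed (use 1 in simp)
  also have "\<dots> = (\<integral>p. norm (F p) \<partial>collision_measure)"
    using collision.integral_fst'[OF F'] .
  also have "\<dots> \<le> (\<integral>p. rate g (collision_map p) + rate g p \<partial>collision_measure)"
  proof (rule integral_mono)
    show "norm (F p) \<le> rate g (collision_map p) + rate g p" for p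
      using rate_nonneg[of p] rate_nonneg[of "collision_map p"] by (simp add: F_def)
  qed (use F' in \<open>auto intro!: integrable_rate_collision integrable_rate\<close>)
  also have "\<dots> = (\<integral>p. rate g (collision_map p) \<partial>collision_measure) + (\<integral>p. rate g p \<partial>collision_measure)"
    by (intro Bochner_Integration.integral_add integrable_rate_collision integrable_rate)
  also have "(\<integral>p. rate g (collision_map p) \<partial>collision_measure) = (\<integral>p. rate g p \<partial>collision_measure)"
    by (rule integral_invariant_map(2)[OF distr_collision_map]) measurable
  finally show "(\<integral>v. \<bar>net_rate g v\<bar> \<partial>lborel) \<le> 4 * (mass + energy)\<^sup>2"
    using integral_rate_le by simp
qed

text \<open>Invariance under \<open>collision_map\<close> moves the gain onto the incoming
  velocities and turns the test function at \<open>v\<close> into its value at the outgoing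
  velocity; invariance under \<open>exchange_map\<close> averages over the partners. Boundedness of
  \<phi> makes the four terms separately integrable.\<close>

lemma weak_form:
  assumes [measurable]: "\<phi> \<in> borel_measurable borel" and \<phi>: "\<And>v. \<bar>\<phi> v\<bar> \<le> C"
  shows "integrable lborel (\<lambda>v. \<phi> v * net_rate g v)"
    and "(\<integral>v. \<phi> v * net_rate g v \<partial>lborel) = (\<integral>p. rate g p * collision_average \<phi> p \<partial>collision_measure)"
proof -
  let ?W = "rate g" and ?I = "integral\<^sup>L (collision_measure :: ('a \<times> 'a \<times> 'a) measure)"
  show "integrable lborel (\<lambda>v. \<phi> v * net_rate g v)"
  proof (rule Bochner_Integration.integrable_bound)
    show "integrable lborel (\<lambda>v. C * net_rate g v)"
      by (intro integrable_mult_right integrable_net_rate)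
    show "AE v in lborel. norm (\<phi> v * net_rate g v) \<le> norm (C * net_rate g v)"
      using \<phi> by (intro AE_I2) (auto simp: abs_mult intro!: mult_right_mono intro: order_trans abs_ge_self)
    have [measurable]: "net_rate g \<in> borel_measurable borel" using integrable_net_rate by auto
    show "(\<lambda>v. \<phi> v * net_rate g v) \<in> borel_measurable lborel" by measurable
  qed
  define a b c d where "a p = \<phi> (fst p)" and "b p = \<phi> (fst (snd p))"
    and "c p = \<phi> (post_velocity (fst p) (fst (snd p)) (snd (snd p)))"
    and "d p = \<phi> (post_velocity_star (fst p) (fst (snd p)) (snd (snd p)))" for p
  have m[measurable]: "a \<in> borel_measurable borel3" "b \<in> borel_measurable borel3"
     "c \<in> borel_measurable borel3" "d \<in> borel_measurable borel3"
    unfolding a_def b_def c_def d_def by measurable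
  have i: "integrable collision_measure (\<lambda>p. ?W p * a p)" "integrable collision_measure (\<lambda>p. ?W p * b p)"
     "integrable collision_measure (\<lambda>p. ?W p * c p)" "integrable collision_measure (\<lambda>p. ?W p * d p)"
    by (rule integrable_rate_mult[where C=C], rule m, simp add: a_def b_def c_def d_def \<phi>)+
  \<comment> \<open>Undoing the collision requires a unit vector \<sigma>, so the identity is
    available almost everywhere.\<close>
  have cJ: "AE p in collision_measure. ?W (collision_map p) * c (collision_map p) = ?W (collision_map p) * a p"
    using AE_collision_norm
    by eventually_elim (auto simp: c_def a_def collision_map_def post_velocity_collision split: prod.splits)
  have iJ: "integrable collision_measure (\<lambda>p. ?W (collision_map p) * a p)"
  proof (rule integrable_cong_AE_imp)
    show "integrable collision_measure (\<lambda>p. ?W (collision_map p) * c (collision_map p))"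
      using i(3) by (subst integral_invariant_map(1)[OF distr_collision_map, of "\<lambda>p. ?W p * c p"]) measurable
    show "AE p in collision_measure. ?W (collision_map p) * c (collision_map p) = ?W (collision_map p) * a p" by (rule cJ)
  qed measurable
  have Iac: "?I (\<lambda>p. ?W (collision_map p) * a p) = ?I (\<lambda>p. ?W p * c p)"
  proof -
    have "?I (\<lambda>p. ?W (collision_map p) * a p) = ?I (\<lambda>p. ?W (collision_map p) * c (collision_map p))"
      using cJ by (intro integral_cong_AE) (measurable, auto)
    also have "\<dots> = ?I (\<lambda>p. ?W p * c p)"
      by (rule integral_invariant_map(2)[OF distr_collision_map, of "\<lambda>p. ?W p * c p"]) measurable
    finally show ?thesis .
  qed
  have Icd: "?I (\<lambda>p. ?W p * c p) = ?I (\<lambda>p. ?W p * d p)"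
  proof -
    have "c (exchange_map p) = d p" for p
      by (cases p) (simp add: c_def d_def exchange_map_def post_velocity_def post_velocity_star_def norm_minus_commute add.commute)
    then have "?I (\<lambda>p. ?W p * d p) = ?I (\<lambda>p. ?W (exchange_map p) * c (exchange_map p))"
      by (simp add: rate_exchange)
    also have "\<dots> = ?I (\<lambda>p. ?W p * c p)"
      by (rule integral_invariant_map(2)[OF distr_exchange_map, of "\<lambda>p. ?W p * c p"]) measurable
    finally show ?thesis ..
  qed
  have Iab: "?I (\<lambda>p. ?W p * a p) = ?I (\<lambda>p. ?W p * b p)"
  proof -
    have "a (exchange_map p) = b p" for p
      by (cases p) (simp add: a_def b_def exchange_map_def)
    then have "?I (\<lambda>p. ?W p * b p) = ?I (\<lambda>p. ?W (exchange_map p) * a (exchange_map p))"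
      by (simp add: rate_exchange)
    also have "\<dots> = ?I (\<lambda>p. ?W p * a p)"
      by (rule integral_invariant_map(2)[OF distr_exchange_map, of "\<lambda>p. ?W p * a p"]) measurable
    finally show ?thesis ..
  qed
  have "(\<integral>v. \<phi> v * net_rate g v \<partial>lborel)
     = (\<integral>v. (\<integral>q. ?W (collision_map (v, q)) * a (v, q) - ?W (v, q) * a (v, q) \<partial>partner_measure) \<partial>lborel)"
    unfolding net_rate_def integral_mult_right_zero[symmetric]
    by (simp add: a_def algebra_simps)
  also have "\<dots> = ?I (\<lambda>p. ?W (collision_map p) * a p - ?W p * a p)"
    by (rule collision.integral_fst') (intro Bochner_Integration.integrable_diff iJ i)
  also have "\<dots> = ?I (\<lambda>p. ?W (collision_map p) * a p) - ?I (\<lambda>p. ?W p * a p)"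
    by (intro Bochner_Integration.integral_diff iJ i)
  also have "\<dots> = (?I (\<lambda>p. ?W p * c p) + ?I (\<lambda>p. ?W p * d p) - ?I (\<lambda>p. ?W p * a p) - ?I (\<lambda>p. ?W p * b p)) / 2"
    using Iac Icd Iab by simp
  also have "\<dots> = ?I (\<lambda>p. (?W p * c p + ?W p * d p - ?W p * a p - ?W p * b p) / 2)"
    using i by simp
  also have "\<dots> = (\<integral>p. rate g p * collision_average \<phi> p \<partial>collision_measure)"
    by (intro Bochner_Integration.integral_cong refl) (auto simp: collision_average_def a_def b_def c_def d_def field_simps)
  finally show "(\<integral>v. \<phi> v * net_rate g v \<partial>lborel) = (\<integral>p. rate g p * collision_average \<phi> p \<partial>collision_measure)" .
qed

end

section \<open>A truncated exponential and its Povzner inequality\<close>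

definition exp_tail :: "real \<Rightarrow> real" where
  "exp_tail x = exp x - 1 - x"

lemma exp_tail_ge_square: "0 \<le> x \<Longrightarrow> x\<^sup>2 / 2 \<le> exp_tail x"
  using exp_lower_Taylor_quadratic[of x] by (simp add: exp_tail_def)

lemma exp_tail_nonneg: "0 \<le> exp_tail x"
  unfolding exp_tail_def using exp_ge_add_one_self[of x] by linarith

lemma exp_tail_0 [simp]: "exp_tail 0 = 0"
  by (simp add: exp_tail_def)

lemma exp_diff_le: "exp b - exp a \<le> (b - a) * exp (b :: real)"
proof -
  have "(1 + (a - b)) * exp b \<le> exp (a - b) * exp b"
    by (intro mult_right_mono exp_ge_add_one_self) simp
  also have "\<dots> = exp a" by (simp flip: exp_add)
  finally show ?thesis by (simp add: algebra_simps)
qed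

lemma exp_diff_ge: "(b - a) * exp a \<le> exp b - exp (a :: real)"
  using exp_diff_le[of a b] by (simp add: algebra_simps)

lemma exp_tail_diff_le: "exp_tail b - exp_tail a \<le> (b - a) * (exp b - 1)"
  using exp_diff_le[of b a] by (simp add: exp_tail_def algebra_simps)

lemma exp_tail_mono: "0 \<le> a \<Longrightarrow> a \<le> b \<Longrightarrow> exp_tail a \<le> exp_tail b"
proof -
  assume ab: "0 \<le> a" "a \<le> b"
  then have "(b - a) * 1 \<le> (b - a) * exp a" by (intro mult_left_mono) simp_all
  then show ?thesis using exp_diff_ge[of b a] by (simp add: exp_tail_def)
qed

lemma exp_convex_origin:
  fixes x r :: real
  assumes "0 \<le> r" "r \<le> 1"
  shows "exp (r * x) - 1 \<le> r * (exp x - 1)"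
proof -
  have "convex_on UNIV (exp :: real \<Rightarrow> real)" by (rule exp_convex)
  then have "exp ((1 - r) *\<^sub>R 0 + r *\<^sub>R x) \<le> (1 - r) * exp 0 + r * exp x"
    using assms by (intro convex_onD) auto
  then show ?thesis by (simp add: algebra_simps)
qed

text \<open>The power series of \<open>exp_tail\<close> starts in degree two, hence the square. The
  surplus \<open>r - r\<^sup>2\<close> over plain convexity is the source of the dissipation, and
  the square also makes the initial excess moment small when \<open>a / a0\<close> is small.\<close>

lemma exp_tail_scale_le:
  assumes "0 \<le> r" "r \<le> 1" "0 \<le> x"
  shows "exp_tail (r * x) \<le> r\<^sup>2 * exp_tail x"
proof -
  have "r\<^sup>2 * exp_tail 0 - exp_tail (r * 0) \<le> r\<^sup>2 * exp_tail x - exp_tail (r * x)"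
  proof (rule DERIV_nonneg_imp_nondecreasing[OF \<open>0 \<le> x\<close>])
    fix y :: real assume "0 \<le> y" "y \<le> x"
    have "((\<lambda>y. r\<^sup>2 * exp_tail y - exp_tail (r * y)) has_real_derivative r * (r * (exp y - 1) - (exp (r * y) - 1))) (at y)"
      unfolding exp_tail_def by (auto intro!: derivative_eq_intros simp: algebra_simps power2_eq_square)
    moreover have "0 \<le> r * (r * (exp y - 1) - (exp (r * y) - 1))"
      using exp_convex_origin[OF assms(1,2), of y] assms(1) by simp
    ultimately show "\<exists>d. ((\<lambda>y. r\<^sup>2 * exp_tail y - exp_tail (r * y)) has_real_derivative d) (at y) \<and> 0 \<le> d"
      by blast
  qed
  then show ?thesis by simp
qed

text \<open>Again the vanishing to second order at 0, now expressed through the derivative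
  \<open>exp x - 1\<close>. It settles the case in which both points lie on the tangent part of
  \<open>trunc_exp_tail\<close>.\<close>

lemma exp_tail_le_half_deriv:
  assumes "0 \<le> x"
  shows "2 * exp_tail x \<le> x * (exp x - 1)"
proof -
  have "0 * (exp 0 - 1) - 2 * exp_tail 0 \<le> x * (exp x - 1) - 2 * exp_tail x"
  proof (rule DERIV_nonneg_imp_nondecreasing[OF \<open>0 \<le> x\<close>])
    fix y :: real assume "0 \<le> y" "y \<le> x"
    have "((\<lambda>y. y * (exp y - 1) - 2 * exp_tail y) has_real_derivative y * exp y - (exp y - exp 0)) (at y)"
      unfolding exp_tail_def by (auto intro!: derivative_eq_intros simp: algebra_simps)
    moreover have "0 \<le> y * exp y - (exp y - exp 0)"
      using exp_diff_le[of y 0] by simp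
    ultimately show "\<exists>d. ((\<lambda>y. y * (exp y - 1) - 2 * exp_tail y) has_real_derivative d) (at y) \<and> 0 \<le> d"
      by blast
  qed
  then show ?thesis by simp
qed

text \<open>\<open>exp_tail\<close>, continued beyond \<open>N\<close> by its tangent: a convex function of linear growth whose
  integral against a state of finite energy exists without further assumptions.\<close>

definition trunc_exp_tail :: "real \<Rightarrow> real \<Rightarrow> real" where
  "trunc_exp_tail N x = exp_tail (min x N) + (exp (min x N) - 1) * (x - min x N)"

lemma trunc_exp_tail_eq: "x \<le> N \<Longrightarrow> trunc_exp_tail N x = exp_tail x"
  by (simp add: trunc_exp_tail_def)

lemma exp_tail_min_le_trunc: "0 \<le> x \<Longrightarrow> 0 \<le> N \<Longrightarrow> exp_tail (min x N) \<le> trunc_exp_tail N x"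
  by (simp add: trunc_exp_tail_def)

lemma trunc_exp_tail_le: "trunc_exp_tail N x \<le> exp_tail x"
  using exp_diff_ge[of x N] by (auto simp: trunc_exp_tail_def exp_tail_def min_def algebra_simps)

text \<open>Origin of the bounded test function: the asymptotic slope \<open>exp N - 1\<close>
  multiplies a conserved quantity and can be subtracted, and what remains is bounded.\<close>

lemma trunc_exp_tail_linear_growth:
  assumes "0 \<le> x" "0 \<le> N"
  shows "\<bar>trunc_exp_tail N x - (exp N - 1) * x\<bar> \<le> exp_tail N + (exp N - 1) * N"
proof (cases "x \<le> N")
  case True
  have "0 \<le> exp_tail x" "exp_tail x \<le> exp_tail N" using assms True by (auto intro: exp_tail_mono exp_tail_nonneg)
  moreover have "0 \<le> (exp N - 1) * x" "(exp N - 1) * x \<le> (exp N - 1) * N"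
    using assms True by (auto intro!: mult_left_mono)
  ultimately show ?thesis using True by (simp add: trunc_exp_tail_eq)
next
  case False
  then have "trunc_exp_tail N x - (exp N - 1) * x = exp_tail N - (exp N - 1) * N"
    by (simp add: trunc_exp_tail_def algebra_simps)
  moreover have "0 \<le> exp_tail N" "0 \<le> (exp N - 1) * N" using assms by (simp_all add: exp_tail_nonneg)
  ultimately show ?thesis by simp
qed

text \<open>Equality holds up to \<open>x + y = N\<close>. If only the sum passes \<open>N\<close>,
  the left side follows the tangent and becomes smaller. If one argument passes \<open>N\<close>,
  the surplus on the right is \<open>exp N\<close> times \<open>exp_tail\<close> of the other one;
  if both do, it is \<open>exp N * exp_tail N\<close>.\<close>

lemma trunc_exp_tail_add_le:
  assumes "0 \<le> x" "0 \<le> y" "0 \<le> N"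
  shows "trunc_exp_tail N (x + y) \<le> trunc_exp_tail N x + trunc_exp_tail N y
    + (exp (min x N) - 1) * (exp (min y N) - 1)"
proof -
  have mixed: "trunc_exp_tail N (x + y) \<le> trunc_exp_tail N x + trunc_exp_tail N y
      + (exp (min x N) - 1) * (exp (min y N) - 1)" if "N < x" "y \<le> N" "0 \<le> x" "0 \<le> y" for x y
  proof -
    have "0 \<le> exp N * exp_tail y" using exp_tail_nonneg by simp
    then show "trunc_exp_tail N (x + y) \<le> trunc_exp_tail N x + trunc_exp_tail N y
      + (exp (min x N) - 1) * (exp (min y N) - 1)"
      using that by (simp add: trunc_exp_tail_def exp_tail_def algebra_simps)
  qed
  consider "x + y \<le> N" | "N < x + y" "x \<le> N" "y \<le> N" | "N < x" "y \<le> N" | "x \<le> N" "N < y" | "N < x" "N < y"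
    by linarith
  then show ?thesis
  proof cases
    case 1
    then show ?thesis using assms by (simp add: trunc_exp_tail_def exp_tail_def exp_add algebra_simps)
  next
    case 2
    then show ?thesis using exp_diff_ge[of "x + y" N] by (simp add: trunc_exp_tail_def exp_tail_def exp_add algebra_simps)
  next
    case 3
    then show ?thesis by (rule mixed) fact+
  next
    case 4
    then show ?thesis using mixed[of y x] assms by (simp add: add_ac mult_ac)
  next
    case 5
    have "0 \<le> exp N * exp_tail N" using exp_tail_nonneg by simp
    then show ?thesis using 5 assms by (simp add: trunc_exp_tail_def exp_tail_def algebra_simps)
  qed
qed

text \<open>Up to \<open>N\<close> this is \<open>exp_tail_scale_le\<close> with
  \<open>r\<^sup>2 = r - r * (1 - r)\<close>. When only \<open>x\<close> is beyond \<open>N\<close>,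
  the scaling is applied at \<open>N\<close> and the rest is bounded by the slope
  \<open>exp N - 1\<close>. When \<open>r * x\<close> is beyond as well, the claim reduces to
  \<open>(1 + r) * exp_tail N \<le> N * (exp N - 1)\<close>.\<close>

lemma trunc_exp_tail_scale_le:
  assumes r: "0 \<le> r" "r \<le> 1" and x: "0 \<le> x" and N: "0 \<le> N"
  shows "trunc_exp_tail N (r * x) \<le> r * trunc_exp_tail N x - r * (1 - r) * exp_tail (min x N)"
proof -
  consider "x \<le> N" | "N < x" "r * x \<le> N" | "N < x" "N < r * x" by linarith
  then show ?thesis
  proof cases
    case 1
    then have "r * x \<le> N" using r x mult_left_le_one_le[of x r] by linarith
    then show ?thesis using 1 exp_tail_scale_le[OF r x]
      by (simp add: trunc_exp_tail_eq power2_eq_square algebra_simps)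
  next
    case 2
    have "r * N \<le> r * x" using 2 r by (intro mult_left_mono) simp_all
    then have "(r * x - r * N) * (exp (r * x) - 1) \<le> (r * x - r * N) * (exp N - 1)"
      using 2 by (intro mult_left_mono) simp_all
    then have "exp_tail (r * x) - exp_tail (r * N) \<le> (r * x - r * N) * (exp N - 1)"
      using exp_tail_diff_le[of "r * x" "r * N"] by linarith
    moreover have "exp_tail (r * N) \<le> r\<^sup>2 * exp_tail N" by (rule exp_tail_scale_le[OF r N])
    ultimately have "exp_tail (r * x) \<le> r\<^sup>2 * exp_tail N + (r * x - r * N) * (exp N - 1)" by linarith
    also have "\<dots> = r * trunc_exp_tail N x - r * (1 - r) * exp_tail (min x N)"
      using 2 by (simp add: trunc_exp_tail_def power2_eq_square algebra_simps)
    finally show ?thesis using 2 by (simp add: trunc_exp_tail_eq)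
  next
    case 3
    have "(1 + r) * exp_tail N \<le> 2 * exp_tail N" using r exp_tail_nonneg by (intro mult_right_mono) simp_all
    also have "\<dots> \<le> N * (exp N - 1)" by (rule exp_tail_le_half_deriv[OF N])
    finally have "0 \<le> (1 - r) * (N * (exp N - 1) - (1 + r) * exp_tail N)" using r by simp
    then show ?thesis using 3 by (simp add: trunc_exp_tail_def algebra_simps)
  qed
qed

text \<open>The scaling bound applied to the two complementary fractions of the total; each
  contributes the same deficit \<open>r * (1 - r)\<close>.\<close>

lemma trunc_exp_tail_split_le:
  assumes "0 \<le> x" "0 \<le> y" "0 \<le> N" "0 < x + y"
  shows "trunc_exp_tail N x + trunc_exp_tail N y
    \<le> trunc_exp_tail N (x + y) - 2 * (x * y / (x + y)\<^sup>2) * exp_tail (min (x + y) N)"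
proof -
  define r where "r = x / (x + y)"
  have r: "0 \<le> r" "r \<le> 1" using assms by (simp_all add: r_def)
  have x: "x = r * (x + y)" using assms by (simp add: r_def)
  have y: "y = (1 - r) * (x + y)" using assms by (simp add: r_def field_simps)
  have xy: "x * y / (x + y)\<^sup>2 = r * (1 - r)"
    using assms by (simp add: r_def field_simps power2_eq_square)
  have s: "0 \<le> x + y" using assms by simp
  show ?thesis
    unfolding xy
    using trunc_exp_tail_scale_le[OF r s \<open>0 \<le> N\<close>] trunc_exp_tail_scale_le[of "1 - r", OF _ _ s \<open>0 \<le> N\<close>] r
    unfolding x[symmetric] y[symmetric] by (simp add: algebra_simps)
qed

text \<open>The squared lengths of the outgoing velocities differ by |v - w| |v + w| times the inner
  product of \<sigma> with the direction \<open>e\<close> of the centre-of-mass velocity, and |v -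
  w| |v + w| is at most \<open>E\<close>. So the energy is shared by both particles unless \<sigma>
  is nearly parallel to that direction.\<close>

lemma post_velocity_energies:
  fixes v w \<sigma> :: "'a::euclidean_space"
  assumes "norm \<sigma> = 1"
  defines "e \<equiv> sgn (v + w)" and "E \<equiv> (norm v)\<^sup>2 + (norm w)\<^sup>2"
  shows "(1 - (e \<bullet> \<sigma>)\<^sup>2) * E\<^sup>2 \<le> 4 * ((norm (post_velocity v w \<sigma>))\<^sup>2 * (norm (post_velocity_star v w \<sigma>))\<^sup>2)"
proof -
  define x y where "x = (norm (post_velocity v w \<sigma>))\<^sup>2" and "y = (norm (post_velocity_star v w \<sigma>))\<^sup>2"
  have sum: "x + y = E" unfolding x_def y_def E_def by (rule energy_conservation) fact
  have "(norm (a + b))\<^sup>2 - (norm (a - b))\<^sup>2 = 4 * (a \<bullet> b)" for a b :: 'a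
    by (simp add: power2_norm_eq_inner inner_add inner_diff inner_commute)
  then have "x - y = 4 * (((v + w) /\<^sub>R 2) \<bullet> ((norm (v - w) / 2) *\<^sub>R \<sigma>))"
    unfolding x_def y_def post_velocity_def post_velocity_star_def .
  also have "\<dots> = norm (v - w) * ((v + w) \<bullet> \<sigma>)" by simp
  also have "(v + w) \<bullet> \<sigma> = norm (v + w) * (e \<bullet> \<sigma>)"
    by (cases "v + w = 0") (simp_all add: e_def sgn_div_norm)
  finally have diff: "x - y = norm (v - w) * norm (v + w) * (e \<bullet> \<sigma>)" by simp
  have "0 \<le> (norm (v - w) - norm (v + w))\<^sup>2" by simp
  also have "\<dots> = 2 * E - 2 * (norm (v - w) * norm (v + w))"
    by (simp add: power2_diff E_def) (simp add: power2_norm_eq_inner inner_add inner_diff inner_commute)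
  finally have "norm (v - w) * norm (v + w) \<le> E" by simp
  then have "(norm (v - w) * norm (v + w))\<^sup>2 \<le> E\<^sup>2" by (intro power_mono) simp_all
  then have "(x - y)\<^sup>2 \<le> E\<^sup>2 * (e \<bullet> \<sigma>)\<^sup>2"
    unfolding diff power_mult_distrib[of _ "e \<bullet> \<sigma>"] by (intro mult_right_mono) simp_all
  moreover have "4 * (x * y) = E\<^sup>2 - (x - y)\<^sup>2" by (simp flip: sum add: power2_eq_square algebra_simps)
  ultimately show ?thesis unfolding x_def[symmetric] y_def[symmetric] by (simp add: algebra_simps)
qed

text \<open>The factor \<open>1 - (e \<bullet> \<sigma>)\<^sup>2\<close> is the gain over plain convexity that produces the dissipation.\<close>

lemma povzner:
  fixes v w \<sigma> :: "'a::euclidean_space"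
  assumes "norm \<sigma> = 1" "0 < a" "0 \<le> N"
  shows "trunc_exp_tail N (a * (norm (post_velocity v w \<sigma>))\<^sup>2) + trunc_exp_tail N (a * (norm (post_velocity_star v w \<sigma>))\<^sup>2)
     - trunc_exp_tail N (a * (norm v)\<^sup>2) - trunc_exp_tail N (a * (norm w)\<^sup>2)
   \<le> (exp (min (a * (norm v)\<^sup>2) N) - 1) * (exp (min (a * (norm w)\<^sup>2) N) - 1)
     - (1 - (sgn (v + w) \<bullet> \<sigma>)\<^sup>2) * exp_tail (min (a * (norm v)\<^sup>2) N) / 2"
proof -
  define x y where "x = a * (norm (post_velocity v w \<sigma>))\<^sup>2" and "y = a * (norm (post_velocity_star v w \<sigma>))\<^sup>2"
  define p q where "p = a * (norm v)\<^sup>2" and "q = a * (norm w)\<^sup>2"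
  define k where "k = 1 - (sgn (v + w) \<bullet> \<sigma>)\<^sup>2"
  have nn: "0 \<le> x" "0 \<le> y" "0 \<le> p" "0 \<le> q" using assms by (simp_all add: x_def y_def p_def q_def)
  have sum: "x + y = p + q"
    using energy_conservation[OF assms(1), of v w] by (simp add: x_def y_def p_def q_def flip: distrib_left)
  have "\<bar>sgn (v + w) \<bullet> \<sigma>\<bar> \<le> norm (sgn (v + w)) * norm \<sigma>" by (rule Cauchy_Schwarz_ineq2)
  also have "\<dots> \<le> 1" using assms by (simp add: norm_sgn)
  finally have k: "0 \<le> k" by (simp add: k_def abs_square_le_1)
  have "a\<^sup>2 * (k * ((norm v)\<^sup>2 + (norm w)\<^sup>2)\<^sup>2) \<le> a\<^sup>2 * (4 * ((norm (post_velocity v w \<sigma>))\<^sup>2 * (norm (post_velocity_star v w \<sigma>))\<^sup>2))"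
    unfolding k_def by (intro mult_left_mono post_velocity_energies assms) simp
  then have kxy: "k * (p + q)\<^sup>2 \<le> 4 * (x * y)"
    by (simp add: x_def y_def p_def q_def power2_eq_square algebra_simps)
  have add: "trunc_exp_tail N (p + q) \<le> trunc_exp_tail N p + trunc_exp_tail N q + (exp (min p N) - 1) * (exp (min q N) - 1)"
    by (rule trunc_exp_tail_add_le) (use nn assms in auto)
  have split: "trunc_exp_tail N x + trunc_exp_tail N y \<le> trunc_exp_tail N (p + q) - k * exp_tail (min p N) / 2"
  proof (cases "p + q = 0")
    case True
    then have "x = 0" "y = 0" "p = 0" "q = 0" using nn sum by auto
    then show ?thesis using assms by (simp add: trunc_exp_tail_def)
  next
    case False
    then have pos: "0 < x + y" using nn sum by simp
    have "k / 2 \<le> 2 * (x * y / (x + y)\<^sup>2)"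
      using kxy pos unfolding sum by (simp add: field_simps)
    \<comment> \<open>The deficit is measured at the total energy; keeping only the share of
      \<open>v\<close> gives a weight from which the partner can later be integrated out.\<close>
    moreover have "exp_tail (min p N) \<le> exp_tail (min (x + y) N)"
      unfolding sum using nn assms by (intro exp_tail_mono) auto
    ultimately have "k / 2 * exp_tail (min p N) \<le> 2 * (x * y / (x + y)\<^sup>2) * exp_tail (min (x + y) N)"
      using k by (intro mult_mono) (auto simp: exp_tail_nonneg)
    then show ?thesis
      using trunc_exp_tail_split_le[OF nn(1,2) assms(3) pos] by (simp add: sum)
  qed
  show ?thesis
    unfolding x_def[symmetric] y_def[symmetric] p_def[symmetric] q_def[symmetric] k_def[symmetric]
    using add split by simp
qed

section \<open>Uniform positivity of the angular dissipation\<close>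

context cutoff_kernel
begin

text \<open>The direction of the relative velocity is rotated to a fixed \<open>b\<close>, and the
  average is minimised over \<open>e\<close> in the closed ball rather than the sphere because
  \<open>sgn (v + w)\<close> may vanish. Continuity in \<open>e\<close> is dominated convergence. A
  vanishing minimum would force \<open>h (b \<bullet> \<sigma>) = 0\<close> for almost every
  \<sigma>, against the normalisation. The \<open>max 0\<close> keeps the integrand nonnegative off
  the sphere.\<close>

lemma angular_dissipation:
  assumes "2 \<le> DIM('a)"
  obtains \<eta> where "0 < \<eta>"
    "\<And>u e :: 'a. norm e \<le> 1 \<Longrightarrow>
      ennreal (\<eta> * norm u powr \<beta>) \<le> (\<integral>\<^sup>+\<sigma>. ennreal (B u \<sigma> * max 0 (1 - (e \<bullet> \<sigma>)\<^sup>2)) \<partial>angular_measure)"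
proof -
  obtain b :: 'a where "b \<in> Basis" using nonempty_Basis by blast
  then have b: "norm b = 1" by simp
  then have b0: "b \<noteq> 0" by auto
  have cb: "cos_angle b \<sigma> = b \<bullet> \<sigma>" for \<sigma> by (simp add: cos_angle_def b)
  have int_b: "(\<integral>\<sigma>. h (b \<bullet> \<sigma>) \<partial>angular_measure) = 1" using h_normalised[OF b0] by (simp add: cb)
  then have i_b: "integrable angular_measure (\<lambda>\<sigma>. h (b \<bullet> \<sigma>))" using not_integrable_integral_eq by fastforce
  define k where "k e \<sigma> = max 0 (1 - (e \<bullet> \<sigma>)\<^sup>2)" for e \<sigma> :: 'a
  have [measurable]: "k e \<in> borel_measurable borel" for e unfolding k_def by measurable
  have k: "0 \<le> k e \<sigma>" "k e \<sigma> \<le> 1" for e \<sigma> by (auto simp: k_def)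
  define q where "q e = (\<integral>\<sigma>. h (b \<bullet> \<sigma>) * k e \<sigma> \<partial>angular_measure)" for e
  have i_k: "integrable angular_measure (\<lambda>\<sigma>. h (b \<bullet> \<sigma>) * k e \<sigma>)" for e
  proof (rule Bochner_Integration.integrable_bound[OF i_b])
    show "AE \<sigma> in angular_measure. norm (h (b \<bullet> \<sigma>) * k e \<sigma>) \<le> norm (h (b \<bullet> \<sigma>))"
      using k h_nonneg by (intro AE_I2) (simp add: abs_mult mult_left_le)
  qed simp
  have "continuous_on (cball 0 1) q"
    unfolding continuous_on_sequentially comp_def
  proof (intro ballI allI impI)
    fix s e assume s: "(\<forall>n. s n \<in> cball 0 (1::real)) \<and> s \<longlonglongrightarrow> (e :: 'a)"
    show "(\<lambda>n. q (s n)) \<longlonglongrightarrow> q e"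
      unfolding q_def
    proof (rule integral_dominated_convergence[where w="\<lambda>\<sigma>. h (b \<bullet> \<sigma>)"])
      show "AE \<sigma> in angular_measure. (\<lambda>n. h (b \<bullet> \<sigma>) * k (s n) \<sigma>) \<longlonglongrightarrow> h (b \<bullet> \<sigma>) * k e \<sigma>"
        unfolding k_def using s by (intro AE_I2 tendsto_intros) auto
      show "AE \<sigma> in angular_measure. norm (h (b \<bullet> \<sigma>) * k (s n) \<sigma>) \<le> h (b \<bullet> \<sigma>)" for n
        using k h_nonneg by (intro AE_I2) (simp add: abs_mult mult_left_le)
    qed (use i_b in simp_all)
  qed
  then obtain e0 where e0: "e0 \<in> cball 0 1" "\<And>e. e \<in> cball 0 1 \<Longrightarrow> q e0 \<le> q e"
    using continuous_attains_inf[of "cball (0::'a) 1" q] by auto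
  have "0 \<le> q e0" unfolding q_def using k h_nonneg by (intro Bochner_Integration.integral_nonneg) simp
  moreover have "q e0 \<noteq> 0"
  proof
    assume "q e0 = 0"
    then have "AE \<sigma> in angular_measure. h (b \<bullet> \<sigma>) * k e0 \<sigma> = 0"
      unfolding q_def using i_k k h_nonneg by (subst (asm) integral_nonneg_eq_0_iff_AE) simp_all
    moreover have "AE \<sigma> in angular_measure. \<bar>e0 \<bullet> \<sigma>\<bar> < 1"
      using e0 assms by (intro AE_angular_inner_less) simp_all
    ultimately have "AE \<sigma> in angular_measure. h (b \<bullet> \<sigma>) = 0"
    proof eventually_elim
      case (elim \<sigma>)
      then have "(e0 \<bullet> \<sigma>)\<^sup>2 < 1" by (simp add: abs_square_less_1)
      then show ?case using elim by (simp add: k_def max_def)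
    qed
    then have "(\<integral>\<sigma>. h (b \<bullet> \<sigma>) \<partial>angular_measure) = (\<integral>\<sigma>. 0 \<partial>(angular_measure :: 'a measure))"
      by (intro integral_cong_AE) simp_all
    then show False using int_b by simp
  qed
  ultimately have pos: "0 < q e0" by simp
  show ?thesis
  proof (rule that[OF pos])
    fix u e :: 'a assume e: "norm e \<le> 1"
    show "ennreal (q e0 * norm u powr \<beta>) \<le> (\<integral>\<^sup>+\<sigma>. ennreal (B u \<sigma> * max 0 (1 - (e \<bullet> \<sigma>)\<^sup>2)) \<partial>angular_measure)"
    proof (cases "u = 0")
      case False
      have "norm (sgn u) = 1" using False by (simp add: norm_sgn)
      then obtain T where T: "orthogonal_transformation T" "T (sgn u) = b"
        using b by (rule orthogonal_transformation_maps_unit)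
      have inn: "T x \<bullet> T y = x \<bullet> y" for x y using T by (simp add: orthogonal_transformation_def)
      have Te: "T e \<in> cball 0 1" using e T by (simp add: orthogonal_transformation_norm)
      have [measurable]: "T \<in> borel_measurable borel" by (rule borel_measurable_orthogonal_transformation[OF T(1)])
      have eq: "h (cos_angle u \<sigma>) * k e \<sigma> = h (b \<bullet> T \<sigma>) * k (T e) (T \<sigma>)" for \<sigma>
        by (simp add: T(2)[symmetric] inn k_def cos_angle_def sgn_div_norm divide_inverse mult.commute)
      have "(\<integral>\<^sup>+\<sigma>. ennreal (B u \<sigma> * max 0 (1 - (e \<bullet> \<sigma>)\<^sup>2)) \<partial>angular_measure)
        = (\<integral>\<^sup>+\<sigma>. ennreal (norm u powr \<beta>) * ennreal (h (b \<bullet> T \<sigma>) * k (T e) (T \<sigma>)) \<partial>angular_measure)"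
        by (intro nn_integral_cong) (simp add: B_def hard_potential_kernel_def mult.assoc flip: ennreal_mult' eq k_def)
      also have "\<dots> = ennreal (norm u powr \<beta>) * (\<integral>\<^sup>+\<sigma>. ennreal (h (b \<bullet> T \<sigma>) * k (T e) (T \<sigma>)) \<partial>angular_measure)"
        by (rule nn_integral_cmult) simp
      also have "(\<integral>\<^sup>+\<sigma>. ennreal (h (b \<bullet> T \<sigma>) * k (T e) (T \<sigma>)) \<partial>angular_measure)
         = (\<integral>\<^sup>+\<sigma>. ennreal (h (b \<bullet> \<sigma>) * k (T e) \<sigma>) \<partial>distr angular_measure borel T)"
        by (rule nn_integral_distr[symmetric]) simp_all
      also have "\<dots> = (\<integral>\<^sup>+\<sigma>. ennreal (h (b \<bullet> \<sigma>) * k (T e) \<sigma>) \<partial>angular_measure)"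
        by (simp add: distr_angular_isometry[OF T(1)])
      also have "\<dots> = ennreal (q (T e))"
        unfolding q_def by (rule nn_integral_eq_integral[OF i_k]) (use k h_nonneg in simp)
      also have "ennreal (norm u powr \<beta>) * \<dots> = ennreal (q (T e) * norm u powr \<beta>)"
        by (simp add: ennreal_mult' mult.commute flip: ennreal_mult'')
      also have "ennreal (q e0 * norm u powr \<beta>) \<le> \<dots>"
        using e0(2)[OF Te] by (intro ennreal_leI mult_right_mono) simp_all
      finally show ?thesis .
    qed simp
  qed
qed

end

section \<open>Dissipation of exponential moments\<close>

context kinetic_state
begin

lemma integrable_weight:
  assumes [measurable]: "K \<in> borel_measurable borel" and K: "\<And>v. \<bar>K v\<bar> \<le> C * (1 + (norm v)\<^sup>2)"
  shows "integrable lborel (\<lambda>v. g v * K v)"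
proof (rule Bochner_Integration.integrable_bound)
  show "integrable lborel (\<lambda>v. C * (g v + g v * (norm v)\<^sup>2))"
    using g_mass g_energy by (auto simp: has_bochner_integral_iff)
  show "AE v in lborel. norm (g v * K v) \<le> norm (C * (g v + g v * (norm v)\<^sup>2))"
  proof (rule AE_I2)
    fix v
    have "norm (g v * K v) \<le> g v * (C * (1 + (norm v)\<^sup>2))"
      using K g_nonneg by (simp add: abs_mult mult_left_mono)
    also have "\<dots> = C * (g v + g v * (norm v)\<^sup>2)" by (simp add: algebra_simps)
    finally show "norm (g v * K v) \<le> norm (C * (g v + g v * (norm v)\<^sup>2))" by simp
  qed
qed measurable

text \<open>Chebyshev's argument: partners with |w| at most |v| / 2 have relative speed at least |v|
  / 2, and by the choice of \<open>R\<close> the others carry at most half of the mass. The second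
  factor 1/2 comes from \<open>2 powr \<beta> \<le> 2\<close>.\<close>

lemma collision_frequency_ge:
  assumes "0 < R" "8 * energy \<le> mass * R\<^sup>2" "R \<le> norm v"
  shows "ennreal (mass / 4 * norm v powr \<beta>) \<le> (\<integral>\<^sup>+w. ennreal (g w * norm (v - w) powr \<beta>) \<partial>lborel)"
proof -
  let ?r = "norm v"
  have r: "0 < ?r" using assms(1,3) by linarith
  \<comment> \<open>The factor \<open>1 - 4 * (norm w)\<^sup>2 / ?r\<^sup>2\<close> replaces the
    indicator of |w| \<le> |v| / 2: it lies below the indicator, and its integral against
    \<open>g\<close> involves mass and energy only.\<close>
  have low: "g w * ((?r / 2) powr \<beta> * (1 - 4 * (norm w)\<^sup>2 / ?r\<^sup>2)) \<le> g w * norm (v - w) powr \<beta>" for w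
  proof (rule mult_left_mono[OF _ g_nonneg])
    show "(?r / 2) powr \<beta> * (1 - 4 * (norm w)\<^sup>2 / ?r\<^sup>2) \<le> norm (v - w) powr \<beta>"
    proof (cases "norm w \<le> ?r / 2")
      case True
      have "?r / 2 \<le> norm (v - w)" using True norm_triangle_ineq2[of v w] by linarith
      then have "(?r / 2) powr \<beta> \<le> norm (v - w) powr \<beta>" using beta r by (intro powr_mono2) simp_all
      moreover have "(?r / 2) powr \<beta> * (1 - 4 * (norm w)\<^sup>2 / ?r\<^sup>2) \<le> (?r / 2) powr \<beta>"
        by (rule mult_left_le) simp_all
      ultimately show ?thesis by simp
    next
      case False
      then have "?r\<^sup>2 \<le> (2 * norm w)\<^sup>2" using r by (intro power_mono) simp_all
      then have "1 - 4 * (norm w)\<^sup>2 / ?r\<^sup>2 \<le> 0" using r by (simp add: power_mult_distrib field_simps)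
      then have "(?r / 2) powr \<beta> * (1 - 4 * (norm w)\<^sup>2 / ?r\<^sup>2) \<le> 0" by (intro mult_nonneg_nonpos) simp_all
      then show ?thesis using powr_ge_zero order_trans by blast
    qed
  qed
  have i1: "integrable lborel (\<lambda>w. g w * norm (v - w) powr \<beta>)"
  proof (rule integrable_weight[where C="2 + ?r\<^sup>2"])
    fix w
    have "\<bar>norm (v - w) powr \<beta>\<bar> \<le> (1 + ?r\<^sup>2) + (1 + (norm w)\<^sup>2)"
      using norm_diff_powr_le[OF beta, of v w] powr_le_one_plus_square[OF norm_ge_zero beta, of v]
        powr_le_one_plus_square[OF norm_ge_zero beta, of w] by simp
    also have "\<dots> \<le> (2 + ?r\<^sup>2) * (1 + (norm w)\<^sup>2)" by (simp add: algebra_simps)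
    finally show "\<bar>norm (v - w) powr \<beta>\<bar> \<le> (2 + ?r\<^sup>2) * (1 + (norm w)\<^sup>2)" .
  qed measurable
  have i2: "has_bochner_integral lborel (\<lambda>w. g w * ((?r / 2) powr \<beta> * (1 - 4 * (norm w)\<^sup>2 / ?r\<^sup>2)))
     ((?r / 2) powr \<beta> * (mass - 4 / ?r\<^sup>2 * energy))"
  proof -
    have "(\<lambda>w. g w * ((?r / 2) powr \<beta> * (1 - 4 * (norm w)\<^sup>2 / ?r\<^sup>2)))
       = (\<lambda>w. (?r / 2) powr \<beta> * (g w - 4 / ?r\<^sup>2 * (g w * (norm w)\<^sup>2)))"
      by (rule ext) (simp add: algebra_simps)
    then show ?thesis
      using g_mass g_energy
      by (simp only:) (intro has_bochner_integral_mult_right has_bochner_integral_diff impI)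
  qed
  have "4 / ?r\<^sup>2 * energy \<le> mass / 2"
  proof -
    have "R\<^sup>2 \<le> ?r\<^sup>2" using assms by (intro power_mono) simp_all
    then have "mass * R\<^sup>2 \<le> mass * ?r\<^sup>2" using mass_nonneg by (rule mult_left_mono)
    then have "8 * energy \<le> mass * ?r\<^sup>2" using assms(2) by linarith
    then show ?thesis using r by (simp add: field_simps)
  qed
  moreover have "?r powr \<beta> / 2 \<le> (?r / 2) powr \<beta>"
  proof -
    have "(2::real) powr \<beta> \<le> 2 powr 1" using beta by (intro powr_mono) simp_all
    then show ?thesis using r by (simp add: powr_divide field_simps mult_left_mono)
  qed
  ultimately have "(?r powr \<beta> / 2) * (mass / 2) \<le> (?r / 2) powr \<beta> * (mass - 4 / ?r\<^sup>2 * energy)"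
    using mass_nonneg by (intro mult_mono) simp_all
  also have "\<dots> \<le> (\<integral>w. g w * norm (v - w) powr \<beta> \<partial>lborel)"
    using i1 i2 low by (subst has_bochner_integral_integral_eq[OF i2, symmetric]) (intro integral_mono, auto simp: has_bochner_integral_iff)
  finally have "mass / 4 * ?r powr \<beta> \<le> (\<integral>w. g w * norm (v - w) powr \<beta> \<partial>lborel)" by (simp add: mult.commute)
  moreover have "(\<integral>\<^sup>+w. ennreal (g w * norm (v - w) powr \<beta>) \<partial>lborel) = ennreal (\<integral>w. g w * norm (v - w) powr \<beta> \<partial>lborel)"
    using g_nonneg by (intro nn_integral_eq_integral i1) simp
  ultimately show ?thesis by (simp add: ennreal_leI)
qed

lemma dissipation_estimate:
  fixes a N \<eta> R :: real
  assumes \<eta>: "0 < \<eta>" "\<And>u e :: 'a. norm e \<le> 1 \<Longrightarrow>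
      ennreal (\<eta> * norm u powr \<beta>) \<le> (\<integral>\<^sup>+\<sigma>. ennreal (B u \<sigma> * max 0 (1 - (e \<bullet> \<sigma>)\<^sup>2)) \<partial>angular_measure)"
    and a: "0 < a" and N: "2 \<le> N"
    and R: "0 < R" "8 * energy \<le> mass * R\<^sup>2"
  defines "\<psi> \<equiv> \<lambda>v. exp_tail (min (a * (norm v)\<^sup>2) N)"
    and "\<phi> \<equiv> \<lambda>v. trunc_exp_tail N (a * (norm v)\<^sup>2) - (exp N - 1) * (a * (norm v)\<^sup>2)"
  defines "L \<equiv> \<integral>v. g v * (norm v powr \<beta> * \<psi> v) \<partial>lborel"
  shows "(\<integral>v. \<phi> v * net_rate g v \<partial>lborel)
    \<le> (2 * L + (2 / a) powr (\<beta> / 2) * a * energy) * ((\<integral>v. g v * \<psi> v \<partial>lborel) + a * energy)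
      - \<eta> * mass / 16 * (L - R powr \<beta> * exp_tail (a * R\<^sup>2) * mass)"
proof -
  define X where "X v = min (a * (norm v)\<^sup>2) N" for v :: 'a
  define P where "P v = trunc_exp_tail N (a * (norm v)\<^sup>2)" for v :: 'a
  define \<theta> where "\<theta> v = exp (X v) - 1" for v
  define k where "k p = (case p of (v, w, \<sigma>) \<Rightarrow> max 0 (1 - (sgn (v + w) \<bullet> \<sigma>)\<^sup>2))" for p :: "'a \<times> 'a \<times> 'a"
  have \<psi>X: "\<psi> v = exp_tail (X v)" for v by (simp add: \<psi>_def X_def)
  have X: "0 \<le> X v" "X v \<le> N" "X v \<le> a * (norm v)\<^sup>2" for v using a N by (simp_all add: X_def)
  have \<psi>0: "0 \<le> \<psi> v" for v by (simp add: \<psi>_def exp_tail_nonneg)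
  have \<psi>b: "\<psi> v \<le> exp_tail N" for v unfolding \<psi>X using X by (intro exp_tail_mono) auto
  have \<theta>0: "0 \<le> \<theta> v" for v using X by (simp add: \<theta>_def)
  have \<theta>b: "\<theta> v \<le> exp N - 1" for v using X by (simp add: \<theta>_def)
  have \<theta>: "\<theta> v = \<psi> v + X v" for v by (simp add: \<theta>_def \<psi>X exp_tail_def)
  have [measurable]: "X \<in> borel_measurable borel" unfolding X_def by measurable
  have [measurable]: "exp_tail \<in> borel_measurable borel" unfolding exp_tail_def[abs_def] by measurable
  have [measurable]: "trunc_exp_tail N \<in> borel_measurable borel" unfolding trunc_exp_tail_def[abs_def] by measurable
  have [measurable]: "\<psi> \<in> borel_measurable borel" "\<theta> \<in> borel_measurable borel" "P \<in> borel_measurable borel" "\<phi> \<in> borel_measurable borel"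
    unfolding \<psi>X[abs_def] \<theta>_def P_def \<phi>_def by measurable
  have [measurable]: "k \<in> borel_measurable borel3" unfolding k_def by measurable
  have k: "0 \<le> k p" "k p \<le> 1" for p by (auto simp: k_def split: prod.split)
  have bound1: "\<bar>K v\<bar> \<le> C * (1 + (norm v)\<^sup>2)" if "0 \<le> K v" "K v \<le> C" for K and C :: real and v :: 'a
  proof -
    have "C * 1 \<le> C * (1 + (norm v)\<^sup>2)" using that by (intro mult_left_mono) auto
    then show ?thesis using that by simp
  qed
  have bound2: "\<bar>norm v powr \<beta> * K v\<bar> \<le> C * (1 + (norm v)\<^sup>2)" if "0 \<le> K v" "K v \<le> C" for K and C :: real and v :: 'a
  proof -
    have "norm v powr \<beta> * K v \<le> (1 + (norm v)\<^sup>2) * C"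
      using that powr_le_one_plus_square[OF norm_ge_zero beta, of v] by (intro mult_mono) simp_all
    then show ?thesis using that by (simp add: mult.commute)
  qed
  have i_\<psi>: "integrable lborel (\<lambda>v. g v * \<psi> v)" by (rule integrable_weight[where C="exp_tail N"]) (measurable, intro bound1 \<psi>0 \<psi>b)
  have i_\<theta>: "integrable lborel (\<lambda>v. g v * \<theta> v)" by (rule integrable_weight[where C="exp N - 1"]) (measurable, intro bound1 \<theta>0 \<theta>b)
  have i_L: "integrable lborel (\<lambda>v. g v * (norm v powr \<beta> * \<psi> v))"
    by (rule integrable_weight[where C="exp_tail N"]) (measurable, intro bound2 \<psi>0 \<psi>b)
  have i_T: "integrable lborel (\<lambda>v. g v * (norm v powr \<beta> * \<theta> v))"
    by (rule integrable_weight[where C="exp N - 1"]) (measurable, intro bound2 \<theta>0 \<theta>b)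
  define T where "T = (\<integral>v. g v * (norm v powr \<beta> * \<theta> v) \<partial>lborel)"
  define z where "z = (\<integral>v. g v * \<psi> v \<partial>lborel)"
  have i_e: "integrable lborel (\<lambda>v. g v * (norm v)\<^sup>2)" "(\<integral>v. g v * (norm v)\<^sup>2 \<partial>lborel) = energy"
    and i_m: "integrable lborel g" "integral\<^sup>L lborel g = mass"
    using g_energy g_mass by (simp_all add: has_bochner_integral_iff)
  have z\<theta>: "(\<integral>v. g v * \<theta> v \<partial>lborel) \<le> z + a * energy"
  proof -
    have "(\<integral>v. g v * \<theta> v \<partial>lborel) \<le> (\<integral>v. g v * \<psi> v + a * (g v * (norm v)\<^sup>2) \<partial>lborel)"
    proof (rule integral_mono[OF i_\<theta>])
      fix v
      have "g v * \<theta> v \<le> g v * (\<psi> v + a * (norm v)\<^sup>2)"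
        using g_nonneg X(3)[of v] by (intro mult_left_mono) (simp_all add: \<theta>)
      then show "g v * \<theta> v \<le> g v * \<psi> v + a * (g v * (norm v)\<^sup>2)" by (simp add: algebra_simps)
    qed (use i_\<psi> i_e in simp)
    also have "\<dots> = z + a * energy" using i_\<psi> i_e by (simp add: z_def)
    finally show ?thesis .
  qed
  let ?c = "(2 / a) powr (\<beta> / 2) * a"
  have T: "T \<le> 2 * L + ?c * energy"
  proof -
    have "T \<le> (\<integral>v. 2 * (g v * (norm v powr \<beta> * \<psi> v)) + ?c * (g v * (norm v)\<^sup>2) \<partial>lborel)"
      unfolding T_def
    proof (rule integral_mono[OF i_T])
      fix v
      \<comment> \<open>Where \<open>X v\<close> is at least 2, the quadratic Taylor bound puts it
        below \<open>\<psi> v\<close>. Elsewhere \<open>2 \<le> N\<close> makes the truncation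
        inactive, so |v|^2 < 2 / a; this is the origin of \<open>?c\<close>.\<close>
      have "norm v powr \<beta> * X v \<le> norm v powr \<beta> * \<psi> v + ?c * (norm v)\<^sup>2"
      proof (cases "2 \<le> X v")
        case True
        have "2 * X v \<le> X v * X v" using True X(1) by (intro mult_right_mono)
        then have "X v \<le> \<psi> v"
          unfolding \<psi>X using exp_tail_ge_square[OF X(1), of v] by (simp add: power2_eq_square)
        then have "norm v powr \<beta> * X v \<le> norm v powr \<beta> * \<psi> v" by (intro mult_left_mono) simp_all
        then show ?thesis using a by (simp add: add_increasing2)
      next
        case False
        then have "a * (norm v)\<^sup>2 < 2" using N by (simp add: X_def)
        then have "(norm v)\<^sup>2 \<le> 2 / a" using a by (simp add: field_simps)
        then have "((norm v)\<^sup>2) powr (\<beta> / 2) \<le> (2 / a) powr (\<beta> / 2)" using beta by (intro powr_mono2) simp_all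
        moreover have "((norm v)\<^sup>2) powr (\<beta> / 2) = norm v powr \<beta>"
          using powr_powr[of "norm v" 2 "\<beta> / 2"] by simp
        ultimately have "norm v powr \<beta> * X v \<le> (2 / a) powr (\<beta> / 2) * (a * (norm v)\<^sup>2)"
          using X by (intro mult_mono) simp_all
        then show ?thesis using \<psi>0[of v] by (simp add: add_increasing mult.assoc)
      qed
      then have "norm v powr \<beta> * \<theta> v \<le> 2 * (norm v powr \<beta> * \<psi> v) + ?c * (norm v)\<^sup>2"
        by (simp add: \<theta> algebra_simps)
      then have "g v * (norm v powr \<beta> * \<theta> v) \<le> g v * (2 * (norm v powr \<beta> * \<psi> v) + ?c * (norm v)\<^sup>2)"
        by (rule mult_left_mono[OF _ g_nonneg])
      then show "g v * (norm v powr \<beta> * \<theta> v) \<le> 2 * (g v * (norm v powr \<beta> * \<psi> v)) + ?c * (g v * (norm v)\<^sup>2)"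
        by (simp add: algebra_simps)
    qed (use i_L i_e in simp)
    also have "\<dots> = 2 * L + ?c * energy" using i_L i_e by (simp add: L_def)
    finally show ?thesis .
  qed
  let ?\<Pi> = "collision_measure :: ('a \<times> 'a \<times> 'a) measure"
  define gain where "gain = (\<integral>p. rate g p * (\<theta> (fst p) * \<theta> (fst (snd p))) \<partial>?\<Pi>)"
  define loss where "loss = (\<integral>p. rate g p * (k p * \<psi> (fst p)) \<partial>?\<Pi>)"
  have \<theta>\<theta>b: "\<bar>\<theta> v * \<theta> w\<bar> \<le> (exp N - 1) * (exp N - 1)" for v w
    using \<theta>0 \<theta>b N by (auto simp: abs_mult intro!: mult_mono)
  have i_gain: "integrable ?\<Pi> (\<lambda>p. rate g p * (\<theta> (fst p) * \<theta> (fst (snd p))))"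
    by (rule integrable_rate_mult[OF _ \<theta>\<theta>b]) measurable
  have k\<psi>b: "\<bar>k p * \<psi> v\<bar> \<le> 1 * exp_tail N" for p v
    using mult_mono[of "k p" 1 "\<psi> v" "exp_tail N"] k[of p] \<psi>0[of v] \<psi>b[of v] by (simp add: abs_mult)
  have i_loss: "integrable ?\<Pi> (\<lambda>p. rate g p * (k p * \<psi> (fst p)))"
    by (rule integrable_rate_mult[OF _ k\<psi>b]) measurable
  have gain: "gain \<le> 2 * (T * (\<integral>v. g v * \<theta> v \<partial>lborel))"
  proof -
    let ?t = "\<lambda>v. ennreal (g v * (norm v powr \<beta> * \<theta> v))" and ?s = "\<lambda>v. ennreal (g v * \<theta> v)"
    have t: "(\<integral>\<^sup>+v. ?t v \<partial>lborel) = ennreal T"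
      unfolding T_def using g_nonneg \<theta>0 by (intro nn_integral_eq_integral i_T) simp
    have s: "(\<integral>\<^sup>+v. ?s v \<partial>lborel) = ennreal (\<integral>v. g v * \<theta> v \<partial>lborel)"
      using g_nonneg \<theta>0 by (intro nn_integral_eq_integral i_\<theta>) simp
    have T0: "0 \<le> T" "0 \<le> (\<integral>v. g v * \<theta> v \<partial>lborel)"
      unfolding T_def using g_nonneg \<theta>0 by (auto intro!: Bochner_Integration.integral_nonneg)
    have "ennreal gain = (\<integral>\<^sup>+p. ennreal (rate g p * (\<theta> (fst p) * \<theta> (fst (snd p)))) \<partial>?\<Pi>)"
      unfolding gain_def using rate_nonneg \<theta>0 by (intro nn_integral_eq_integral[symmetric] i_gain) simp
    also have "\<dots> = (\<integral>\<^sup>+p. ennreal (rate g p) * (\<lambda>(v, w). ennreal (\<theta> v * \<theta> w)) (fst p, fst (snd p)) \<partial>?\<Pi>)"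
      using rate_nonneg \<theta>0 by (simp add: ennreal_mult)
    also have "\<dots> = (\<integral>\<^sup>+v. (\<integral>\<^sup>+w. ennreal (g w * g v * norm (v - w) powr \<beta>) * (\<lambda>(v, w). ennreal (\<theta> v * \<theta> w)) (v, w) \<partial>lborel) \<partial>lborel)"
      by (rule nn_integral_rate) (measurable, rule g_nonneg, measurable)
    also have "\<dots> \<le> (\<integral>\<^sup>+v. (\<integral>\<^sup>+w. ?t v * ?s w + ?s v * ?t w \<partial>lborel) \<partial>lborel)"
    proof (intro nn_integral_mono)
      fix v w :: 'a
      have "norm (v - w) powr \<beta> * (g w * \<theta> w * (g v * \<theta> v)) \<le> (norm v powr \<beta> + norm w powr \<beta>) * (g w * \<theta> w * (g v * \<theta> v))"
        using g_nonneg \<theta>0 by (intro mult_right_mono norm_diff_powr_le beta) simp_all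
      then have "ennreal (g w * g v * norm (v - w) powr \<beta> * (\<theta> v * \<theta> w))
        \<le> ennreal (g v * (norm v powr \<beta> * \<theta> v) * (g w * \<theta> w) + g v * \<theta> v * (g w * (norm w powr \<beta> * \<theta> w)))"
        by (intro ennreal_leI) (simp add: algebra_simps)
      then show "ennreal (g w * g v * norm (v - w) powr \<beta>) * (\<lambda>(v, w). ennreal (\<theta> v * \<theta> w)) (v, w) \<le> ?t v * ?s w + ?s v * ?t w"
        using g_nonneg \<theta>0 by (simp add: ennreal_mult[symmetric] ennreal_plus[symmetric] del: ennreal_plus)
    qed
    also have "\<dots> = ennreal (2 * (T * (\<integral>v. g v * \<theta> v \<partial>lborel)))"
      using T0 by (simp add: nn_integral_add nn_integral_cmult nn_integral_multc t s ennreal_mult[symmetric] ennreal_plus[symmetric] del: ennreal_plus)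
    finally show ?thesis using T0 by (simp add: ennreal_le_iff)
  qed
  have loss: "\<eta> * (mass / 4) * (L - R powr \<beta> * exp_tail (a * R\<^sup>2) * mass) \<le> loss"
  proof -
    \<comment> \<open>The indicator of the velocities to which \<open>collision_frequency_ge\<close>
      applies; on the others the weighted \<open>\<psi>\<close> is bounded by a constant, which is
      charged to the mass.\<close>
    define I where "I v = (if R \<le> norm v then 1 else 0 :: real)" for v :: 'a
    have [measurable]: "I \<in> borel_measurable borel" unfolding I_def by measurable
    have i_I: "integrable lborel (\<lambda>v. g v * (norm v powr \<beta> * (I v * \<psi> v)))"
      by (rule integrable_weight[where C="exp_tail N"]) (measurable, intro bound2, auto simp: I_def \<psi>0 \<psi>b intro: order_trans[OF \<psi>0 \<psi>b])
    have "L \<le> (\<integral>v. g v * (norm v powr \<beta> * (I v * \<psi> v)) + R powr \<beta> * exp_tail (a * R\<^sup>2) * g v \<partial>lborel)"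
      unfolding L_def
    proof (rule integral_mono[OF i_L])
      fix v
      have "norm v powr \<beta> * \<psi> v \<le> norm v powr \<beta> * (I v * \<psi> v) + R powr \<beta> * exp_tail (a * R\<^sup>2)"
      proof (cases "R \<le> norm v")
        case True
        then show ?thesis by (simp add: I_def exp_tail_nonneg)
      next
        case False
        then have "(norm v)\<^sup>2 \<le> R\<^sup>2" by (intro power_mono) simp_all
        then have "a * (norm v)\<^sup>2 \<le> a * R\<^sup>2" using a by (intro mult_left_mono) simp_all
        then have "X v \<le> a * R\<^sup>2" using X(3)[of v] by linarith
        then have "\<psi> v \<le> exp_tail (a * R\<^sup>2)" unfolding \<psi>X by (intro exp_tail_mono X)
        moreover have "norm v powr \<beta> \<le> R powr \<beta>" using False beta by (intro powr_mono2) simp_all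
        ultimately have "norm v powr \<beta> * \<psi> v \<le> R powr \<beta> * exp_tail (a * R\<^sup>2)"
          using \<psi>0 by (intro mult_mono) simp_all
        then show ?thesis by (simp add: I_def False)
      qed
      then have "g v * (norm v powr \<beta> * \<psi> v) \<le> g v * (norm v powr \<beta> * (I v * \<psi> v) + R powr \<beta> * exp_tail (a * R\<^sup>2))"
        by (rule mult_left_mono[OF _ g_nonneg])
      then show "g v * (norm v powr \<beta> * \<psi> v) \<le> g v * (norm v powr \<beta> * (I v * \<psi> v)) + R powr \<beta> * exp_tail (a * R\<^sup>2) * g v"
        by (simp add: algebra_simps)
    qed (use i_I i_m in simp)
    then have "L - R powr \<beta> * exp_tail (a * R\<^sup>2) * mass \<le> (\<integral>v. g v * (norm v powr \<beta> * (I v * \<psi> v)) \<partial>lborel)"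
      using i_I i_m by simp
    then have "\<eta> * (mass / 4) * (L - R powr \<beta> * exp_tail (a * R\<^sup>2) * mass)
       \<le> \<eta> * (mass / 4) * (\<integral>v. g v * (norm v powr \<beta> * (I v * \<psi> v)) \<partial>lborel)"
      using \<eta> mass_nonneg by (intro mult_left_mono) simp_all
    also have "\<dots> \<le> loss"
    proof -
      have "ennreal (\<eta> * (mass / 4) * (\<integral>v. g v * (norm v powr \<beta> * (I v * \<psi> v)) \<partial>lborel))
        = (\<integral>\<^sup>+v. ennreal (\<eta> * (mass / 4) * (g v * (norm v powr \<beta> * (I v * \<psi> v)))) \<partial>lborel)"
        using i_I \<eta> mass_nonneg g_nonneg \<psi>0 by (subst nn_integral_eq_integral) (auto simp: I_def)
      also have "\<dots> \<le> (\<integral>\<^sup>+v. (\<integral>\<^sup>+w. ennreal (\<eta> * g v * \<psi> v) * ennreal (g w * norm (v - w) powr \<beta>) \<partial>lborel) \<partial>lborel)"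
      proof (rule nn_integral_mono)
        fix v
        show "ennreal (\<eta> * (mass / 4) * (g v * (norm v powr \<beta> * (I v * \<psi> v))))
          \<le> (\<integral>\<^sup>+w. ennreal (\<eta> * g v * \<psi> v) * ennreal (g w * norm (v - w) powr \<beta>) \<partial>lborel)"
        proof (cases "R \<le> norm v")
          case True
          have "ennreal (\<eta> * (mass / 4) * (g v * (norm v powr \<beta> * (I v * \<psi> v))))
             = ennreal (\<eta> * g v * \<psi> v) * ennreal (mass / 4 * norm v powr \<beta>)"
            using True \<eta> g_nonneg \<psi>0 mass_nonneg by (simp add: I_def ennreal_mult[symmetric] mult_ac)
          also have "\<dots> \<le> ennreal (\<eta> * g v * \<psi> v) * (\<integral>\<^sup>+w. ennreal (g w * norm (v - w) powr \<beta>) \<partial>lborel)"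
            by (intro mult_left_mono collision_frequency_ge[OF R True]) simp
          finally show ?thesis by (subst nn_integral_cmult) measurable
        qed (simp add: I_def)
      qed
      \<comment> \<open>The angular bound is used with \<open>e = sgn (v + w)\<close>, which varies
        with the partner; this is why \<eta> has to be uniform in \<open>e\<close>.\<close>
      also have "\<dots> \<le> (\<integral>\<^sup>+v. (\<integral>\<^sup>+w. (\<integral>\<^sup>+\<sigma>. ennreal (rate g (v, w, \<sigma>) * (k (v, w, \<sigma>) * \<psi> v)) \<partial>angular_measure) \<partial>lborel) \<partial>lborel)"
      proof (intro nn_integral_mono)
        fix v w :: 'a
        have "ennreal (\<eta> * g v * \<psi> v) * ennreal (g w * norm (v - w) powr \<beta>)
          = ennreal (g w * g v * \<psi> v) * ennreal (\<eta> * norm (v - w) powr \<beta>)"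
          using \<eta> g_nonneg \<psi>0 by (simp add: ennreal_mult[symmetric] mult_ac)
        also have "\<dots> \<le> ennreal (g w * g v * \<psi> v) * (\<integral>\<^sup>+\<sigma>. ennreal (B (v - w) \<sigma> * max 0 (1 - (sgn (v + w) \<bullet> \<sigma>)\<^sup>2)) \<partial>angular_measure)"
          by (intro mult_left_mono \<eta>(2)) (simp_all add: norm_sgn)
        also have "\<dots> = (\<integral>\<^sup>+\<sigma>. ennreal (g w * g v * \<psi> v) * ennreal (B (v - w) \<sigma> * max 0 (1 - (sgn (v + w) \<bullet> \<sigma>)\<^sup>2)) \<partial>angular_measure)"
          by (rule nn_integral_cmult[symmetric]) simp
        also have "\<dots> = (\<integral>\<^sup>+\<sigma>. ennreal (rate g (v, w, \<sigma>) * (k (v, w, \<sigma>) * \<psi> v)) \<partial>angular_measure)"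
          using g_nonneg \<psi>0 by (intro nn_integral_cong) (simp add: rate_def k_def ennreal_mult[symmetric] mult_ac)
        finally show "ennreal (\<eta> * g v * \<psi> v) * ennreal (g w * norm (v - w) powr \<beta>)
          \<le> (\<integral>\<^sup>+\<sigma>. ennreal (rate g (v, w, \<sigma>) * (k (v, w, \<sigma>) * \<psi> v)) \<partial>angular_measure)" .
      qed
      also have "\<dots> = (\<integral>\<^sup>+p. ennreal (rate g p * (k p * \<psi> (fst p))) \<partial>?\<Pi>)"
        by (subst nn_integral_collision_measure) simp_all
      also have "\<dots> = ennreal loss"
        unfolding loss_def using rate_nonneg k \<psi>0 by (intro nn_integral_eq_integral i_loss) simp
      finally show ?thesis
        using rate_nonneg k \<psi>0 by (subst (asm) ennreal_le_iff) (auto simp: loss_def intro!: Bochner_Integration.integral_nonneg)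
    qed
    finally show ?thesis .
  qed
  define C where "C = exp_tail N + (exp N - 1) * N"
  have \<phi>: "\<bar>\<phi> v\<bar> \<le> C" for v
    unfolding \<phi>_def C_def using a N by (intro trunc_exp_tail_linear_growth) simp_all
  have "(\<integral>v. \<phi> v * net_rate g v \<partial>lborel) = (\<integral>p. rate g p * collision_average \<phi> p \<partial>?\<Pi>)"
    by (rule weak_form(2)[OF _ \<phi>]) measurable
  also have "\<dots> \<le> (\<integral>p. rate g p * (\<theta> (fst p) * \<theta> (fst (snd p))) / 2 - rate g p * (k p * \<psi> (fst p)) / 4 \<partial>?\<Pi>)"
  proof (rule integral_mono_AE)
    show "integrable ?\<Pi> (\<lambda>p. rate g p * collision_average \<phi> p)"
    proof (rule integrable_rate_mult[where C="2 * C"])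
      fix p :: "'a \<times> 'a \<times> 'a"
      obtain v w \<sigma> where p: "p = (v, w, \<sigma>)" by (cases p)
      show "\<bar>collision_average \<phi> p\<bar> \<le> 2 * C"
        using \<phi>[of v] \<phi>[of w] \<phi>[of "post_velocity v w \<sigma>"] \<phi>[of "post_velocity_star v w \<sigma>"] by (simp add: p collision_average_def)
    qed (unfold collision_average_def, measurable)
    show "integrable ?\<Pi> (\<lambda>p. rate g p * (\<theta> (fst p) * \<theta> (fst (snd p))) / 2 - rate g p * (k p * \<psi> (fst p)) / 4)"
      using i_gain i_loss by (intro Bochner_Integration.integrable_diff Bochner_Integration.integrable_divide) auto
    show "AE p in ?\<Pi>. rate g p * collision_average \<phi> p
       \<le> rate g p * (\<theta> (fst p) * \<theta> (fst (snd p))) / 2 - rate g p * (k p * \<psi> (fst p)) / 4"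
      using AE_collision_norm
    proof eventually_elim
      case (elim p)
      obtain v w \<sigma> where p: "p = (v, w, \<sigma>)" by (cases p)
      have n: "norm \<sigma> = 1" using elim by (simp add: p)
      have "\<bar>sgn (v + w) \<bullet> \<sigma>\<bar> \<le> norm (sgn (v + w)) * norm \<sigma>" by (rule Cauchy_Schwarz_ineq2)
      also have "\<dots> \<le> 1" using n by (simp add: norm_sgn)
      finally have "k p = 1 - (sgn (v + w) \<bullet> \<sigma>)\<^sup>2" by (simp add: k_def p abs_square_le_1)
      then have P_le: "P (post_velocity v w \<sigma>) + P (post_velocity_star v w \<sigma>) - P v - P w \<le> \<theta> v * \<theta> w - k p * \<psi> v / 2"
        using povzner[OF n a, of N v w] N unfolding P_def \<theta>_def X_def \<psi>_def by simp
      \<comment> \<open>The subtracted multiple of |v|^2 is a collision invariant, so \<phi> and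
        \<open>P\<close> have the same collision average and the Povzner inequality for
        \<open>P\<close> applies.\<close>
      have "(exp N - 1) * a * ((norm (post_velocity v w \<sigma>))\<^sup>2 + (norm (post_velocity_star v w \<sigma>))\<^sup>2)
           = (exp N - 1) * a * ((norm v)\<^sup>2 + (norm w)\<^sup>2)"
        by (simp only: energy_conservation[OF n])
      then have "\<phi> (post_velocity v w \<sigma>) + \<phi> (post_velocity_star v w \<sigma>) - \<phi> v - \<phi> w
          = P (post_velocity v w \<sigma>) + P (post_velocity_star v w \<sigma>) - P v - P w"
        by (simp add: \<phi>_def P_def algebra_simps)
      with P_le have "rate g p * collision_average \<phi> p
        \<le> rate g p * ((\<theta> v * \<theta> w - k p * \<psi> v / 2) / 2)"
        unfolding p collision_average_def prod.case by (intro mult_left_mono rate_nonneg divide_right_mono) simp_all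
      then show ?case by (simp add: p field_simps)
    qed
  qed
  also have "\<dots> = gain / 2 - loss / 4"
    unfolding gain_def loss_def using i_gain i_loss by simp
  also have "\<dots> \<le> T * (\<integral>v. g v * \<theta> v \<partial>lborel) - \<eta> * mass / 16 * (L - R powr \<beta> * exp_tail (a * R\<^sup>2) * mass)"
    using gain loss by simp
  also have "T * (\<integral>v. g v * \<theta> v \<partial>lborel) \<le> (2 * L + ?c * energy) * (z + a * energy)"
    using T z\<theta> g_nonneg \<theta>0 \<psi>0 a energy_nonneg
    by (intro mult_mono) (auto simp: L_def intro!: Bochner_Integration.integral_nonneg add_nonneg_nonneg mult_nonneg_nonneg)
  finally show ?thesis unfolding z_def by simp
qed

end

text \<open>A continuity argument gives \<open>\<delta>\<close> on a time step of fixed length, uniformly in \<open>n\<close>; only then can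
  \<open>n \<rightarrow> \<infinity>\<close> turn the damping by \<open>zh n\<close> into a damping of the limit and restore \<open>\<delta>/2\<close>.\<close>

lemma truncated_damping_bound:
  fixes z zh :: "nat \<Rightarrow> real \<Rightarrow> real" and \<delta> k :: real
  assumes cont: "\<And>n. continuous_on {0..} (z n)" "\<And>n. continuous_on {0..} (zh n)"
    and nonneg: "\<And>n t. 0 \<le> t \<Longrightarrow> 0 \<le> zh n t"
    and le: "\<And>n t. 0 \<le> t \<Longrightarrow> zh n t \<le> z n t"
    and limit: "\<And>t. 0 \<le> t \<Longrightarrow> (\<And>n. zh n t \<le> \<delta>) \<Longrightarrow> \<exists>l. (\<lambda>n. zh n t) \<longlonglongrightarrow> l \<and> (\<lambda>n. z n t) \<longlonglongrightarrow> l \<and> (\<forall>n. z n t \<le> l)"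
    and initial: "\<And>n. z n 0 \<le> \<delta> / 2"
    and growth: "\<And>n s t. 0 \<le> s \<Longrightarrow> s < t \<Longrightarrow> (\<And>\<tau>. s \<le> \<tau> \<Longrightarrow> \<tau> \<le> t \<Longrightarrow> zh n \<tau> \<le> \<delta>)
       \<Longrightarrow> z n t - z n s \<le> integral {s..t} (\<lambda>\<tau>. k * (\<delta> / 2 - zh n \<tau>))"
    and pos: "0 < \<delta>" "0 < k"
    and t: "0 \<le> t"
  shows "z n t \<le> \<delta> / 2"
proof -
  \<comment> \<open>The drift is at most \<open>k * \<delta> / 2\<close>, so a step of this length
    raises \<open>z n\<close> by at most \<open>\<delta> / 4\<close>, from
    \<open>\<delta> / 2\<close> to a value below \<delta>.\<close>
  define T where "T = 1 / (2 * k)"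
  have T: "0 < T" "k * T = 1 / 2" using pos by (simp_all add: T_def)
  let ?q = "\<lambda>n \<tau>. k * (\<delta> / 2 - zh n \<tau>)"
  have int: "(?q n) integrable_on {s..t}" if "0 \<le> s" for s t n
    using that by (intro integrable_continuous_interval continuous_intros continuous_on_subset[OF cont(2)]) auto
  have int_le: "integral {s..t} (?q n) \<le> (t - s) * (k * \<delta> / 2)" if "0 \<le> s" "s \<le> t" for s t n
  proof -
    have "integral {s..t} (?q n) \<le> integral {s..t} (\<lambda>\<tau>. k * \<delta> / 2)"
      using that pos nonneg by (intro integral_le int) (auto simp: algebra_simps)
    also have "\<dots> = (t - s) * (k * \<delta> / 2)" using that by simp
    finally show ?thesis .
  qed
  have step: "z n t \<le> \<delta> / 2"
    if t0: "0 \<le> t0" "\<And>n. z n t0 \<le> \<delta> / 2" and t: "t0 \<le> t" "t \<le> t0 + T" for t0 t n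
  proof -
    have small: "z n s \<le> \<delta>" if s: "t0 \<le> s" "s \<le> t0 + T" for n s
    proof (rule ccontr)
      assume "\<not> z n s \<le> \<delta>"
      then have gt: "\<delta> < z n s" by simp
      have c: "continuous_on {t0..r} (z n)" for r
        using t0 by (intro continuous_on_subset[OF cont(1)]) auto
      have ivt: "\<exists>q. t0 \<le> q \<and> q \<le> r \<and> z n q = \<delta>" if "t0 \<le> r" "\<delta> < z n r" for r
      proof -
        have "z n t0 \<le> \<delta>" using t0(2)[of n] pos by simp
        then show ?thesis using IVT'[of "z n" t0 \<delta> r, OF _ less_imp_le[OF that(2)] that(1) c] by blast
      qed
      \<comment> \<open>The least element of \<open>S\<close> is the first time at which
        \<open>z n\<close> reaches \<delta>. Up to then
        \<open>zh n \<le> z n \<le> \<delta>\<close>, so the growth hypothesis applies.\<close>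
      define S where "S = {r \<in> {t0..s}. z n r = \<delta>}"
      have "closedin (top_of_set {t0..s}) S"
        unfolding S_def by (rule continuous_closedin_preimage_constant[OF c])
      then have "compact S" by (metis compact_Icc closedin_compact)
      moreover have "S \<noteq> {}"
        using ivt[OF s(1) gt] by (auto simp: S_def)
      ultimately have "\<exists>r\<in>S. \<forall>q\<in>S. r \<le> q" by (rule compact_attains_inf)
      then obtain r where r: "r \<in> S" "\<And>q. q \<in> S \<Longrightarrow> r \<le> q" by blast
      have r': "t0 \<le> r" "r \<le> s" "z n r = \<delta>" using r by (auto simp: S_def)
      have "t0 \<noteq> r" using r' t0(2)[of n] pos by auto
      then have "t0 < r" using r' by simp
      have below: "zh n \<tau> \<le> \<delta>" if "t0 \<le> \<tau>" "\<tau> \<le> r" for \<tau>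
      proof (rule ccontr)
        assume "\<not> zh n \<tau> \<le> \<delta>"
        then have "\<delta> < z n \<tau>" using le[of \<tau> n] that t0 by simp
        then obtain q where "t0 \<le> q" "q \<le> \<tau>" "z n q = \<delta>"
          using ivt[OF \<open>t0 \<le> \<tau>\<close>] by blast
        moreover have "q \<noteq> \<tau>" using \<open>\<delta> < z n \<tau>\<close> \<open>z n q = \<delta>\<close> by auto
        ultimately show False using r(2)[of q] that r' by (auto simp: S_def)
      qed
      have "z n r - z n t0 \<le> (r - t0) * (k * \<delta> / 2)"
        using growth[OF t0(1) \<open>t0 < r\<close> below] int_le[of t0 r n] t0 r' by simp
      also have "\<dots> \<le> T * (k * \<delta> / 2)" using r' s pos by (intro mult_right_mono) simp_all
      also have "\<dots> = \<delta> / 4" using T by (simp add: algebra_simps)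
      finally show False using t0(2)[of n] r' pos by simp
    qed
    have "\<forall>s. \<exists>l. t0 \<le> s \<and> s \<le> t0 + T \<longrightarrow> (\<lambda>n. zh n s) \<longlonglongrightarrow> l \<and> (\<lambda>n. z n s) \<longlonglongrightarrow> l \<and> (\<forall>n. z n s \<le> l)"
    proof
      fix s
      show "\<exists>l. t0 \<le> s \<and> s \<le> t0 + T \<longrightarrow> (\<lambda>n. zh n s) \<longlonglongrightarrow> l \<and> (\<lambda>n. z n s) \<longlonglongrightarrow> l \<and> (\<forall>n. z n s \<le> l)"
      proof (cases "t0 \<le> s \<and> s \<le> t0 + T")
        case True
        then have "zh n s \<le> \<delta>" for n using le[of s n] small[of s n] t0 by simp
        then show ?thesis using limit[of s] True t0 by auto
      qed blast
    qed
    from choice[OF this] obtain Z where Z: "\<And>s. t0 \<le> s \<Longrightarrow> s \<le> t0 + T \<Longrightarrow> (\<lambda>n. zh n s) \<longlonglongrightarrow> Z s"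
        "\<And>s. t0 \<le> s \<Longrightarrow> s \<le> t0 + T \<Longrightarrow> (\<lambda>n. z n s) \<longlonglongrightarrow> Z s"
        "\<And>s n. t0 \<le> s \<Longrightarrow> s \<le> t0 + T \<Longrightarrow> z n s \<le> Z s"
      by blast
    have "Z t \<le> \<delta> / 2"
    proof (rule ccontr)
      assume "\<not> Z t \<le> \<delta> / 2"
      then have Zt: "\<delta> / 2 < Z t" by simp
      let ?Q = "\<lambda>\<tau>. k * (\<delta> / 2 - Z \<tau>)"
      \<comment> \<open>As a pointwise limit, \<open>Z\<close> is not known to be continuous. The
        last time with \<open>Z \<le> \<delta> / 2\<close> is therefore taken as a supremum, which
        need not belong to \<open>A\<close>.\<close>
      define A where "A = {s \<in> {t0..t}. Z s \<le> \<delta> / 2}"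
      define s0 where "s0 = Sup A"
      have "Z t0 \<le> \<delta> / 2" using Z(2)[of t0] t0(2) T by (intro LIMSEQ_le_const2) auto
      then have A: "t0 \<in> A" using t by (simp add: A_def)
      have bdd: "bdd_above A" by (auto simp: A_def bdd_above_def)
      have s0: "t0 \<le> s0" unfolding s0_def by (rule cSup_upper[OF A bdd])
      have s0t: "s0 \<le> t" unfolding s0_def by (rule cSup_least) (use A in \<open>auto simp: A_def\<close>)
      note s0 = s0 s0t
      have above: "\<delta> / 2 < Z s" if "s0 < s" "s \<le> t" for s
      proof (rule ccontr)
        assume "\<not> \<delta> / 2 < Z s"
        then have "s \<in> A" using that s0 by (simp add: A_def)
        then show False using cSup_upper[OF _ bdd, of s] that(1) by (simp add: s0_def)
      qed
      have Z01: "0 \<le> Z s" "Z s \<le> \<delta>" if "t0 \<le> s" "s \<le> t0 + T" for s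
      proof -
        show "0 \<le> Z s" using Z(1)[OF that] nonneg t0 that by (intro LIMSEQ_le_const[OF Z(1)[OF that]]) auto
        show "Z s \<le> \<delta>" using small that by (intro LIMSEQ_le_const2[OF Z(2)[OF that]]) auto
      qed
      have conv: "?Q integrable_on {s0..t}"
         "(\<lambda>n. integral {s0..t} (?q n)) \<longlonglongrightarrow> integral {s0..t} ?Q"
      proof -
        have 1: "(?q n) integrable_on {s0..t}" for n
          using s0 t0 by (intro int) simp
        have 2: "(\<lambda>_. k * \<delta>) integrable_on {s0..t}" by (rule integrable_const_ivl)
        have 3: "norm (k * (\<delta> / 2 - zh n \<tau>)) \<le> k * \<delta>" if "\<tau> \<in> {s0..t}" for n \<tau>
        proof -
          have "0 \<le> zh n \<tau>" "zh n \<tau> \<le> \<delta>"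
            using that s0 t0 t nonneg[of \<tau> n] le[of \<tau> n] small[of \<tau> n] by auto
          then have "\<bar>\<delta> / 2 - zh n \<tau>\<bar> \<le> \<delta>" using pos by (simp add: abs_le_iff)
          then show ?thesis using pos by (simp add: abs_mult)
        qed
        have 4: "(\<lambda>n. k * (\<delta> / 2 - zh n \<tau>)) \<longlonglongrightarrow> k * (\<delta> / 2 - Z \<tau>)" if "\<tau> \<in> {s0..t}" for \<tau>
          using that s0 t by (intro tendsto_intros Z) auto
        note dominated_convergence[OF 1 2 3 4]
        then show "?Q integrable_on {s0..t}"
         "(\<lambda>n. integral {s0..t} (?q n)) \<longlonglongrightarrow> integral {s0..t} ?Q"
          by blast+
      qed
      have int0: "integral {s0..t} ?Q \<le> 0"
      proof -
        \<comment> \<open>The sign of the integrand is known strictly after \<open>s0\<close>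
          only.\<close>
        have "integral {s0..t} ?Q = integral {s0<..<t} ?Q"
          by (simp add: integral_open_interval_real)
        also have "\<dots> \<le> integral {s0<..<t} (\<lambda>\<tau>. 0 :: real)"
        proof (rule integral_le)
          show "?Q integrable_on {s0<..<t}"
            using conv(1) by (simp add: integrable_on_open_interval_real)
          show "k * (\<delta> / 2 - Z \<tau>) \<le> 0" if "\<tau> \<in> {s0<..<t}" for \<tau>
            using above[of \<tau>] that pos by (simp add: mult_nonneg_nonpos)
        qed (rule integrable_0)
        finally show ?thesis by simp
      qed
      have "Z t \<le> \<delta> / 2 + e" if e: "0 < e" for e
      proof -
        \<comment> \<open>Starting from a point of \<open>A\<close> within distance \<open>d\<close>
          of \<open>s0\<close> costs at most \<open>e\<close>, since the drift up to
          \<open>s0\<close> is bounded by \<open>k * \<delta> / 2\<close>.\<close>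
        define d where "d = e / (k * \<delta> / 2)"
        have d: "0 < d" "d * (k * \<delta> / 2) = e" using e pos by (simp_all add: d_def)
        obtain s where s: "s \<in> A" "s0 - d < s"
        proof -
          have "A \<noteq> {}" "s0 - d < Sup A" using A d by (auto simp: s0_def)
          then show ?thesis using less_cSup_iff[OF _ bdd, of "s0 - d"] that by blast
        qed
        have s': "t0 \<le> s" "s \<le> t" "Z s \<le> \<delta> / 2" "s \<le> s0"
          using s cSup_upper[OF s(1) bdd] by (auto simp: A_def s0_def)
        have "s \<noteq> t" using s' Zt by auto
        then have st: "s < t" using s' by simp
        have "z n t \<le> \<delta> / 2 + e + integral {s0..t} (?q n)" for n
        proof -
          have "z n t - z n s \<le> integral {s..t} (?q n)"
          proof (rule growth[OF _ st])
            show "zh n \<tau> \<le> \<delta>" if "s \<le> \<tau>" "\<tau> \<le> t" for \<tau>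
              using that s' t0 t le[of \<tau> n] small[of \<tau> n] by simp
          qed (use s' t0 in simp)
          also have "\<dots> = integral {s..s0} (?q n) + integral {s0..t} (?q n)"
            using s' s0 t0 by (intro Henstock_Kurzweil_Integration.integral_combine[symmetric] int) simp_all
          also have "integral {s..s0} (?q n) \<le> (s0 - s) * (k * \<delta> / 2)"
            using s' t0 by (intro int_le) simp_all
          also have "\<dots> \<le> d * (k * \<delta> / 2)" using s pos by (intro mult_right_mono) simp_all
          finally show ?thesis using Z(3)[of s n] s' t d by simp
        qed
        then have "Z t \<le> \<delta> / 2 + e + integral {s0..t} ?Q"
          using t by (intro LIMSEQ_le[OF Z(2) tendsto_add[OF tendsto_const conv(2)]]) auto
        then show ?thesis using int0 by simp
      qed
      then have "Z t \<le> \<delta> / 2" by (rule field_le_epsilon)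
      then show False using Zt by simp
    qed
    then show ?thesis using Z(3)[of t n] t by simp
  qed
  have "\<forall>n t. 0 \<le> t \<and> t \<le> real j * T \<longrightarrow> z n t \<le> \<delta> / 2" for j
  proof (induction j)
    case 0
    then show ?case using initial by (metis mult_zero_left of_nat_0 order_antisym)
  next
    case (Suc j)
    show ?case
    proof (intro allI impI)
      fix n t assume t: "0 \<le> t \<and> t \<le> real (Suc j) * T"
      show "z n t \<le> \<delta> / 2"
      proof (cases "t \<le> real j * T")
        case True
        then show ?thesis using Suc t by blast
      next
        case False
        show ?thesis
        proof (rule step)
          show "0 \<le> real j * T" using T by simp
          then show "z m (real j * T) \<le> \<delta> / 2" for m using Suc by blast
          show "real j * T \<le> t" "t \<le> real j * T + T" using False t by (simp_all add: distrib_right)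
        qed
      qed
    qed
  qed
  moreover obtain j :: nat where "t / T \<le> real j" using real_arch_simple by blast
  then have "t \<le> real j * T" using T by (simp add: field_simps)
  ultimately show ?thesis using t by blast
qed

section \<open>Evolution of moments\<close>

context cutoff_kernel
begin

lemma net_rate_measurable_pair:
  assumes g: "(\<lambda>(t, v). g t v) \<in> borel_measurable (borel \<Otimes>\<^sub>M borel)"
  shows "(\<lambda>(\<tau>, v). net_rate (g \<tau>) v) \<in> borel_measurable (lborel \<Otimes>\<^sub>M lborel)"
proof -
  have g': "(\<lambda>x. g (a x) (b x)) \<in> borel_measurable M"
    if "a \<in> borel_measurable M" "b \<in> borel_measurable M" for a b and M :: "'c measure"
    using measurable_compose[OF measurable_Pair[OF that] g] by simp
  have "(\<lambda>x. \<integral>q. rate (g (fst x)) (collision_map (snd x, q)) - rate (g (fst x)) (snd x, q) \<partial>partner_measure)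
    \<in> borel_measurable (lborel \<Otimes>\<^sub>M (lborel :: 'a measure))"
    unfolding rate_def collision_map_def split_beta fst_conv snd_conv
    by (rule velocity_angle.borel_measurable_lebesgue_integral, unfold split_beta)
      (intro borel_measurable_diff borel_measurable_times g' B_measurable; measurable)
  then show ?thesis by (simp add: net_rate_def[abs_def] split_beta')
qed

lemma collision_operator_angular:
  assumes [measurable]: "g \<in> borel_measurable borel"
  shows "collision_operator B g v = (\<integral>w. (\<integral>\<sigma>. collision_integrand B g v w \<sigma>
        \<partial>angular_measure) \<partial>lborel)"
  unfolding collision_operator_def
  by (intro Bochner_Integration.integral_cong refl integral_sphere_measure) measurable

lemma collision_operator_measurable_pair:
  assumes g: "(\<lambda>(t, v). g t v) \<in> borel_measurable (borel \<Otimes>\<^sub>M borel)"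
  shows "(\<lambda>(\<tau>, v). collision_operator B (g \<tau>) v) \<in> borel_measurable (lborel \<Otimes>\<^sub>M lborel)"
proof -
  have g': "(\<lambda>x. g (a x) (b x)) \<in> borel_measurable M"
    if "a \<in> borel_measurable M" "b \<in> borel_measurable M" for a b and M :: "'c measure"
    using measurable_compose[OF measurable_Pair[OF that] g] by simp
  have "g t \<in> borel_measurable borel" for t
    using measurable_compose[OF measurable_Pair1' g, of t] by simp
  then have eq: "collision_operator B (g \<tau>) v = (\<integral>w. (\<integral>\<sigma>. (g \<tau> (post_velocity_star v w \<sigma>) * g \<tau> (post_velocity v w \<sigma>) - g \<tau> w * g \<tau> v)
      * B (v - w) \<sigma> \<partial>angular_measure) \<partial>lborel)" for \<tau> v
    by (rule collision_operator_angular)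
  show ?thesis
    unfolding eq split_beta
    by (rule lborel.borel_measurable_lebesgue_integral, unfold split_beta,
        rule angular.borel_measurable_lebesgue_integral, unfold split_beta)
      (intro borel_measurable_diff borel_measurable_times g' B_measurable; measurable)
qed

end

text \<open>A representative of the solution that is nonnegative everywhere and jointly measurable
  in time and velocity, with its evolution driven by \<open>net_rate\<close>. The exceptional null
  set of velocities is the same for all \<open>s\<close> and \<open>t\<close>.\<close>

locale kinetic_evolution = cutoff_kernel B \<beta> h
  for B :: "'a::euclidean_space \<Rightarrow> 'a \<Rightarrow> real" and \<beta> h +
  fixes g :: "real \<Rightarrow> 'a \<Rightarrow> real" and mass energy :: real
  assumes g_measurable_pair: "(\<lambda>(t, v). g t v) \<in> borel_measurable (borel \<Otimes>\<^sub>M borel)"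
    and g_nonneg: "\<And>t v. 0 \<le> g t v"
    and g_mass: "\<And>t. 0 \<le> t \<Longrightarrow> has_bochner_integral lborel (g t) mass"
    and g_energy: "\<And>t. 0 \<le> t \<Longrightarrow> has_bochner_integral lborel (\<lambda>v. g t v * (norm v)\<^sup>2) energy"
    and g_continuous: "\<And>t. 0 \<le> t \<Longrightarrow> ((\<lambda>s. \<integral>v. \<bar>g s v - g t v\<bar> \<partial>lborel) \<longlongrightarrow> 0) (at t within {0..})"
    and g_evolution: "AE v in lborel. \<forall>s t. 0 \<le> s \<and> s < t \<longrightarrow>
       set_integrable lborel {s..t} (\<lambda>\<tau>. net_rate (g \<tau>) v) \<and>
       g t v - g s v = (LINT \<tau>:{s..t}|lborel. net_rate (g \<tau>) v)"
begin

lemma kinetic_state_at: "0 \<le> t \<Longrightarrow> kinetic_state B \<beta> h (g t) mass energy"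
  using g_nonneg g_mass g_energy by unfold_locales auto

lemma g_measurable [measurable]: "g t \<in> borel_measurable borel"
  using measurable_compose[OF measurable_Pair1' g_measurable_pair, of t] by simp

lemma g_integrable: "0 \<le> t \<Longrightarrow> integrable lborel (g t)"
  using g_mass by (auto simp: has_bochner_integral_iff)

lemma integrable_bounded_moment:
  assumes [measurable]: "\<phi> \<in> borel_measurable borel" and \<phi>: "\<And>v. \<bar>\<phi> v\<bar> \<le> C" and t: "0 \<le> t"
  shows "integrable lborel (\<lambda>v. \<phi> v * g t v)"
proof (rule Bochner_Integration.integrable_bound)
  show "integrable lborel (\<lambda>v. C * g t v)" using g_integrable[OF t] by simp
  show "AE v in lborel. norm (\<phi> v * g t v) \<le> norm (C * g t v)"
  proof (rule AE_I2)
    fix v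
    have "\<bar>\<phi> v\<bar> * \<bar>g t v\<bar> \<le> \<bar>C\<bar> * \<bar>g t v\<bar>" using \<phi>[of v] by (intro mult_right_mono) auto
    then show "norm (\<phi> v * g t v) \<le> norm (C * g t v)" by (simp add: abs_mult)
  qed
qed measurable

text \<open>Continuity in time is given in the L1 norm, which controls moments with bounded
  weights.\<close>

lemma continuous_on_bounded_moment:
  assumes [measurable]: "\<phi> \<in> borel_measurable borel" and \<phi>: "\<And>v. \<bar>\<phi> v\<bar> \<le> C"
  shows "continuous_on {0..} (\<lambda>t. \<integral>v. \<phi> v * g t v \<partial>lborel)"
  unfolding continuous_on
proof
  fix t :: real assume "t \<in> {0..}"
  then have t: "0 \<le> t" by simp
  have "((\<lambda>s. (\<integral>v. \<phi> v * g s v \<partial>lborel) - (\<integral>v. \<phi> v * g t v \<partial>lborel)) \<longlongrightarrow> 0) (at t within {0..})"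
  proof (rule Lim_null_comparison)
    show "((\<lambda>s. C * (\<integral>v. \<bar>g s v - g t v\<bar> \<partial>lborel)) \<longlongrightarrow> 0) (at t within {0..})"
      using tendsto_mult_right_zero[OF g_continuous[OF t]] .
    show "\<forall>\<^sub>F s in at t within {0..}. norm ((\<integral>v. \<phi> v * g s v \<partial>lborel) - (\<integral>v. \<phi> v * g t v \<partial>lborel)) \<le> C * (\<integral>v. \<bar>g s v - g t v\<bar> \<partial>lborel)"
      unfolding eventually_at_filter
    proof (intro always_eventually allI impI)
      fix s :: real assume "s \<in> {0..}"
      then have s: "0 \<le> s" by simp
      have i: "integrable lborel (\<lambda>v. g s v - g t v)" using g_integrable s t by simp
      have "(\<integral>v. \<phi> v * g s v \<partial>lborel) - (\<integral>v. \<phi> v * g t v \<partial>lborel) = (\<integral>v. \<phi> v * g s v - \<phi> v * g t v \<partial>lborel)"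
        by (rule Bochner_Integration.integral_diff[symmetric]) (rule integrable_bounded_moment[OF assms], fact)+
      then have "norm ((\<integral>v. \<phi> v * g s v \<partial>lborel) - (\<integral>v. \<phi> v * g t v \<partial>lborel)) \<le> (\<integral>v. norm (\<phi> v * g s v - \<phi> v * g t v) \<partial>lborel)"
        by (simp only: integral_norm_bound)
      also have "\<dots> \<le> (\<integral>v. C * \<bar>g s v - g t v\<bar> \<partial>lborel)"
      proof (rule integral_mono)
        show "integrable lborel (\<lambda>v. norm (\<phi> v * g s v - \<phi> v * g t v))"
          by (intro integrable_norm Bochner_Integration.integrable_diff integrable_bounded_moment[OF assms] s t)
        show "integrable lborel (\<lambda>v. C * \<bar>g s v - g t v\<bar>)" using integrable_abs[OF i] by simp
        fix v
        have "norm (\<phi> v * g s v - \<phi> v * g t v) = \<bar>\<phi> v\<bar> * \<bar>g s v - g t v\<bar>" by (simp flip: right_diff_distrib add: abs_mult)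
        also have "\<dots> \<le> C * \<bar>g s v - g t v\<bar>" using \<phi> by (intro mult_right_mono) simp_all
        finally show "norm (\<phi> v * g s v - \<phi> v * g t v) \<le> C * \<bar>g s v - g t v\<bar>" .
      qed
      finally show "norm ((\<integral>v. \<phi> v * g s v \<partial>lborel) - (\<integral>v. \<phi> v * g t v \<partial>lborel)) \<le> C * (\<integral>v. \<bar>g s v - g t v\<bar> \<partial>lborel)"
        by simp
    qed
  qed
  then show "((\<lambda>s. \<integral>v. \<phi> v * g s v \<partial>lborel) \<longlongrightarrow> (\<integral>v. \<phi> v * g t v \<partial>lborel)) (at t within {0..})"
    by (rule LIM_zero_cancel)
qed

lemma net_rate_measurable [measurable]: "(\<lambda>(\<tau>, v). net_rate (g \<tau>) v) \<in> borel_measurable (lborel \<Otimes>\<^sub>M lborel)"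
  by (rule net_rate_measurable_pair[OF g_measurable_pair])

text \<open>Fubini in time and velocity: the absolute integral of the net rate is at most
  \<open>4 * (mass + energy)\<^sup>2\<close> at every time, so the integrand is integrable over a
  bounded time interval.\<close>

lemma moment_evolution:
  assumes [measurable]: "\<phi> \<in> borel_measurable borel" and \<phi>: "\<And>v. \<bar>\<phi> v\<bar> \<le> C" and s: "0 \<le> s" "s < t"
  shows "set_integrable lborel {s..t} (\<lambda>\<tau>. \<integral>v. \<phi> v * net_rate (g \<tau>) v \<partial>lborel)"
    and "(\<integral>v. \<phi> v * g t v \<partial>lborel) - (\<integral>v. \<phi> v * g s v \<partial>lborel)
       = (LINT \<tau>:{s..t}|lborel. (\<integral>v. \<phi> v * net_rate (g \<tau>) v \<partial>lborel))"
proof -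
  define F where "F \<tau> v = indicator {s..t} \<tau> * (\<phi> v * net_rate (g \<tau>) v)" for \<tau> v
  have C: "0 \<le> C" using \<phi>[of 0] by simp
  have [measurable]: "(\<lambda>(\<tau>, v). F \<tau> v) \<in> borel_measurable (lborel \<Otimes>\<^sub>M lborel)"
    unfolding F_def by measurable
  have iF: "integrable lborel (F \<tau>)" for \<tau>
  proof (cases "\<tau> \<in> {s..t}")
    case True
    then interpret kinetic_state B \<beta> h "g \<tau>" mass energy using s by (intro kinetic_state_at) simp
    show ?thesis unfolding F_def using weak_form(1)[OF _ \<phi>] True by simp
  qed (simp add: F_def[abs_def])
  have bF: "(\<integral>v. norm (F \<tau> v) \<partial>lborel) \<le> indicator {s..t} \<tau> * (C * (4 * (mass + energy)\<^sup>2))" for \<tau>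
  proof (cases "\<tau> \<in> {s..t}")
    case True
    then interpret kinetic_state B \<beta> h "g \<tau>" mass energy using s by (intro kinetic_state_at) simp
    have "(\<integral>v. norm (F \<tau> v) \<partial>lborel) \<le> (\<integral>v. C * \<bar>net_rate (g \<tau>) v\<bar> \<partial>lborel)"
    proof (rule integral_mono)
      show "integrable lborel (\<lambda>v. C * \<bar>net_rate (g \<tau>) v\<bar>)" using integrable_net_rate by simp
      show "norm (F \<tau> v) \<le> C * \<bar>net_rate (g \<tau>) v\<bar>" for v
        using True \<phi> by (simp add: F_def abs_mult mult_right_mono)
    qed (intro integrable_norm iF)
    also have "\<dots> = C * (\<integral>v. \<bar>net_rate (g \<tau>) v\<bar> \<partial>lborel)" by simp
    also have "\<dots> \<le> C * (4 * (mass + energy)\<^sup>2)" by (intro mult_left_mono integral_abs_net_rate_le C)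
    finally show ?thesis using True by simp
  qed (simp add: F_def)
  have F: "integrable (lborel \<Otimes>\<^sub>M lborel) (\<lambda>(\<tau>, v). F \<tau> v)"
  proof (rule lborel_pair.Fubini_integrable)
    show "integrable lborel (\<lambda>\<tau>. \<integral>v. norm ((\<lambda>(\<tau>, v). F \<tau> v) (\<tau>, v)) \<partial>lborel)"
    proof (rule Bochner_Integration.integrable_bound)
      show "integrable lborel (\<lambda>\<tau>. indicator {s..t} \<tau> * (C * (4 * (mass + energy)\<^sup>2)))"
        using s by (intro integrable_mult_left) (simp add: emeasure_lborel_Icc)
      show "AE \<tau> in lborel. norm (\<integral>v. norm ((\<lambda>(\<tau>, v). F \<tau> v) (\<tau>, v)) \<partial>lborel)
          \<le> norm (indicator {s..t} \<tau> * (C * (4 * (mass + energy)\<^sup>2)))"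
      proof (rule AE_I2)
        fix \<tau>
        have "0 \<le> (\<integral>v. norm (F \<tau> v) \<partial>lborel)" by (intro Bochner_Integration.integral_nonneg) simp
        then show "norm (\<integral>v. norm ((\<lambda>(\<tau>, v). F \<tau> v) (\<tau>, v)) \<partial>lborel)
          \<le> norm (indicator {s..t} \<tau> * (C * (4 * (mass + energy)\<^sup>2)))"
          using bF[of \<tau>] by simp
      qed
    qed measurable
    show "AE \<tau> in lborel. integrable lborel (\<lambda>v. (\<lambda>(\<tau>, v). F \<tau> v) (\<tau>, v))" using iF by simp
  qed measurable
  have eq: "indicator {s..t} \<tau> *\<^sub>R (\<integral>v. \<phi> v * net_rate (g \<tau>) v \<partial>lborel) = (\<integral>v. F \<tau> v \<partial>lborel)" for \<tau>
    by (simp add: F_def)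
  show "set_integrable lborel {s..t} (\<lambda>\<tau>. \<integral>v. \<phi> v * net_rate (g \<tau>) v \<partial>lborel)"
    unfolding set_integrable_def eq by (rule lborel_pair.integrable_fst[OF F])
  have "(LINT \<tau>:{s..t}|lborel. (\<integral>v. \<phi> v * net_rate (g \<tau>) v \<partial>lborel)) = (\<integral>\<tau>. (\<integral>v. F \<tau> v \<partial>lborel) \<partial>lborel)"
    unfolding set_lebesgue_integral_def eq ..
  also have "\<dots> = (\<integral>v. (\<integral>\<tau>. F \<tau> v \<partial>lborel) \<partial>lborel)"
    by (rule lborel_pair.Fubini_integral[OF F, symmetric])
  also have "\<dots> = (\<integral>v. \<phi> v * g t v - \<phi> v * g s v \<partial>lborel)"
  proof (rule integral_cong_AE)
    show "(\<lambda>v. \<integral>\<tau>. F \<tau> v \<partial>lborel) \<in> borel_measurable lborel"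
      using lborel_pair.integrable_snd[OF F] by auto
    show "AE v in lborel. (\<integral>\<tau>. F \<tau> v \<partial>lborel) = \<phi> v * g t v - \<phi> v * g s v"
      using g_evolution
    proof eventually_elim
      case (elim v)
      have "(\<integral>\<tau>. F \<tau> v \<partial>lborel) = (\<integral>\<tau>. \<phi> v * (indicator {s..t} \<tau> * net_rate (g \<tau>) v) \<partial>lborel)"
        unfolding F_def by (intro Bochner_Integration.integral_cong refl) (simp add: mult_ac)
      also have "\<dots> = \<phi> v * (LINT \<tau>:{s..t}|lborel. net_rate (g \<tau>) v)"
        by (simp add: set_lebesgue_integral_def)
      also have "\<dots> = \<phi> v * (g t v - g s v)" using elim s by simp
      finally show ?case by (simp add: algebra_simps)
    qed
  qed measurable
  also have "\<dots> = (\<integral>v. \<phi> v * g t v \<partial>lborel) - (\<integral>v. \<phi> v * g s v \<partial>lborel)"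
    using s by (intro Bochner_Integration.integral_diff integrable_bounded_moment[OF assms(1,2)]) simp_all
  finally show "(\<integral>v. \<phi> v * g t v \<partial>lborel) - (\<integral>v. \<phi> v * g s v \<partial>lborel)
       = (LINT \<tau>:{s..t}|lborel. (\<integral>v. \<phi> v * net_rate (g \<tau>) v \<partial>lborel))" ..
qed

end

section \<open>Propagation of the exponential moment\<close>

context kinetic_evolution
begin

text \<open>All constants serve one inequality: while \<open>zh n \<le> \<delta>\<close>, the moment
  \<open>z n\<close> grows at most at the rate \<open>c / 2 * (\<delta> / 2 - zh n)\<close>. This is
  the growth hypothesis of \<open>truncated_damping_bound\<close>.\<close>

lemma exponential_moment_bound:
  assumes dim: "2 \<le> DIM('a)" and a0: "0 < a0" and init: "integrable lborel (\<lambda>v. exp (a0 * (norm v)\<^sup>2) * g 0 v)"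
  shows "\<exists>C a. 0 < a \<and> (\<forall>t\<ge>0. integrable lborel (\<lambda>v. exp (a * (norm v)\<^sup>2) * g t v) \<and>
    (\<integral>v. exp (a * (norm v)\<^sup>2) * g t v \<partial>lborel) \<le> C)"
proof (cases "mass = 0")
  \<comment> \<open>Without mass the damping coefficient would vanish, but so does the
    solution.\<close>
  case True
  have "integrable lborel (\<lambda>v. exp (1 * (norm v)\<^sup>2) * g t v) \<and> (\<integral>v. exp (1 * (norm v)\<^sup>2) * g t v \<partial>lborel) \<le> 0" if t: "0 \<le> t" for t
  proof -
    have "integral\<^sup>L lborel (g t) = 0" using g_mass[OF t] True by (simp add: has_bochner_integral_iff)
    then have "AE v in lborel. g t v = 0"
      using integral_nonneg_eq_0_iff_AE[OF g_integrable[OF t]] g_nonneg by simp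
    then have ae: "AE v in lborel. exp (1 * (norm v)\<^sup>2) * g t v = 0" by eventually_elim simp
    then have "integrable lborel (\<lambda>v. exp (1 * (norm v)\<^sup>2) * g t v) \<longleftrightarrow> integrable lborel (\<lambda>v::'a. 0::real)"
      by (intro integrable_cong_AE) measurable
    moreover have "(\<integral>v. exp (1 * (norm v)\<^sup>2) * g t v \<partial>lborel) = 0"
      using integral_cong_AE[OF _ _ ae] by simp
    ultimately show ?thesis by simp
  qed
  then show ?thesis by (intro exI[of _ 0] exI[of _ 1]) auto
next
  case False
  interpret s0: kinetic_state B \<beta> h "g 0" mass energy by (rule kinetic_state_at) simp
  have mass: "0 < mass" using False s0.mass_nonneg by simp
  have energy: "0 \<le> energy" by (rule s0.energy_nonneg)
  define R where "R = sqrt (8 * energy / mass) + 1"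
  have R: "0 < R" using energy mass by (simp add: R_def add_nonneg_pos)
  have "8 * energy / mass = (sqrt (8 * energy / mass))\<^sup>2" using energy mass by simp
  also have "\<dots> \<le> R\<^sup>2" unfolding R_def using energy mass by (intro power_mono) simp_all
  finally have R2: "8 * energy \<le> mass * R\<^sup>2" using mass by (simp add: field_simps)
  obtain \<eta> where \<eta>: "0 < \<eta>" "\<And>u e :: 'a. norm e \<le> 1 \<Longrightarrow>
      ennreal (\<eta> * norm u powr \<beta>) \<le> (\<integral>\<^sup>+\<sigma>. ennreal (B u \<sigma> * max 0 (1 - (e \<bullet> \<sigma>)\<^sup>2)) \<partial>angular_measure)"
    using angular_dissipation[OF dim] by blast
  define c where "c = \<eta> * mass / 16"
  \<comment> \<open>While the excess moment is at most \<delta>, its sum with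
    \<open>a * energy\<close> is at most \<open>2 * \<delta> = c / 4\<close>, and the part of the
    gain proportional to \<open>L\<close> takes at most half of the damping
    \<open>c * L\<close>.\<close>
  define \<delta> where "\<delta> = c / 8"
  have c: "0 < c" "0 < \<delta>" using \<eta>(1) mass by (simp_all add: c_def \<delta>_def)
  define J where "J = (\<integral>v. exp (a0 * (norm v)\<^sup>2) * g 0 v \<partial>lborel)"
  \<comment> \<open>What is left once the gain is absorbed: velocities below 1 when \<open>L\<close>
    is compared with \<open>zh\<close>, the linear part of the gain, and velocities below
    \<open>R\<close>. All three tend to 0 with \<open>a\<close>, while \<open>R\<close>,
    \<open>c\<close> and \<delta> are fixed before \<open>a\<close> is chosen.\<close>
  let ?err = "\<lambda>a. exp_tail a * mass / 2 + sqrt (2 * a) * energy / 4 + R powr \<beta> * exp_tail (a * R\<^sup>2) * mass"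
  obtain a where a: "0 < a" "a < 1" "a < a0" "a * energy < \<delta>" "(a / a0)\<^sup>2 * J < \<delta> / 2"
     "?err a < \<delta> / 4"
  proof -
    have "((\<lambda>a. a * energy) \<longlongrightarrow> 0 * energy) (at_right 0)" by (intro tendsto_intros)
    then have e1: "\<forall>\<^sub>F a in at_right 0. a * energy < \<delta>" using c by (intro order_tendstoD(2)) auto
    have "((\<lambda>a. (a / a0)\<^sup>2 * J) \<longlongrightarrow> (0 / a0)\<^sup>2 * J) (at_right 0)" using a0 by (intro tendsto_intros) simp
    then have e2: "\<forall>\<^sub>F a in at_right 0. (a / a0)\<^sup>2 * J < \<delta> / 2" using c by (intro order_tendstoD(2)) auto
    have "(?err
      \<longlongrightarrow> (exp 0 - 1 - 0) * mass / 2 + sqrt (2 * 0) * energy / 4 + R powr \<beta> * (exp (0 * R\<^sup>2) - 1 - 0 * R\<^sup>2) * mass) (at_right 0)"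
      unfolding exp_tail_def by (intro tendsto_intros) simp_all
    then have e3: "\<forall>\<^sub>F a in at_right 0. ?err a < \<delta> / 4"
      using c by (intro order_tendstoD(2)) auto
    have e4: "\<forall>\<^sub>F a in at_right 0. a \<in> {0<..<min 1 a0}"
      using a0 by (intro eventually_at_right_real) simp
    have "\<forall>\<^sub>F a in at_right 0. 0 < a \<and> a < 1 \<and> a < a0 \<and> a * energy < \<delta> \<and> (a / a0)\<^sup>2 * J < \<delta> / 2 \<and>
      ?err a < \<delta> / 4"
      using e1 e2 e3 e4 by eventually_elim auto
    from eventually_happens'[OF _ this] show ?thesis using that by (auto simp: trivial_limit_at_right_real)
  qed
  \<comment> \<open>Because \<open>a < 1\<close> and \<open>\<beta> \<le> 1\<close>, the base
    \<open>2 / a\<close> exceeds 1 and the exponent may be raised to 1/2; the energy coefficient of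
    \<open>dissipation_estimate\<close> is then small with \<open>a\<close>, whatever the value of
    \<beta>.\<close>
  have \<kappa>: "(2 / a) powr (\<beta> / 2) * a \<le> sqrt (2 * a)"
  proof -
    have "(2 / a) powr (\<beta> / 2) \<le> (2 / a) powr (1 / 2)" using a beta by (intro powr_mono) (simp_all add: field_simps)
    then have "(2 / a) powr (\<beta> / 2) * a \<le> sqrt (2 / a) * a" using a by (intro mult_right_mono) (simp_all add: powr_half_sqrt)
    also have "\<dots> = sqrt (2 / a) * (sqrt a * sqrt a)" using a by simp
    also have "\<dots> = sqrt (2 / a * a * a)" by (simp only: real_sqrt_mult mult.assoc)
    also have "\<dots> = sqrt (2 * a)" using a by simp
    finally show ?thesis .
  qed
  have [measurable]: "exp_tail \<in> borel_measurable borel" unfolding exp_tail_def[abs_def] by measurable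
  have [measurable]: "trunc_exp_tail N \<in> borel_measurable borel" for N unfolding trunc_exp_tail_def[abs_def] by measurable
  \<comment> \<open>The offset meets the hypothesis \<open>2 \<le> N\<close> of
    \<open>dissipation_estimate\<close>.\<close>
  define N where "N n = real n + 2" for n
  have N: "2 \<le> N n" "0 \<le> N n" for n by (simp_all add: N_def)
  define x where "x v = a * (norm v)\<^sup>2" for v :: 'a
  have x: "0 \<le> x v" for v using a by (simp add: x_def)
  have [measurable]: "x \<in> borel_measurable borel" unfolding x_def by measurable
  define \<psi> where "\<psi> n v = exp_tail (min (x v) (N n))" for n v
  define P where "P n v = trunc_exp_tail (N n) (x v)" for n v
  define \<phi> where "\<phi> n v = P n v - (exp (N n) - 1) * x v" for n v
  define zh where "zh n t = (\<integral>v. \<psi> n v * g t v \<partial>lborel)" for n t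
  define z where "z n t = (\<integral>v. P n v * g t v \<partial>lborel)" for n t
  have [measurable]: "\<psi> n \<in> borel_measurable borel" "P n \<in> borel_measurable borel" "\<phi> n \<in> borel_measurable borel" for n
    unfolding \<psi>_def P_def \<phi>_def by measurable
  have \<psi>0: "0 \<le> \<psi> n v" for n v by (simp add: \<psi>_def exp_tail_nonneg)
  have \<psi>b: "\<bar>\<psi> n v\<bar> \<le> exp_tail (N n)" for n v
    using \<psi>0[of n v] x N by (auto simp: \<psi>_def intro!: exp_tail_mono)
  have \<phi>b: "\<bar>\<phi> n v\<bar> \<le> exp_tail (N n) + (exp (N n) - 1) * N n" for n v
    unfolding \<phi>_def P_def by (rule trunc_exp_tail_linear_growth[OF x N(2)])
  have i_\<psi>: "integrable lborel (\<lambda>v. \<psi> n v * g t v)" if "0 \<le> t" for n t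
    by (rule integrable_bounded_moment[OF _ \<psi>b that]) measurable
  have i_\<phi>: "integrable lborel (\<lambda>v. \<phi> n v * g t v)" if "0 \<le> t" for n t
    by (rule integrable_bounded_moment[OF _ \<phi>b that]) measurable
  have i_e: "integrable lborel (\<lambda>v. g t v * (norm v)\<^sup>2)" "(\<integral>v. g t v * (norm v)\<^sup>2 \<partial>lborel) = energy"
    and i_m: "integrable lborel (g t)" "integral\<^sup>L lborel (g t) = mass" if "0 \<le> t" for t
    using g_energy[OF that] g_mass[OF that] by (simp_all add: has_bochner_integral_iff)
  have P\<phi>: "P n v * g t v = \<phi> n v * g t v + (exp (N n) - 1) * a * (g t v * (norm v)\<^sup>2)" for n t v
    by (simp add: \<phi>_def x_def algebra_simps)
  have i_P: "integrable lborel (\<lambda>v. P n v * g t v)" if "0 \<le> t" for n t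
    unfolding P\<phi> using i_\<phi>[OF that] i_e[OF that] by simp
  have z_eq: "z n t = (\<integral>v. \<phi> n v * g t v \<partial>lborel) + (exp (N n) - 1) * a * energy" if "0 \<le> t" for n t
    unfolding z_def P\<phi> using i_\<phi>[OF that] i_e[OF that] by simp
  have le: "zh n t \<le> z n t" if "0 \<le> t" for n t
    unfolding zh_def z_def
    using g_nonneg exp_tail_min_le_trunc[OF x N(2)]
    by (intro integral_mono i_\<psi> i_P that mult_right_mono) (simp_all add: \<psi>_def P_def)
  have cont_zh: "continuous_on {0..} (zh n)" for n
    unfolding zh_def by (rule continuous_on_bounded_moment[OF _ \<psi>b]) measurable
  let ?z = "\<lambda>t. \<integral>v. exp_tail (x v) * g t v \<partial>lborel"
  \<comment> \<open>The bound by \<delta> turns monotone convergence of \<open>zh n t\<close> into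
    integrability of the untruncated excess, which then dominates the integrands of
    \<open>z n t\<close>. Both sequences therefore have the same limit.\<close>
  have lim: "integrable lborel (\<lambda>v. exp_tail (x v) * g t v) \<and>
      (\<lambda>n. zh n t) \<longlonglongrightarrow> ?z t \<and>
      (\<lambda>n. z n t) \<longlonglongrightarrow> ?z t \<and>
      (\<forall>n. z n t \<le> ?z t)"
    if t: "0 \<le> t" and b: "\<And>n. zh n t \<le> \<delta>" for t
  proof -
    have mono: "mono (\<lambda>n. \<psi> n v * g t v)" for v
      unfolding \<psi>_def N_def using x g_nonneg by (intro monoI mult_right_mono exp_tail_mono) auto
    have ev: "\<forall>\<^sub>F n in sequentially. x v \<le> N n" for v
    proof -
      obtain m :: nat where "x v \<le> real m" using real_arch_simple by blast
      then show ?thesis by (auto simp: N_def eventually_sequentially intro!: exI[of _ m])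
    qed
    have lim\<psi>: "(\<lambda>n. \<psi> n v * g t v) \<longlonglongrightarrow> exp_tail (x v) * g t v" for v
      by (rule tendsto_eventually, rule eventually_mono[OF ev[of v]]) (simp add: \<psi>_def)
    have limP: "(\<lambda>n. P n v * g t v) \<longlonglongrightarrow> exp_tail (x v) * g t v" for v
      by (rule tendsto_eventually, rule eventually_mono[OF ev[of v]]) (simp add: P_def trunc_exp_tail_eq)
    have "incseq (\<lambda>n. zh n t)"
      unfolding zh_def using mono by (intro incseq_SucI integral_mono i_\<psi> t) (auto simp: mono_def)
    then obtain l where l: "(\<lambda>n. zh n t) \<longlonglongrightarrow> l"
      using b incseq_convergent[of "\<lambda>n. zh n t" \<delta>] by blast
    have 1: "integrable lborel (\<lambda>v. exp_tail (x v) * g t v)"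
      by (rule integrable_monotone_convergence[OF i_\<psi>[OF t] AE_I2[OF mono] AE_I2[OF lim\<psi>] l[unfolded zh_def]]) measurable
    have 2: "?z t = l"
      by (rule integral_monotone_convergence[OF i_\<psi>[OF t] AE_I2[OF mono] AE_I2[OF lim\<psi>] l[unfolded zh_def]]) measurable
    have Ple: "P n v \<le> exp_tail (x v)" for n v by (simp add: P_def trunc_exp_tail_le)
    have P0: "0 \<le> P n v" for n v
      using exp_tail_min_le_trunc[OF x N(2), of v n] exp_tail_nonneg order_trans unfolding P_def by blast
    have 3: "(\<lambda>n. z n t) \<longlonglongrightarrow> ?z t"
      unfolding z_def
    proof (rule integral_dominated_convergence[OF _ _ 1])
      show "AE v in lborel. norm (P n v * g t v) \<le> exp_tail (x v) * g t v" for n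
        using P0 Ple g_nonneg by (intro AE_I2) (simp add: mult_right_mono)
    qed (use limP in simp_all)
    have 4: "z n t \<le> ?z t" for n
      unfolding z_def using Ple g_nonneg by (intro integral_mono i_P 1 t mult_right_mono) auto
    show ?thesis using 1 2 3 4 l by simp
  qed
  have initial: "z n 0 \<le> \<delta> / 2" for n
  proof -
    have "z n 0 \<le> (\<integral>v. (a / a0)\<^sup>2 * (exp (a0 * (norm v)\<^sup>2) * g 0 v) \<partial>lborel)"
      unfolding z_def
    proof (rule integral_mono)
      fix v
      have "P n v \<le> exp_tail ((a / a0) * (a0 * (norm v)\<^sup>2))"
        using a0 trunc_exp_tail_le[of "N n" "x v"] by (simp add: P_def x_def)
      also have "\<dots> \<le> (a / a0)\<^sup>2 * exp_tail (a0 * (norm v)\<^sup>2)"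
        using a a0 by (intro exp_tail_scale_le) simp_all
      also have "\<dots> \<le> (a / a0)\<^sup>2 * exp (a0 * (norm v)\<^sup>2)"
      proof (rule mult_left_mono)
        have "0 \<le> a0 * (norm v)\<^sup>2" using a0 by simp
        then show "exp_tail (a0 * (norm v)\<^sup>2) \<le> exp (a0 * (norm v)\<^sup>2)" unfolding exp_tail_def by linarith
      qed simp
      finally show "P n v * g 0 v \<le> (a / a0)\<^sup>2 * (exp (a0 * (norm v)\<^sup>2) * g 0 v)"
        using g_nonneg by (simp add: mult_right_mono flip: mult.assoc)
    qed (use i_P init in simp_all)
    also have "\<dots> = (a / a0)\<^sup>2 * J" by (simp add: J_def)
    finally show ?thesis using a by simp
  qed
  have growth: "z n t - z n s \<le> integral {s..t} (\<lambda>\<tau>. c / 2 * (\<delta> / 2 - zh n \<tau>))"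
    if s: "0 \<le> s" "s < t" and b: "\<And>\<tau>. s \<le> \<tau> \<Longrightarrow> \<tau> \<le> t \<Longrightarrow> zh n \<tau> \<le> \<delta>" for n s t
  proof -
    have si: "set_integrable lborel {s..t} (\<lambda>\<tau>. c / 2 * (\<delta> / 2 - zh n \<tau>))"
      using s by (intro borel_integrable_atLeastAtMost' continuous_intros continuous_on_subset[OF cont_zh]) auto
    \<comment> \<open>The energy part of \<open>z_eq\<close> is constant in time and cancels, which
      leaves a bounded test function.\<close>
    have "z n t - z n s = (\<integral>v. \<phi> n v * g t v \<partial>lborel) - (\<integral>v. \<phi> n v * g s v \<partial>lborel)"
      using s by (simp add: z_eq)
    also have "\<dots> = (LINT \<tau>:{s..t}|lborel. (\<integral>v. \<phi> n v * net_rate (g \<tau>) v \<partial>lborel))"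
      by (rule moment_evolution(2)[OF _ \<phi>b s]) measurable
    also have "\<dots> \<le> (LINT \<tau>:{s..t}|lborel. c / 2 * (\<delta> / 2 - zh n \<tau>))"
    proof (rule set_integral_mono[OF _ si])
      show "set_integrable lborel {s..t} (\<lambda>\<tau>. \<integral>v. \<phi> n v * net_rate (g \<tau>) v \<partial>lborel)"
        by (rule moment_evolution(1)[OF _ \<phi>b s]) measurable
      fix \<tau> assume "\<tau> \<in> {s..t}"
      then have \<tau>: "0 \<le> \<tau>" and zb: "zh n \<tau> \<le> \<delta>" using s b by auto
      interpret s: kinetic_state B \<beta> h "g \<tau>" mass energy by (rule kinetic_state_at[OF \<tau>])
      define L where "L = (\<integral>v. g \<tau> v * (norm v powr \<beta> * \<psi> n v) \<partial>lborel)"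
      have i_L: "integrable lborel (\<lambda>v. g \<tau> v * (norm v powr \<beta> * \<psi> n v))"
      proof (rule s.integrable_weight)
        fix v
        have "norm v powr \<beta> * \<psi> n v \<le> (1 + (norm v)\<^sup>2) * exp_tail (N n)"
          using \<psi>0[of n v] \<psi>b[of n v] powr_le_one_plus_square[OF norm_ge_zero beta, of v] by (intro mult_mono) simp_all
        then show "\<bar>norm v powr \<beta> * \<psi> n v\<bar> \<le> exp_tail (N n) * (1 + (norm v)\<^sup>2)"
          using \<psi>0[of n v] by (simp add: mult.commute)
      qed measurable
      have L0: "0 \<le> L" unfolding L_def using g_nonneg \<psi>0 by (intro Bochner_Integration.integral_nonneg) simp
      have "zh n \<tau> \<le> (\<integral>v. g \<tau> v * (norm v powr \<beta> * \<psi> n v) + exp_tail a * g \<tau> v \<partial>lborel)"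
        unfolding zh_def
      proof (rule integral_mono[OF i_\<psi>[OF \<tau>]])
        fix v
        \<comment> \<open>The damping controls the weighted moment. The weight falls below 1 only
          for |v| < 1, and there \<open>x v \<le> a\<close>.\<close>
        have "\<psi> n v \<le> norm v powr \<beta> * \<psi> n v + exp_tail a"
        proof (cases "1 \<le> norm v")
          case True
          then have "1 * \<psi> n v \<le> norm v powr \<beta> * \<psi> n v" using beta \<psi>0 by (intro mult_right_mono ge_one_powr_ge_zero) simp_all
          then show ?thesis using exp_tail_nonneg[of a] by simp
        next
          case False
          then have "(norm v)\<^sup>2 \<le> 1" by (simp add: power_le_one)
          then have "x v \<le> a" using a by (simp add: x_def mult_left_le)
          then have "\<psi> n v \<le> exp_tail a" unfolding \<psi>_def using x N by (intro exp_tail_mono) auto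
          then show ?thesis using \<psi>0 by (simp add: add_increasing)
        qed
        then have "g \<tau> v * \<psi> n v \<le> g \<tau> v * (norm v powr \<beta> * \<psi> n v + exp_tail a)"
          by (rule mult_left_mono[OF _ g_nonneg])
        then show "\<psi> n v * g \<tau> v \<le> g \<tau> v * (norm v powr \<beta> * \<psi> n v) + exp_tail a * g \<tau> v"
          by (simp add: algebra_simps)
      qed (use i_L i_m[OF \<tau>] in simp)
      also have "\<dots> = L + exp_tail a * mass" using i_L i_m[OF \<tau>] by (simp add: L_def)
      finally have zL: "zh n \<tau> - exp_tail a * mass \<le> L" by simp
      let ?\<kappa> = "(2 / a) powr (\<beta> / 2) * a" and ?K = "R powr \<beta> * exp_tail (a * R\<^sup>2) * mass"
      have "(\<integral>v. \<phi> n v * net_rate (g \<tau>) v \<partial>lborel)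
        \<le> (2 * L + ?\<kappa> * energy) * (zh n \<tau> + a * energy) - c * (L - ?K)"
        using s.dissipation_estimate[OF \<eta> a(1) N(1) R R2, of n]
        unfolding L_def zh_def c_def \<phi>_def P_def \<psi>_def x_def by (simp add: mult.commute)
      also have "(2 * L + ?\<kappa> * energy) * (zh n \<tau> + a * energy) \<le> (2 * L + sqrt (2 * a) * energy) * (c / 4)"
      proof (rule mult_mono)
        show "2 * L + ?\<kappa> * energy \<le> 2 * L + sqrt (2 * a) * energy"
          using \<kappa> energy by (simp add: mult_right_mono)
        show "zh n \<tau> + a * energy \<le> c / 4" using zb a by (simp add: \<delta>_def)
        show "0 \<le> 2 * L + sqrt (2 * a) * energy" using L0 energy a by simp
        show "0 \<le> zh n \<tau> + a * energy" unfolding zh_def using g_nonneg \<psi>0 energy a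
          by (intro add_nonneg_nonneg Bochner_Integration.integral_nonneg mult_nonneg_nonneg) simp_all
      qed
      also have "(2 * L + sqrt (2 * a) * energy) * (c / 4) - c * (L - ?K)
        = c * (sqrt (2 * a) * energy / 4 + ?K) - c / 2 * L" by (simp add: field_simps)
      also have "\<dots> \<le> c * (sqrt (2 * a) * energy / 4 + ?K) - c / 2 * (zh n \<tau> - exp_tail a * mass)"
        using zL c by (intro diff_left_mono mult_left_mono) simp_all
      also have "\<dots> = c * (exp_tail a * mass / 2 + sqrt (2 * a) * energy / 4 + ?K) - c / 2 * zh n \<tau>"
        by (simp add: field_simps)
      also have "\<dots> \<le> c * (\<delta> / 4) - c / 2 * zh n \<tau>"
        using a(6) c by (intro diff_right_mono mult_left_mono) simp_all
      also have "\<dots> = c / 2 * (\<delta> / 2 - zh n \<tau>)" by (simp add: field_simps)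
      finally show "(\<integral>v. \<phi> n v * net_rate (g \<tau>) v \<partial>lborel) \<le> c / 2 * (\<delta> / 2 - zh n \<tau>)" by simp
    qed
    also have "\<dots> = integral {s..t} (\<lambda>\<tau>. c / 2 * (\<delta> / 2 - zh n \<tau>))"
      by (rule set_borel_integral_eq_integral(2)[OF si])
    finally show ?thesis .
  qed
  have bound: "z n t \<le> \<delta> / 2" if t: "0 \<le> t" for n t
  proof (rule truncated_damping_bound[where z=z and zh=zh and k="c / 2", OF _ cont_zh _ le _ initial growth _ _ t])
    have "continuous_on {0..} (\<lambda>t. (\<integral>v. \<phi> n v * g t v \<partial>lborel) + (exp (N n) - 1) * a * energy)" for n
      by (intro continuous_intros continuous_on_bounded_moment[OF _ \<phi>b]) measurable
    then show "continuous_on {0..} (z n)" for n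
      by (rule continuous_on_eq) (simp add: z_eq)
    show "0 \<le> zh n t" for n t unfolding zh_def using g_nonneg \<psi>0 by (intro Bochner_Integration.integral_nonneg) simp
    show "\<exists>l. (\<lambda>n. zh n t) \<longlonglongrightarrow> l \<and> (\<lambda>n. z n t) \<longlonglongrightarrow> l \<and> (\<forall>n. z n t \<le> l)"
      if "0 \<le> t" "\<And>n. zh n t \<le> \<delta>" for t
      using lim[OF that] by blast
    show "0 < \<delta>" "0 < c / 2" using c by simp_all
  qed
  have "integrable lborel (\<lambda>v. exp (a * (norm v)\<^sup>2) * g t v) \<and>
      (\<integral>v. exp (a * (norm v)\<^sup>2) * g t v \<partial>lborel) \<le> \<delta> / 2 + mass + a * energy" if t: "0 \<le> t" for t
  proof -
    have zb: "zh n t \<le> \<delta>" for n using le[OF t, of n] bound[OF t, of n] c by simp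
    have 1: "integrable lborel (\<lambda>v. exp_tail (x v) * g t v)"
      and 2: "(\<lambda>n. z n t) \<longlonglongrightarrow> ?z t"
      using lim[OF t zb] by blast+
    have 3: "?z t \<le> \<delta> / 2"
      using bound[OF t] by (intro LIMSEQ_le_const2[OF 2]) auto
    have eq: "exp (a * (norm v)\<^sup>2) * g t v = exp_tail (x v) * g t v + g t v + a * (g t v * (norm v)\<^sup>2)" for v
      by (simp add: exp_tail_def x_def algebra_simps)
    show ?thesis unfolding eq using 1 3 i_m[OF t] i_e[OF t] by simp
  qed
  then show ?thesis using a by blast
qed

end

section \<open>Reduction of mild solutions\<close>

lemma cos_angle_eq_inner_sgn: "cos_angle u \<sigma> = sgn u \<bullet> \<sigma>"
  by (simp add: cos_angle_def sgn_div_norm divide_inverse mult.commute)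

text \<open>The endpoints \<open>\<plusminus>1\<close> are removed in two stages, since the given \<open>h\<close> is Borel on \<open>[-1, 1]\<close>
  but possibly negative at the endpoints and arbitrary outside.\<close>

lemma cutoff_kernel_exists:
  fixes B :: "'a::euclidean_space \<Rightarrow> 'a \<Rightarrow> real"
  assumes dim: "2 \<le> DIM('a)" and B: "hard_potential_with_cutoff B"
  obtains B' \<beta> h where "cutoff_kernel B' \<beta> h"
    "\<And>g v. g \<in> borel_measurable borel \<Longrightarrow> collision_operator B g v = collision_operator B' g v"
proof -
  obtain \<beta> h where Bh: "B = hard_potential_kernel \<beta> h" and \<beta>: "0 < \<beta>" "\<beta> \<le> 1"
    and hm: "h \<in> borel_measurable (restrict_space borel {-1<..<1})" and h0: "\<And>z. z \<in> {-1<..<1} \<Longrightarrow> 0 \<le> h z"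
    and hn: "\<And>u::'a. u \<noteq> 0 \<Longrightarrow> (\<integral>\<sigma>. h (cos_angle u \<sigma>) \<partial>sphere_measure) = 1"
    using B unfolding hard_potential_with_cutoff_def by blast
  define k where "k z = (if z \<in> {-1<..<1} then h z else 0)" for z
  define l where "l z = k z + indicator {1} z * h 1 + indicator {-1} z * h (-1)" for z
  have "k = (\<lambda>z. indicator {-1<..<1} z *\<^sub>R h z)" by (auto simp: k_def)
  then have [measurable]: "k \<in> borel_measurable borel"
    using hm by (simp add: borel_measurable_restrict_space_iff)
  then have [measurable]: "l \<in> borel_measurable borel" unfolding l_def by measurable
  have hl: "h z = l z" if "\<bar>z\<bar> \<le> 1" for z
    using that by (auto simp: l_def k_def indicator_def abs_le_iff)
  have lk: "l z = k z" if "\<bar>z\<bar> < 1" for z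
    using that by (auto simp: l_def indicator_def)
  have cos_le: "\<bar>cos_angle u \<sigma>\<bar> \<le> 1" if "\<sigma> \<in> space sphere_measure" for u \<sigma> :: 'a
  proof -
    have "\<bar>sgn u \<bullet> \<sigma>\<bar> \<le> norm (sgn u) * norm \<sigma>" by (rule Cauchy_Schwarz_ineq2)
    also have "\<dots> \<le> 1" using that by (simp add: space_sphere_measure norm_sgn)
    finally show ?thesis by (simp add: cos_angle_eq_inner_sgn)
  qed
  have [measurable]: "cos_angle u \<in> borel_measurable borel" for u :: 'a
    unfolding cos_angle_def[abs_def] by measurable
  have int: "(\<integral>\<sigma>. F \<sigma> * h (cos_angle u \<sigma>) \<partial>sphere_measure) = (\<integral>\<sigma>. F \<sigma> * k (cos_angle u \<sigma>) \<partial>angular_measure)"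
    if [measurable]: "F \<in> borel_measurable borel" for F :: "'a \<Rightarrow> real" and u
  proof -
    have "(\<integral>\<sigma>. F \<sigma> * h (cos_angle u \<sigma>) \<partial>sphere_measure) = (\<integral>\<sigma>. F \<sigma> * l (cos_angle u \<sigma>) \<partial>sphere_measure)"
      by (intro Bochner_Integration.integral_cong refl) (simp add: hl cos_le)
    also have "\<dots> = (\<integral>\<sigma>. F \<sigma> * l (cos_angle u \<sigma>) \<partial>angular_measure)"
      by (rule integral_sphere_measure) measurable
    also have "\<dots> = (\<integral>\<sigma>. F \<sigma> * k (cos_angle u \<sigma>) \<partial>angular_measure)"
    proof (rule integral_cong_AE)
      have "norm (sgn u) \<le> 1" by (simp add: norm_sgn)
      from AE_angular_inner_less[OF dim this]
      show "AE \<sigma> in angular_measure. F \<sigma> * l (cos_angle u \<sigma>) = F \<sigma> * k (cos_angle u \<sigma>)"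
        by eventually_elim (simp add: lk cos_angle_eq_inner_sgn)
    qed simp_all
    finally show ?thesis .
  qed
  show ?thesis
  proof (rule that)
    show ck: "cutoff_kernel (hard_potential_kernel \<beta> k :: 'a \<Rightarrow> 'a \<Rightarrow> real) \<beta> k"
    proof
      show "(\<integral>\<sigma>. k (cos_angle u \<sigma>) \<partial>angular_measure) = 1" if "u \<noteq> 0" for u :: 'a
        using int[of "\<lambda>_. 1" u] hn[OF that] by simp
    qed (use \<beta> h0 in \<open>auto simp: k_def\<close>)
    fix g :: "'a \<Rightarrow> real" and v assume [measurable]: "g \<in> borel_measurable borel"
    have "collision_operator B g v = (\<integral>w. (\<integral>\<sigma>. ((g (post_velocity_star v w \<sigma>) * g (post_velocity v w \<sigma>) - g w * g v) * norm (v - w) powr \<beta>)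
        * h (cos_angle (v - w) \<sigma>) \<partial>sphere_measure) \<partial>lborel)"
      unfolding collision_operator_def Bh hard_potential_kernel_def by (simp add: mult.assoc)
    also have "\<dots> = (\<integral>w. (\<integral>\<sigma>. ((g (post_velocity_star v w \<sigma>) * g (post_velocity v w \<sigma>) - g w * g v) * norm (v - w) powr \<beta>)
        * k (cos_angle (v - w) \<sigma>) \<partial>angular_measure) \<partial>lborel)"
      by (intro Bochner_Integration.integral_cong refl int) measurable
    also have "\<dots> = collision_operator (hard_potential_kernel \<beta> k) g v"
      unfolding cutoff_kernel.collision_operator_angular[OF ck \<open>g \<in> borel_measurable borel\<close>] hard_potential_kernel_def
      by (simp add: mult.assoc)
    finally show "collision_operator B g v = collision_operator (hard_potential_kernel \<beta> k) g v" .
  qed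
qed

text \<open>Time rounded down to the grid of width \<open>1 / Suc n\<close> takes countably many
  values, so the rounded function is measurable; continuity in time makes these functions
  converge.\<close>

lemma measurable_continuous_in_time:
  fixes g :: "real \<Rightarrow> 'a::euclidean_space \<Rightarrow> real"
  assumes meas: "\<And>t. g t \<in> borel_measurable borel" and cont: "\<And>v t. isCont (\<lambda>t. g t v) t"
  shows "(\<lambda>(t, v). g t v) \<in> borel_measurable (borel \<Otimes>\<^sub>M borel)"
proof (rule borel_measurable_LIMSEQ_real)
  define s where "s n t = real_of_int \<lfloor>real (Suc n) * t\<rfloor> / real (Suc n)" for n t
  show "(\<lambda>(t, v). g (s n t) v) \<in> borel_measurable (borel \<Otimes>\<^sub>M borel)" for n
  proof -
    have "(\<lambda>p. (\<lambda>i p. g (real_of_int i / real (Suc n)) (snd p)) \<lfloor>real (Suc n) * fst p\<rfloor> p) \<in> borel_measurable (borel \<Otimes>\<^sub>M (borel :: 'a measure))"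
      by (rule measurable_compose_countable) (use measurable_compose[OF measurable_snd meas] in \<open>simp_all\<close>)
    then show ?thesis by (simp add: s_def split_beta')
  qed
  show "(\<lambda>n. case p of (t, v) \<Rightarrow> g (s n t) v) \<longlonglongrightarrow> (case p of (t, v) \<Rightarrow> g t v)" for p
  proof -
    have "(\<lambda>n. s n t) \<longlonglongrightarrow> t" for t
    proof (rule LIMSEQ_I)
      fix e :: real assume "0 < e"
      then obtain m :: nat where m: "inverse (real (Suc m)) < e" using reals_Archimedean by blast
      have "norm (s n t - t) < e" if "m \<le> n" for n
      proof -
        have "\<bar>real_of_int \<lfloor>real (Suc n) * t\<rfloor> - real (Suc n) * t\<bar> \<le> 1" by linarith
        then have "\<bar>real_of_int \<lfloor>real (Suc n) * t\<rfloor> - real (Suc n) * t\<bar> / real (Suc n) \<le> 1 / real (Suc n)"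
          by (intro divide_right_mono) simp_all
        also have "\<bar>real_of_int \<lfloor>real (Suc n) * t\<rfloor> - real (Suc n) * t\<bar> / real (Suc n) = \<bar>s n t - t\<bar>"
          by (simp add: s_def field_simps flip: abs_divide)
        also have "1 / real (Suc n) \<le> inverse (real (Suc m))" using that by (simp add: inverse_eq_divide frac_le)
        finally show ?thesis using m by simp
      qed
      then show "\<exists>no. \<forall>n\<ge>no. norm (s n t - t) < e" by blast
    qed
    then have "(\<lambda>n. g (s n (fst p)) (snd p)) \<longlonglongrightarrow> g (fst p) (snd p)"
      by (rule isCont_tendsto_compose[OF cont])
    then show ?thesis by (simp add: split_beta)
  qed
qed

context cutoff_kernel
begin

text \<open>The quantifiers over \<open>f\<close> and \<open>g\<close> stand inside the
  almost-everywhere statement: the exceptional velocities depend on \<open>N\<close> alone, so one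
  null set serves all times. Outgoing velocities avoid \<open>N\<close> almost everywhere because
  \<open>collision_map\<close> preserves the collision measure.\<close>

lemma collision_operator_cong_null:
  assumes N: "N \<in> null_sets lborel"
  shows "AE v in lborel. \<forall>f g. f \<in> borel_measurable borel \<longrightarrow> g \<in> borel_measurable borel \<longrightarrow>
    (\<forall>w. w \<notin> N \<longrightarrow> f w = g w) \<longrightarrow> collision_operator B f v = collision_operator B g v"
proof -
  have [measurable]: "N \<in> sets borel" using N by auto
  have ae: "AE v in lborel. v \<notin> N" by (rule AE_not_in[OF N])
  have "AE p in collision_measure. fst p \<notin> N \<and> fst (snd p) \<notin> N"
  proof (rule collision.AE_pair_measure)
    show "AE v in lborel. AE q in lborel \<Otimes>\<^sub>M (angular_measure :: 'a measure). fst (v, q) \<notin> N \<and> fst (snd (v, q)) \<notin> N"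
      using ae
    proof eventually_elim
      case (elim v)
      show ?case
      proof (rule velocity_angle.AE_pair_measure)
        show "AE w in lborel. AE \<sigma> in (angular_measure :: 'a measure). fst (v, w, \<sigma>) \<notin> N \<and> fst (snd (v, w, \<sigma>)) \<notin> N"
          using ae by eventually_elim (simp add: elim)
      qed (unfold fst_conv snd_conv, measurable)
    qed
  qed measurable
  then have "AE p in distr collision_measure collision_measure collision_map. fst p \<notin> N \<and> fst (snd p) \<notin> N"
    unfolding distr_collision_map .
  then have "AE p in collision_measure. fst (collision_map p) \<notin> N \<and> fst (snd (collision_map p)) \<notin> N"
    by (rule AE_distrD[rotated]) measurable
  then have "AE v in lborel. AE q in partner_measure. fst (collision_map (v, q)) \<notin> N \<and> fst (snd (collision_map (v, q))) \<notin> N"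
    by (rule collision.AE_pair)
  then show ?thesis
    using ae
  proof eventually_elim
    case (elim v)
    have "AE w in lborel. AE \<sigma> in angular_measure. fst (collision_map (v, w, \<sigma>)) \<notin> N \<and> fst (snd (collision_map (v, w, \<sigma>))) \<notin> N"
      using velocity_angle.AE_pair[OF elim(1)] .
    then have post: "AE w in lborel. AE \<sigma> in angular_measure. post_velocity v w \<sigma> \<notin> N \<and> post_velocity_star v w \<sigma> \<notin> N"
      by (simp add: collision_map_def)
    show ?case
    proof (intro allI impI)
      fix f g :: "'a \<Rightarrow> real"
      assume [measurable]: "f \<in> borel_measurable borel" "g \<in> borel_measurable borel" and fg: "\<forall>w. w \<notin> N \<longrightarrow> f w = g w"
      show "collision_operator B f v = collision_operator B g v"
        unfolding collision_operator_angular[OF \<open>f \<in> _\<close>] collision_operator_angular[OF \<open>g \<in> _\<close>]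
      proof (rule integral_cong_AE)
        show "AE w in lborel. (\<integral>\<sigma>. collision_integrand B f v w \<sigma> \<partial>angular_measure)
          = (\<integral>\<sigma>. collision_integrand B g v w \<sigma> \<partial>angular_measure)"
          using post ae
        proof eventually_elim
          case (elim w)
          show ?case
          proof (rule integral_cong_AE)
            show "AE \<sigma> in angular_measure. collision_integrand B f v w \<sigma>
               = collision_integrand B g v w \<sigma>"
              using elim(1) by eventually_elim (use fg elim(2) \<open>v \<notin> N\<close> in simp)
          qed measurable
        qed
      qed measurable
    qed
  qed
qed

end

text \<open>An indefinite integral is continuous. This pointwise continuity in time later gives
  joint measurability and nonnegativity at all times.\<close>

lemma continuous_on_mild:
  fixes u q :: "real \<Rightarrow> real"
  assumes "\<And>s t. 0 \<le> s \<Longrightarrow> s < t \<Longrightarrow> set_integrable lborel {s..t} q \<and> u t - u s = (LINT \<tau>:{s..t}|lborel. q \<tau>)"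
  shows "continuous_on {0..} u"
  unfolding continuous_on_eq_continuous_within
proof
  fix t :: real assume "t \<in> {0..}"
  then have t: "0 \<le> t" by simp
  have int: "set_integrable lborel {0..t + 1} q" using assms[of 0 "t + 1"] t by simp
  have "continuous_on {0..t + 1} (\<lambda>x. u 0 + integral {0..x} q)"
    by (intro continuous_intros indefinite_integral_continuous_1 set_borel_integral_eq_integral(1)[OF int])
  then have "continuous_on {0..t + 1} u"
  proof (rule continuous_on_eq)
    fix x assume x: "x \<in> {0..t + 1}"
    show "u 0 + integral {0..x} q = u x"
    proof (cases "x = 0")
      case False
      then have *: "set_integrable lborel {0..x} q" "u x - u 0 = (LINT \<tau>:{0..x}|lborel. q \<tau>)"
        using assms[of 0 x] x by auto
      show ?thesis using *(2) unfolding set_borel_integral_eq_integral(2)[OF *(1)] by simp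
    qed simp
  qed
  then have "continuous (at t within {0..t + 1}) u"
    using t by (simp add: continuous_on_eq_continuous_within)
  moreover have "at t within {0..} = at t within {0..t + 1}"
    by (rule at_within_nhd[of t "{..<t + 1}"]) auto
  ultimately show "continuous (at t within {0..}) u" by simp
qed

text \<open>Each \<open>f t\<close> is measurable in the velocity, whereas Fubini in time and
  velocity asks for joint measurability. Outside one null set of velocities the mild formula makes
  \<open>f\<close> continuous in time, and setting \<open>g\<close> to 0 on that null set yields a
  representative with both properties.\<close>

lemma mild_solution_kinetic_evolution:
  fixes B :: "'a::euclidean_space \<Rightarrow> 'a \<Rightarrow> real"
  assumes dim: "2 \<le> DIM('a)" and B: "hard_potential_with_cutoff B"
    and mild: "boltzmann_mild_solution B f0 f" and pres: "preserves_mass_and_energy f0 f"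
  obtains B' \<beta> h g where
    "kinetic_evolution B' \<beta> h g (\<integral>v. f0 v \<partial>lborel) (\<integral>v. f0 v * (norm v)\<^sup>2 \<partial>lborel)"
    "\<And>t. 0 \<le> t \<Longrightarrow> AE v in lborel. g t v = f t v"
proof -
  obtain B' \<beta> h where ck: "cutoff_kernel B' \<beta> h"
    and BB': "\<And>g v. g \<in> borel_measurable borel \<Longrightarrow> collision_operator B g v = collision_operator B' g v"
    using cutoff_kernel_exists[OF dim B] by blast
  interpret cutoff_kernel B' \<beta> h by (rule ck)
  have f_nonneg: "\<And>t. 0 \<le> t \<Longrightarrow> AE v in lborel. 0 \<le> f t v"
    and f_int: "\<And>t. 0 \<le> t \<Longrightarrow> integrable lborel (f t)"
    and f_cont: "\<And>t. 0 \<le> t \<Longrightarrow> ((\<lambda>s. \<integral>v. \<bar>f s v - f t v\<bar> \<partial>lborel) \<longlongrightarrow> 0) (at t within {0..})"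
    and f_mild: "AE v in lborel. f 0 v = f0 v \<and> (\<forall>s t. 0 \<le> s \<and> s < t \<longrightarrow>
           set_integrable lborel {s..t} (\<lambda>\<tau>. collision_operator B (f \<tau>) v) \<and>
           f t v - f s v = (LINT \<tau>:{s..t}|lborel. collision_operator B (f \<tau>) v))"
    using mild unfolding boltzmann_mild_solution_def by auto
  have f_meas: "f t \<in> borel_measurable borel" if "0 \<le> t" for t
    using f_int[OF that] by auto
  \<comment> \<open>Nonnegativity is asked at rational times, so that only countably many null sets
    are joined; continuity in time extends it to all times.\<close>
  define good where "good v \<longleftrightarrow> (\<forall>q\<in>\<rat> \<inter> {0..}. 0 \<le> f q v) \<and> (\<forall>s t. 0 \<le> s \<and> s < t \<longrightarrow>
           set_integrable lborel {s..t} (\<lambda>\<tau>. collision_operator B (f \<tau>) v) \<and>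
           f t v - f s v = (LINT \<tau>:{s..t}|lborel. collision_operator B (f \<tau>) v))" for v
  have "countable (\<rat> \<inter> {0::real..})" by (simp add: countable_rat)
  then have "AE v in lborel. \<forall>q\<in>\<rat> \<inter> {0..}. 0 \<le> f q v"
    using f_nonneg by (subst AE_ball_countable) auto
  then have "AE v in lborel. good v"
    using f_mild by eventually_elim (simp add: good_def)
  then obtain N where N: "{v. \<not> good v} \<subseteq> N" "N \<in> null_sets lborel"
    unfolding eventually_ae_filter by auto
  have [measurable]: "N \<in> sets borel" using N by auto
  have goodN: "good v" if "v \<notin> N" for v using N that by blast
  have aeN: "AE v in lborel. v \<notin> N" by (rule AE_not_in[OF N(2)])
  \<comment> \<open>Freezing time at 0 for negative \<open>t\<close> makes \<open>g\<close>
    continuous on the whole line, as \<open>measurable_continuous_in_time\<close> asks.\<close>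
  define g where "g t v = (if v \<in> N then 0 else f (max t 0) v)" for t v
  have g_meas: "g t \<in> borel_measurable borel" for t
  proof -
    have [measurable]: "f (max t 0) \<in> borel_measurable borel" by (rule f_meas) simp
    show ?thesis unfolding g_def by measurable
  qed
  have f_on: "continuous_on {0..} (\<lambda>t. f t v)" if "v \<notin> N" for v
    using goodN[OF that] unfolding good_def by (intro continuous_on_mild[where q="\<lambda>\<tau>. collision_operator B (f \<tau>) v"]) blast
  have g_isCont: "isCont (\<lambda>t. g t v) t" for v t
  proof (cases "v \<in> N")
    case False
    have "continuous_on UNIV (\<lambda>t. f (max t 0) v)"
      by (rule continuous_on_compose2[OF f_on[OF False]]) (auto intro!: continuous_intros)
    then show ?thesis using False by (simp add: g_def continuous_on_eq_continuous_at)
  qed (simp add: g_def)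
  have g_pair: "(\<lambda>(t, v). g t v) \<in> borel_measurable (borel \<Otimes>\<^sub>M borel)"
    by (rule measurable_continuous_in_time[OF g_meas g_isCont])
  have g_nonneg: "0 \<le> g t v" for t v
  proof (cases "v \<in> N")
    case False
    have "0 \<le> f s v" if s: "0 \<le> s" for s
    proof -
      have "s \<in> closure (\<rat> \<inter> {0..})"
      proof (rule closure_approachable[THEN iffD2], intro allI impI)
        fix e :: real assume "0 < e"
        then obtain r where "r \<in> \<rat>" "s < r" "r < s + e" using Rats_dense_in_real[of s "s + e"] by auto
        then show "\<exists>y\<in>\<rat> \<inter> {0..}. dist y s < e" using s by (intro bexI[of _ r]) (auto simp: dist_real_def)
      qed
      moreover have "closure (\<rat> \<inter> {0::real..}) \<subseteq> {0..}" by (rule closure_minimal) auto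
      then have "continuous_on (closure (\<rat> \<inter> {0..})) (\<lambda>t. f t v)"
        by (rule continuous_on_subset[OF f_on[OF False]])
      ultimately show ?thesis
        using goodN[OF False] continuous_ge_on_closure[of "\<rat> \<inter> {0..}" "\<lambda>t. f t v" s 0]
        by (simp add: good_def)
    qed
    then show ?thesis by (simp add: g_def)
  qed (simp add: g_def)
  have g_eq: "AE v in lborel. g t v = f t v" if "0 \<le> t" for t
    using aeN by eventually_elim (use that in \<open>simp add: g_def\<close>)
  have coll: "AE v in lborel. \<forall>\<tau>\<ge>0. collision_operator B (f \<tau>) v = collision_operator B' (g \<tau>) v"
  proof (rule eventually_mono[OF collision_operator_cong_null[OF N(2)]])
    fix v
    assume elim: "\<forall>f g. f \<in> borel_measurable borel \<longrightarrow> g \<in> borel_measurable borel \<longrightarrow>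
      (\<forall>w. w \<notin> N \<longrightarrow> f w = g w) \<longrightarrow> collision_operator B' f v = collision_operator B' g v"
    show "\<forall>\<tau>\<ge>0. collision_operator B (f \<tau>) v = collision_operator B' (g \<tau>) v"
    proof (intro allI impI)
      fix \<tau> :: real assume \<tau>: "0 \<le> \<tau>"
      have "collision_operator B' (f \<tau>) v = collision_operator B' (g \<tau>) v"
        by (rule elim[rule_format, OF f_meas[OF \<tau>] g_meas]) (use \<tau> in \<open>simp add: g_def\<close>)
      then show "collision_operator B (f \<tau>) v = collision_operator B' (g \<tau>) v" using BB'[OF f_meas[OF \<tau>]] by simp
    qed
  qed
  let ?m = "\<integral>v. f0 v \<partial>lborel" and ?e = "\<integral>v. f0 v * (norm v)\<^sup>2 \<partial>lborel"
  have g_mass: "has_bochner_integral lborel (g t) ?m"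
    and g_energy: "has_bochner_integral lborel (\<lambda>v. g t v * (norm v)\<^sup>2) ?e" if t: "0 \<le> t" for t
  proof -
    have [measurable]: "g t \<in> borel_measurable borel" "f t \<in> borel_measurable borel" using g_meas f_meas t by auto
    have "has_bochner_integral lborel (f t) ?m" "has_bochner_integral lborel (\<lambda>v. f t v * (norm v)\<^sup>2) ?e"
      using pres t unfolding preserves_mass_and_energy_def by auto
    moreover have "has_bochner_integral lborel (g t) ?m \<longleftrightarrow> has_bochner_integral lborel (f t) ?m"
      using g_eq[OF t] by (intro has_bochner_integral_cong_AE) (simp_all add: g_meas f_meas t)
    moreover have "has_bochner_integral lborel (\<lambda>v. g t v * (norm v)\<^sup>2) ?e \<longleftrightarrow> has_bochner_integral lborel (\<lambda>v. f t v * (norm v)\<^sup>2) ?e"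
      using g_eq[OF t] by (intro has_bochner_integral_cong_AE) (measurable, auto elim: eventually_mono)
    ultimately show "has_bochner_integral lborel (g t) ?m"
      "has_bochner_integral lborel (\<lambda>v. g t v * (norm v)\<^sup>2) ?e" by blast+
  qed
  \<comment> \<open>The equality is known for each \<tau> at almost every velocity; joint
    measurability of both sides allows the two almost-everywhere quantifiers to be
    exchanged.\<close>
  have net: "AE v in lborel. AE \<tau> in lborel. collision_operator B' (g \<tau>) v = net_rate (g \<tau>) v"
  proof -
    note [measurable] = net_rate_measurable_pair[OF g_pair] collision_operator_measurable_pair[OF g_pair]
    have "collision_operator B' (g \<tau>) v = net_rate (g \<tau>) v \<longleftrightarrow>
        (\<lambda>(\<tau>, v). collision_operator B' (g \<tau>) v) (\<tau>, v) = (\<lambda>(\<tau>, v). net_rate (g \<tau>) v) (\<tau>, v)" for \<tau> v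
      by simp
    moreover have "{x \<in> space (lborel \<Otimes>\<^sub>M lborel). (\<lambda>(\<tau>, v). collision_operator B' (g \<tau>) v) x = (\<lambda>(\<tau>, v). net_rate (g \<tau>) v) x}
        \<in> sets (lborel \<Otimes>\<^sub>M (lborel :: 'a measure))" by measurable
    then have "{x \<in> space (lborel \<Otimes>\<^sub>M lborel). collision_operator B' (g (fst x)) (snd x) = net_rate (g (fst x)) (snd x)}
        \<in> sets (lborel \<Otimes>\<^sub>M (lborel :: 'a measure))" by (simp add: split_beta')
    moreover have "AE v in lborel. collision_operator B' (g \<tau>) v = net_rate (g \<tau>) v" for \<tau>
    proof -
      have "g \<tau> = g (max \<tau> 0)" by (simp add: g_def fun_eq_iff)
      moreover have "kinetic_state B' \<beta> h (g (max \<tau> 0)) ?m ?e"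
        using g_nonneg g_mass g_energy by unfold_locales auto
      ultimately show ?thesis using kinetic_state.collision_operator_eq_net_rate by fastforce
    qed
    ultimately show ?thesis by (subst lborel_pair.AE_commute[symmetric]) auto
  qed
  have g_evol: "AE v in lborel. \<forall>s t. 0 \<le> s \<and> s < t \<longrightarrow>
       set_integrable lborel {s..t} (\<lambda>\<tau>. net_rate (g \<tau>) v) \<and>
       g t v - g s v = (LINT \<tau>:{s..t}|lborel. net_rate (g \<tau>) v)"
    using net coll aeN
  proof eventually_elim
    case (elim v)
    show ?case
    proof (intro allI impI)
      fix s t :: real assume st: "0 \<le> s \<and> s < t"
      have int: "set_integrable lborel {s..t} (\<lambda>\<tau>. collision_operator B (f \<tau>) v)"
        and diff: "f t v - f s v = (LINT \<tau>:{s..t}|lborel. collision_operator B (f \<tau>) v)"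
        using goodN[OF elim(3)] st unfolding good_def by blast+
      have "(\<lambda>\<tau>. net_rate (g \<tau>) v) \<in> borel_measurable lborel"
        using measurable_compose[OF measurable_Pair2' net_rate_measurable_pair[OF g_pair], of v] by simp
      then have m: "(\<lambda>\<tau>. indicator {s..t} \<tau> *\<^sub>R net_rate (g \<tau>) v) \<in> borel_measurable lborel" by measurable
      have ae: "AE \<tau> in lborel. indicator {s..t} \<tau> *\<^sub>R collision_operator B (f \<tau>) v = indicator {s..t} \<tau> *\<^sub>R net_rate (g \<tau>) v"
        using elim(1) by eventually_elim (use elim(2) st in \<open>auto simp: indicator_def\<close>)
      have 1: "set_integrable lborel {s..t} (\<lambda>\<tau>. net_rate (g \<tau>) v)"
        using integrable_cong_AE_imp[OF int[unfolded set_integrable_def] m ae] unfolding set_integrable_def .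
      have 2: "(LINT \<tau>:{s..t}|lborel. collision_operator B (f \<tau>) v) = (LINT \<tau>:{s..t}|lborel. net_rate (g \<tau>) v)"
        unfolding set_lebesgue_integral_def
        using int m ae by (intro integral_cong_AE) (auto simp: set_integrable_def)
      show "set_integrable lborel {s..t} (\<lambda>\<tau>. net_rate (g \<tau>) v) \<and> g t v - g s v = (LINT \<tau>:{s..t}|lborel. net_rate (g \<tau>) v)"
        using 1 2 diff st elim(3) by (simp add: g_def)
    qed
  qed
  have g_cont: "((\<lambda>s. \<integral>v. \<bar>g s v - g t v\<bar> \<partial>lborel) \<longlongrightarrow> 0) (at t within {0..})" if t: "0 \<le> t" for t
  proof -
    have "(\<integral>v. \<bar>g s v - g t v\<bar> \<partial>lborel) = (\<integral>v. \<bar>f s v - f t v\<bar> \<partial>lborel)" if s: "0 \<le> s" for s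
    proof (rule integral_cong_AE)
      show "AE v in lborel. \<bar>g s v - g t v\<bar> = \<bar>f s v - f t v\<bar>"
        using g_eq[OF s] g_eq[OF t] by eventually_elim simp
    qed (use g_meas f_meas s t in simp_all)
    then have "\<forall>\<^sub>F s in at t within {0..}. (\<integral>v. \<bar>f s v - f t v\<bar> \<partial>lborel) = (\<integral>v. \<bar>g s v - g t v\<bar> \<partial>lborel)"
      by (simp add: eventually_at_filter)
    then show ?thesis by (rule Lim_transform_eventually[OF f_cont[OF t]])
  qed
  have "kinetic_evolution B' \<beta> h g ?m ?e"
    using g_pair g_nonneg g_mass g_energy g_cont g_evol by unfold_locales auto
  then show ?thesis using that g_eq by blast
qed

theorem theorem4:
  fixes B :: "'a::euclidean_space \<Rightarrow> 'a \<Rightarrow> real"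
    and f0 :: "'a \<Rightarrow> real"
    and f :: "real \<Rightarrow> 'a \<Rightarrow> real"
    and a0 :: real
  assumes "2 \<le> DIM('a)"
    and "hard_potential_with_cutoff B"
    and "AE v in lborel. 0 \<le> f0 v"
    and "0 < a0"
    and "integrable lborel (\<lambda>v. f0 v / maxwellian a0 v)"
    and "boltzmann_mild_solution B f0 f"
    and "preserves_mass_and_energy f0 f"
  shows "\<exists>C a. 0 < a \<and>
    (\<forall>t\<ge>0. integrable lborel (\<lambda>v. f t v / maxwellian a v) \<and>
       (\<integral>v. f t v / maxwellian a v \<partial>lborel) \<le> C)"
proof -
  obtain B' \<beta> h g where
    ke: "kinetic_evolution B' \<beta> h g (\<integral>v. f0 v \<partial>lborel) (\<integral>v. f0 v * (norm v)\<^sup>2 \<partial>lborel)"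
    and eq: "\<And>t. 0 \<le> t \<Longrightarrow> AE v in lborel. g t v = f t v"
    using mild_solution_kinetic_evolution[OF assms(1,2,6,7)] by blast
  interpret kinetic_evolution B' \<beta> h g "\<integral>v. f0 v \<partial>lborel" "\<integral>v. f0 v * (norm v)\<^sup>2 \<partial>lborel"
    by (rule ke)
  have maxw: "x / maxwellian a v = exp (a * (norm v)\<^sup>2) * x" for x a and v :: 'a
    by (simp add: maxwellian_def exp_minus divide_inverse)
  have f_meas: "f t \<in> borel_measurable borel" if "0 \<le> t" for t
    using assms(6) that unfolding boltzmann_mild_solution_def by auto
  have "AE v in lborel. f 0 v = f0 v"
    using assms(6) unfolding boltzmann_mild_solution_def by (auto elim: eventually_mono)
  then have ae0: "AE v in lborel. exp (a0 * (norm v)\<^sup>2) * f0 v = exp (a0 * (norm v)\<^sup>2) * g 0 v"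
    using eq[OF order_refl] by eventually_elim simp
  have "integrable lborel (\<lambda>v. exp (a0 * (norm v)\<^sup>2) * g 0 v)"
    using assms(5) unfolding maxw by (rule integrable_cong_AE_imp[OF _ _ ae0]) measurable
  then obtain C a where a: "0 < a" and bound: "\<And>t. 0 \<le> t \<Longrightarrow> integrable lborel (\<lambda>v. exp (a * (norm v)\<^sup>2) * g t v) \<and>
      (\<integral>v. exp (a * (norm v)\<^sup>2) * g t v \<partial>lborel) \<le> C"
    using exponential_moment_bound[OF assms(1,4)] by blast
  have "integrable lborel (\<lambda>v. f t v / maxwellian a v) \<and> (\<integral>v. f t v / maxwellian a v \<partial>lborel) \<le> C" if t: "0 \<le> t" for t
  proof -
    have [measurable]: "f t \<in> borel_measurable borel" by (rule f_meas[OF t])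
    have ae: "AE v in lborel. exp (a * (norm v)\<^sup>2) * g t v = exp (a * (norm v)\<^sup>2) * f t v"
      using eq[OF t] by eventually_elim simp
    have "integrable lborel (\<lambda>v. exp (a * (norm v)\<^sup>2) * f t v)"
      using bound[OF t] ae by (intro integrable_cong_AE_imp[OF _ _ ae]) auto
    moreover have "(\<integral>v. exp (a * (norm v)\<^sup>2) * f t v \<partial>lborel) = (\<integral>v. exp (a * (norm v)\<^sup>2) * g t v \<partial>lborel)"
      using ae by (intro integral_cong_AE) (measurable, auto elim: eventually_mono)
    ultimately show ?thesis unfolding maxw using bound[OF t] by simp
  qed
  then show ?thesis using a by blast
qed

end
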